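(* Let $(M,\varphi,\xi_\alpha,\eta^\alpha,g)$ be a $(2n+s)$-dimensional indefinite $\mathcal{S}$-manifold, with $n\geqslant2$ and $s\geqslant1$, having pointwise constant $\varphi$-sectional curvature $c$, where $c$ is a smooth function on $M$. Then $c$ is a constant function on $M$, i.e. $M$ is an indefinite $\mathcal{S}$-space form.
   Context: All manifolds are connected, and all manifolds, tensor fields and maps are smooth. A globally framed $f$-manifold ($g.f.f$-manifold) $(M,\varphi,\xi_\alpha,\eta^\alpha)$, $\alpha\in\{1,\ldots,s\}$, $s\geqslant1$, is a $(2n+s)$-dimensional manifold with a $(1,1)$-tensor field $\varphi$ of constant rank $2n$ satisfying $\varphi^3+\varphi=0$, together with $s$ linearly independent global vector fields $\xi_\alpha$ and $s$ one-forms $\eta^\alpha$ such that $\varphi^2=-I+\sum_{\alpha=1}^s\eta^\alpha\otimes\xi_\alpha$ and $\eta^\alpha(\xi_\beta)=\delta^\alpha_\beta$. It is normal if $[\varphi,\varphi]+2\sum_{\alpha=1}^s d\eta^\alpha\otimes\xi_\alpha=0$, where $[\varphi,\varphi](X,Y)=\varphi^2[X,Y]+[\varphi X,\varphi Y]-\varphi[\varphi X,Y]-\varphi[X,\varphi Y]$. The convention for the exterior derivative of a 1-form is $2\,d\eta(X,Y)=X(\eta(Y))-Y(\eta(X))-\eta([X,Y])$. An indefinite (metric) $g.f.f$-manifold is a $g.f.f$-manifold with a semi-Riemannian metric $g$ such that $g(\varphi X,\varphi Y)=g(X,Y)-\sum_{\alpha=1}^s\varepsilon_\alpha\eta^\alpha(X)\eta^\alpha(Y)$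 for all vector fields $X,Y$, where $\varepsilon_\alpha=g(\xi_\alpha,\xi_\alpha)=\pm1$. Its fundamental 2-form is $\Phi(X,Y)=g(X,\varphi Y)$. An indefinite $\mathcal{S}$-manifold is a normal indefinite $g.f.f$-manifold such that $\Phi=d\eta^\alpha$ for every $\alpha\in\{1,\ldots,s\}$. With $\nabla$ the Levi-Civita connection of $g$, the curvature tensor is $R(X,Y,Z,W)=g(R(Z,W)Y,X)=g(([\nabla_Z,\nabla_W]-\nabla_{[Z,W]})Y,X)$. The sectional curvature of a non-degenerate plane $\pi=\mathrm{span}(x,y)\subset T_pM$ is $k_p(\pi)=R_p(x,y,x,y)/(g_p(x,x)g_p(y,y)-g_p(x,y)^2)$. For a non-lightlike unit vector $x\in\mathrm{Im}(\varphi_p)$, the $\varphi$-sectional curvature at $p$ with respect to the $\varphi$-plane $\pi=\mathrm{span}\{x,\varphi x\}$ is $k_p(\pi)$. $M$ has pointwise constant $\varphi$-sectional curvature $c$ if, at every point $p\in M$, the $\varphi$-sectional curvature at $p$ is independent of the choice of the $\varphi$-plane and equals $c(p)$. An indefinite $\mathcal{S}$-manifold with pointwise constant $\varphi$-sectional curvature is an indefinite $\mathcal{S}$-space form if the $\varphi$-sectional curvature does not depend on the point. *)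

theory Defs
  imports "HOL-Analysis.Analysis" "HOL-Library.Function_Algebras"
begin

section \<open>Smooth maps between open subsets of Euclidean spaces\<close>

text \<open>\<open>S\<close> is always open below, so derivatives are taken in the full neighbourhood filter.\<close>

fun Ck_on :: "nat \<Rightarrow> 'a::euclidean_space set \<Rightarrow> ('a \<Rightarrow> 'b::real_normed_vector) \<Rightarrow> bool" where
  "Ck_on 0 S f \<longleftrightarrow> continuous_on S f"
| "Ck_on (Suc k) S f \<longleftrightarrow>
     (\<forall>x\<in>S. f differentiable (at x)) \<and> (\<forall>v. Ck_on k S (\<lambda>x. frechet_derivative f (at x) v))"

definition smooth_on :: "'a::euclidean_space set \<Rightarrow> ('a \<Rightarrow> 'b::real_normed_vector) \<Rightarrow> bool" where
  "smooth_on S f \<longleftrightarrow> (\<forall>k. Ck_on k S f)"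

section \<open>Smooth manifolds\<close>

text \<open>The manifold is a whole type \<open>'m\<close>, Hausdorff and second countable by its sort; its smooth
  structure is the one generated by an atlas with values in the model space \<open>'e\<close>, so that the
  dimension is \<open>DIM('e)\<close>. In a chart \<open>(U, \<psi>)\<close> only the values of \<open>\<psi>\<close> on \<open>U\<close> matter.\<close>

type_synonym ('m, 'e) atlas = "('m set \<times> ('m \<Rightarrow> 'e)) set"

definition is_chart :: "'m::topological_space set \<Rightarrow> ('m \<Rightarrow> 'e::euclidean_space) \<Rightarrow> bool" where
  "is_chart U \<psi> \<longleftrightarrow> open U \<and> open (\<psi> ` U) \<and> homeomorphism U (\<psi> ` U) \<psi> (inv_into U \<psi>)"

definition smooth_atlas ::
  "('m::{t2_space, second_countable_topology}, 'e::euclidean_space) atlas \<Rightarrow> bool" where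
  "smooth_atlas A \<longleftrightarrow>
     (\<forall>(U, \<psi>)\<in>A. is_chart U \<psi>) \<and>
     (\<Union>(U, \<psi>)\<in>A. U) = UNIV \<and>
     (\<forall>(U, \<psi>)\<in>A. \<forall>(V, \<theta>)\<in>A. smooth_on (\<psi> ` (U \<inter> V)) (\<theta> \<circ> inv_into U \<psi>))"

definition smooth_fun :: "('m::topological_space, 'e::euclidean_space) atlas \<Rightarrow> 'm set \<Rightarrow> ('m \<Rightarrow> real) \<Rightarrow> bool" where
  "smooth_fun A U f \<longleftrightarrow> (\<forall>(V, \<psi>)\<in>A. smooth_on (\<psi> ` (U \<inter> V)) (f \<circ> inv_into V \<psi>))"

definition smooth_near :: "('m::topological_space, 'e::euclidean_space) atlas \<Rightarrow> 'm \<Rightarrow> ('m \<Rightarrow> real) \<Rightarrow> bool" where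
  "smooth_near A p f \<longleftrightarrow> (\<exists>U. open U \<and> p \<in> U \<and> smooth_fun A U f)"

section \<open>Tangent vectors and vector fields\<close>

instantiation "fun" :: (type, real_vector) real_vector
begin

definition scaleR_fun :: "real \<Rightarrow> ('a \<Rightarrow> 'b) \<Rightarrow> 'a \<Rightarrow> 'b" where
  "scaleR_fun r f = (\<lambda>x. r *\<^sub>R f x)"

instance
  by standard (auto simp: scaleR_fun_def fun_eq_iff scaleR_add_right scaleR_add_left)

end

text \<open>Tangent vectors at \<open>p\<close> are the derivations at \<open>p\<close> of functions that are smooth near \<open>p\<close>.
  The value \<open>0\<close> on all other functions is a normalisation that makes a tangent vector
  determined by the derivation.\<close>

type_synonym 'm tangent = "('m \<Rightarrow> real) \<Rightarrow> real"

definition tangent_space :: "('m::topological_space, 'e::euclidean_space) atlas \<Rightarrow> 'm \<Rightarrow> 'm tangent set" where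
  "tangent_space A p = {v.
     (\<forall>f. \<not> smooth_near A p f \<longrightarrow> v f = 0) \<and>
     (\<forall>f h a b. smooth_near A p f \<longrightarrow> smooth_near A p h \<longrightarrow>
        v (\<lambda>x. a * f x + b * h x) = a * v f + b * v h) \<and>
     (\<forall>f h. smooth_near A p f \<longrightarrow> smooth_near A p h \<longrightarrow>
        v (\<lambda>x. f x * h x) = f p * v h + h p * v f)}"

type_synonym 'm vfield = "'m \<Rightarrow> 'm tangent"

text \<open>Smooth vector fields on an open set \<open>U\<close>; their values outside \<open>U\<close> are irrelevant.\<close>

definition vfields :: "('m::topological_space, 'e::euclidean_space) atlas \<Rightarrow> 'm set \<Rightarrow> 'm vfield set" where
  "vfields A U = {X.
     (\<forall>p\<in>U. X p \<in> tangent_space A p) \<and>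
     (\<forall>V f. open V \<longrightarrow> V \<subseteq> U \<longrightarrow> smooth_fun A V f \<longrightarrow> smooth_fun A V (\<lambda>p. X p f))}"

definition bracket ::
  "('m::topological_space, 'e::euclidean_space) atlas \<Rightarrow> 'm vfield \<Rightarrow> 'm vfield \<Rightarrow> 'm vfield" where
  "bracket A X Y p f =
     (if smooth_near A p f then X p (\<lambda>q. Y q f) - Y p (\<lambda>q. X q f) else 0)"

section \<open>Tensor fields\<close>

definition one_form ::
  "('m::topological_space, 'e::euclidean_space) atlas \<Rightarrow> ('m \<Rightarrow> 'm tangent \<Rightarrow> real) \<Rightarrow> bool" where
  "one_form A \<eta> \<longleftrightarrow>
     (\<forall>p. \<forall>x\<in>tangent_space A p. \<forall>y\<in>tangent_space A p. \<forall>a b.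
        \<eta> p (a *\<^sub>R x + b *\<^sub>R y) = a * \<eta> p x + b * \<eta> p y) \<and>
     (\<forall>U. open U \<longrightarrow> (\<forall>X\<in>vfields A U. smooth_fun A U (\<lambda>p. \<eta> p (X p))))"

definition tensor_1_1 ::
  "('m::topological_space, 'e::euclidean_space) atlas \<Rightarrow> ('m \<Rightarrow> 'm tangent \<Rightarrow> 'm tangent) \<Rightarrow> bool" where
  "tensor_1_1 A \<phi> \<longleftrightarrow>
     (\<forall>p. \<forall>x\<in>tangent_space A p. \<phi> p x \<in> tangent_space A p) \<and>
     (\<forall>p. \<forall>x\<in>tangent_space A p. \<forall>y\<in>tangent_space A p. \<forall>a b.
        \<phi> p (a *\<^sub>R x + b *\<^sub>R y) = a *\<^sub>R \<phi> p x + b *\<^sub>R \<phi> p y) \<and>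
     (\<forall>U. open U \<longrightarrow> (\<forall>X\<in>vfields A U. (\<lambda>p. \<phi> p (X p)) \<in> vfields A U))"

definition neg_def_subspace ::
  "('m::topological_space, 'e::euclidean_space) atlas \<Rightarrow> ('m \<Rightarrow> 'm tangent \<Rightarrow> 'm tangent \<Rightarrow> real) \<Rightarrow>
    'm \<Rightarrow> 'm tangent set \<Rightarrow> bool" where
  "neg_def_subspace A g p W \<longleftrightarrow>
     subspace W \<and> W \<subseteq> tangent_space A p \<and> (\<forall>x\<in>W. x \<noteq> 0 \<longrightarrow> g p x x < 0)"

text \<open>The last conjunct says that the index of \<open>g\<close> is the same at all points.\<close>

definition semi_riemannian_metric ::
  "('m::topological_space, 'e::euclidean_space) atlas \<Rightarrow>
    ('m \<Rightarrow> 'm tangent \<Rightarrow> 'm tangent \<Rightarrow> real) \<Rightarrow> bool" where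
  "semi_riemannian_metric A g \<longleftrightarrow>
     (\<forall>p. \<forall>x\<in>tangent_space A p. \<forall>y\<in>tangent_space A p. g p x y = g p y x) \<and>
     (\<forall>p. \<forall>x\<in>tangent_space A p. \<forall>y\<in>tangent_space A p. \<forall>z\<in>tangent_space A p. \<forall>a b.
        g p (a *\<^sub>R x + b *\<^sub>R y) z = a * g p x z + b * g p y z) \<and>
     (\<forall>p. \<forall>x\<in>tangent_space A p. (\<forall>y\<in>tangent_space A p. g p x y = 0) \<longrightarrow> x = 0) \<and>
     (\<forall>U. open U \<longrightarrow> (\<forall>X\<in>vfields A U. \<forall>Y\<in>vfields A U. smooth_fun A U (\<lambda>p. g p (X p) (Y p)))) \<and>
     (\<exists>\<nu>. \<forall>p. (\<exists>W. neg_def_subspace A g p W \<and> dim W = \<nu>) \<and>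
              (\<forall>W. neg_def_subspace A g p W \<longrightarrow> dim W \<le> \<nu>))"

section \<open>The Levi-Civita connection and curvature\<close>

text \<open>A connection is taken as an operator on the smooth vector fields over all open subsets,
  which is the usual local extension of its action on global vector fields.\<close>

definition affine_connection ::
  "('m::topological_space, 'e::euclidean_space) atlas \<Rightarrow> ('m vfield \<Rightarrow> 'm vfield \<Rightarrow> 'm vfield) \<Rightarrow> bool" where
  "affine_connection A D \<longleftrightarrow>
     (\<forall>U. open U \<longrightarrow>
       (\<forall>X\<in>vfields A U. \<forall>Y\<in>vfields A U. D X Y \<in> vfields A U) \<and>
       (\<forall>X\<in>vfields A U. \<forall>X'\<in>vfields A U. \<forall>Y\<in>vfields A U. \<forall>p\<in>U.
          D (\<lambda>q. X q + X' q) Y p = D X Y p + D X' Y p) \<and>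
       (\<forall>X\<in>vfields A U. \<forall>Y\<in>vfields A U. \<forall>f. smooth_fun A U f \<longrightarrow>
          (\<forall>p\<in>U. D (\<lambda>q. f q *\<^sub>R X q) Y p = f p *\<^sub>R D X Y p)) \<and>
       (\<forall>X\<in>vfields A U. \<forall>Y\<in>vfields A U. \<forall>Y'\<in>vfields A U. \<forall>p\<in>U.
          D X (\<lambda>q. Y q + Y' q) p = D X Y p + D X Y' p) \<and>
       (\<forall>X\<in>vfields A U. \<forall>Y\<in>vfields A U. \<forall>f. smooth_fun A U f \<longrightarrow>
          (\<forall>p\<in>U. D X (\<lambda>q. f q *\<^sub>R Y q) p = X p f *\<^sub>R Y p + f p *\<^sub>R D X Y p)))"

definition levi_civita_connection ::
  "('m::topological_space, 'e::euclidean_space) atlas \<Rightarrow>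
    ('m \<Rightarrow> 'm tangent \<Rightarrow> 'm tangent \<Rightarrow> real) \<Rightarrow> ('m vfield \<Rightarrow> 'm vfield \<Rightarrow> 'm vfield) \<Rightarrow> bool" where
  "levi_civita_connection A g D \<longleftrightarrow>
     affine_connection A D \<and>
     (\<forall>U. open U \<longrightarrow> (\<forall>X\<in>vfields A U. \<forall>Y\<in>vfields A U. \<forall>p\<in>U.
        D X Y p - D Y X p = bracket A X Y p)) \<and>
     (\<forall>U. open U \<longrightarrow> (\<forall>X\<in>vfields A U. \<forall>Y\<in>vfields A U. \<forall>Z\<in>vfields A U. \<forall>p\<in>U.
        X p (\<lambda>q. g q (Y q) (Z q)) = g p (D X Y p) (Z p) + g p (Y p) (D X Z p)))"

definition curvature_op ::
  "('m::topological_space, 'e::euclidean_space) atlas \<Rightarrow> ('m vfield \<Rightarrow> 'm vfield \<Rightarrow> 'm vfield) \<Rightarrow>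
    'm vfield \<Rightarrow> 'm vfield \<Rightarrow> 'm vfield \<Rightarrow> 'm vfield" where
  "curvature_op A D Z W Y p = D Z (D W Y) p - D W (D Z Y) p - D (bracket A Z W) Y p"

text \<open>The value at \<open>p\<close> of the tensor \<open>R(X,Y,Z,W) = g(R(Z,W)Y,X)\<close>: the common value for all
  extensions of the four tangent vectors to smooth vector fields around \<open>p\<close>.\<close>

definition curvature_tensor ::
  "('m::topological_space, 'e::euclidean_space) atlas \<Rightarrow>
    ('m \<Rightarrow> 'm tangent \<Rightarrow> 'm tangent \<Rightarrow> real) \<Rightarrow> ('m vfield \<Rightarrow> 'm vfield \<Rightarrow> 'm vfield) \<Rightarrow>
    'm \<Rightarrow> 'm tangent \<Rightarrow> 'm tangent \<Rightarrow> 'm tangent \<Rightarrow> 'm tangent \<Rightarrow> real" where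
  "curvature_tensor A g D p x y z w =
     (THE r. \<exists>U. open U \<and> p \<in> U \<and>
        (\<exists>X\<in>vfields A U. \<exists>Y\<in>vfields A U. \<exists>Z\<in>vfields A U. \<exists>W\<in>vfields A U.
           X p = x \<and> Y p = y \<and> Z p = z \<and> W p = w \<and> r = g p (curvature_op A D Z W Y p) (X p)))"

text \<open>A non-degenerate plane is given by a basis \<open>x, y\<close>; the quotient does not depend on the choice.\<close>

definition sectional_curvature ::
  "('m::topological_space, 'e::euclidean_space) atlas \<Rightarrow>
    ('m \<Rightarrow> 'm tangent \<Rightarrow> 'm tangent \<Rightarrow> real) \<Rightarrow> ('m vfield \<Rightarrow> 'm vfield \<Rightarrow> 'm vfield) \<Rightarrow>
    'm \<Rightarrow> 'm tangent \<Rightarrow> 'm tangent \<Rightarrow> real" where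
  "sectional_curvature A g D p x y =
     curvature_tensor A g D p x y x y / (g p x x * g p y y - (g p x y)\<^sup>2)"

section \<open>Globally framed f-manifolds\<close>

definition gff_manifold ::
  "nat \<Rightarrow> nat \<Rightarrow> ('m::{t2_space, second_countable_topology}, 'e::euclidean_space) atlas \<Rightarrow>
    ('m \<Rightarrow> 'm tangent \<Rightarrow> 'm tangent) \<Rightarrow> (nat \<Rightarrow> 'm vfield) \<Rightarrow> (nat \<Rightarrow> 'm \<Rightarrow> 'm tangent \<Rightarrow> real) \<Rightarrow> bool" where
  "gff_manifold n s A \<phi> \<xi> \<eta> \<longleftrightarrow>
     connected (UNIV :: 'm set) \<and> smooth_atlas A \<and> DIM('e) = 2 * n + s \<and> s \<ge> 1 \<and>
     tensor_1_1 A \<phi> \<and> (\<forall>\<alpha>\<in>{1..s}. \<xi> \<alpha> \<in> vfields A UNIV) \<and> (\<forall>\<alpha>\<in>{1..s}. one_form A (\<eta> \<alpha>)) \<and>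
     (\<forall>p. dim (\<phi> p ` tangent_space A p) = 2 * n) \<and>
     (\<forall>p. \<forall>x\<in>tangent_space A p. \<phi> p (\<phi> p (\<phi> p x)) + \<phi> p x = 0) \<and>
     (\<forall>p. \<forall>a :: nat \<Rightarrow> real. (\<Sum>\<alpha>=1..s. a \<alpha> *\<^sub>R \<xi> \<alpha> p) = 0 \<longrightarrow> (\<forall>\<alpha>\<in>{1..s}. a \<alpha> = 0)) \<and>
     (\<forall>p. \<forall>x\<in>tangent_space A p. \<phi> p (\<phi> p x) = - x + (\<Sum>\<alpha>=1..s. \<eta> \<alpha> p x *\<^sub>R \<xi> \<alpha> p)) \<and>
     (\<forall>p. \<forall>\<alpha>\<in>{1..s}. \<forall>\<beta>\<in>{1..s}. \<eta> \<alpha> p (\<xi> \<beta> p) = (if \<alpha> = \<beta> then 1 else 0))"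

text \<open>The exterior derivative of a 1-form carries the factor 1/2.\<close>

definition ext_deriv ::
  "('m::topological_space, 'e::euclidean_space) atlas \<Rightarrow> ('m \<Rightarrow> 'm tangent \<Rightarrow> real) \<Rightarrow>
    'm vfield \<Rightarrow> 'm vfield \<Rightarrow> 'm \<Rightarrow> real" where
  "ext_deriv A \<eta> X Y p =
     (X p (\<lambda>q. \<eta> q (Y q)) - Y p (\<lambda>q. \<eta> q (X q)) - \<eta> p (bracket A X Y p)) / 2"

definition nijenhuis ::
  "('m::topological_space, 'e::euclidean_space) atlas \<Rightarrow> ('m \<Rightarrow> 'm tangent \<Rightarrow> 'm tangent) \<Rightarrow>
    'm vfield \<Rightarrow> 'm vfield \<Rightarrow> 'm vfield" where
  "nijenhuis A \<phi> X Y p =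
     \<phi> p (\<phi> p (bracket A X Y p)) + bracket A (\<lambda>q. \<phi> q (X q)) (\<lambda>q. \<phi> q (Y q)) p
     - \<phi> p (bracket A (\<lambda>q. \<phi> q (X q)) Y p) - \<phi> p (bracket A X (\<lambda>q. \<phi> q (Y q)) p)"

definition normal_gff ::
  "nat \<Rightarrow> ('m::topological_space, 'e::euclidean_space) atlas \<Rightarrow> ('m \<Rightarrow> 'm tangent \<Rightarrow> 'm tangent) \<Rightarrow>
    (nat \<Rightarrow> 'm vfield) \<Rightarrow> (nat \<Rightarrow> 'm \<Rightarrow> 'm tangent \<Rightarrow> real) \<Rightarrow> bool" where
  "normal_gff s A \<phi> \<xi> \<eta> \<longleftrightarrow>
     (\<forall>U. open U \<longrightarrow> (\<forall>X\<in>vfields A U. \<forall>Y\<in>vfields A U. \<forall>p\<in>U.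
        nijenhuis A \<phi> X Y p + 2 *\<^sub>R (\<Sum>\<alpha>=1..s. ext_deriv A (\<eta> \<alpha>) X Y p *\<^sub>R \<xi> \<alpha> p) = 0))"

text \<open>The signs \<open>\<epsilon>\<^sub>\<alpha>\<close> appear as \<open>g p (\<xi> \<alpha> p) (\<xi> \<alpha> p)\<close>.\<close>

definition indefinite_gff_manifold ::
  "nat \<Rightarrow> nat \<Rightarrow> ('m::{t2_space, second_countable_topology}, 'e::euclidean_space) atlas \<Rightarrow>
    ('m \<Rightarrow> 'm tangent \<Rightarrow> 'm tangent) \<Rightarrow> (nat \<Rightarrow> 'm vfield) \<Rightarrow> (nat \<Rightarrow> 'm \<Rightarrow> 'm tangent \<Rightarrow> real) \<Rightarrow>
    ('m \<Rightarrow> 'm tangent \<Rightarrow> 'm tangent \<Rightarrow> real) \<Rightarrow> bool" where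
  "indefinite_gff_manifold n s A \<phi> \<xi> \<eta> g \<longleftrightarrow>
     gff_manifold n s A \<phi> \<xi> \<eta> \<and> semi_riemannian_metric A g \<and>
     (\<forall>\<alpha>\<in>{1..s}. (\<forall>p. g p (\<xi> \<alpha> p) (\<xi> \<alpha> p) = 1) \<or> (\<forall>p. g p (\<xi> \<alpha> p) (\<xi> \<alpha> p) = - 1)) \<and>
     (\<forall>p. \<forall>x\<in>tangent_space A p. \<forall>y\<in>tangent_space A p.
        g p (\<phi> p x) (\<phi> p y) =
          g p x y - (\<Sum>\<alpha>=1..s. g p (\<xi> \<alpha> p) (\<xi> \<alpha> p) * \<eta> \<alpha> p x * \<eta> \<alpha> p y))"

definition fundamental_form ::
  "('m \<Rightarrow> 'm tangent \<Rightarrow> 'm tangent) \<Rightarrow> ('m \<Rightarrow> 'm tangent \<Rightarrow> 'm tangent \<Rightarrow> real) \<Rightarrow>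
    'm \<Rightarrow> 'm tangent \<Rightarrow> 'm tangent \<Rightarrow> real" where
  "fundamental_form \<phi> g p x y = g p x (\<phi> p y)"

definition indefinite_S_manifold ::
  "nat \<Rightarrow> nat \<Rightarrow> ('m::{t2_space, second_countable_topology}, 'e::euclidean_space) atlas \<Rightarrow>
    ('m \<Rightarrow> 'm tangent \<Rightarrow> 'm tangent) \<Rightarrow> (nat \<Rightarrow> 'm vfield) \<Rightarrow> (nat \<Rightarrow> 'm \<Rightarrow> 'm tangent \<Rightarrow> real) \<Rightarrow>
    ('m \<Rightarrow> 'm tangent \<Rightarrow> 'm tangent \<Rightarrow> real) \<Rightarrow> bool" where
  "indefinite_S_manifold n s A \<phi> \<xi> \<eta> g \<longleftrightarrow>
     indefinite_gff_manifold n s A \<phi> \<xi> \<eta> g \<and> normal_gff s A \<phi> \<xi> \<eta> \<and>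
     (\<forall>\<alpha>\<in>{1..s}. \<forall>U. open U \<longrightarrow> (\<forall>X\<in>vfields A U. \<forall>Y\<in>vfields A U. \<forall>p\<in>U.
        fundamental_form \<phi> g p (X p) (Y p) = ext_deriv A (\<eta> \<alpha>) X Y p))"

definition pointwise_constant_phi_curvature ::
  "('m::topological_space, 'e::euclidean_space) atlas \<Rightarrow> ('m \<Rightarrow> 'm tangent \<Rightarrow> 'm tangent) \<Rightarrow>
    ('m \<Rightarrow> 'm tangent \<Rightarrow> 'm tangent \<Rightarrow> real) \<Rightarrow> ('m vfield \<Rightarrow> 'm vfield \<Rightarrow> 'm vfield) \<Rightarrow>
    ('m \<Rightarrow> real) \<Rightarrow> bool" where
  "pointwise_constant_phi_curvature A \<phi> g D c \<longleftrightarrow>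
     (\<forall>p. \<forall>x \<in> \<phi> p ` tangent_space A p. \<bar>g p x x\<bar> = 1 \<longrightarrow>
        sectional_curvature A g D p x (\<phi> p x) = c p)"

definition indefinite_S_space_form ::
  "nat \<Rightarrow> nat \<Rightarrow> ('m::{t2_space, second_countable_topology}, 'e::euclidean_space) atlas \<Rightarrow>
    ('m \<Rightarrow> 'm tangent \<Rightarrow> 'm tangent) \<Rightarrow> (nat \<Rightarrow> 'm vfield) \<Rightarrow> (nat \<Rightarrow> 'm \<Rightarrow> 'm tangent \<Rightarrow> real) \<Rightarrow>
    ('m \<Rightarrow> 'm tangent \<Rightarrow> 'm tangent \<Rightarrow> real) \<Rightarrow> ('m vfield \<Rightarrow> 'm vfield \<Rightarrow> 'm vfield) \<Rightarrow> bool" where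
  "indefinite_S_space_form n s A \<phi> \<xi> \<eta> g D \<longleftrightarrow>
     indefinite_S_manifold n s A \<phi> \<xi> \<eta> g \<and>
     (\<exists>k. pointwise_constant_phi_curvature A \<phi> g D (\<lambda>p. k))"

end

theory Submission
  imports Defs
begin

text \<open>Work over the algebra of smooth functions on a chart domain. Normality together with
  \<open>\<Phi> = d\<eta>\<^sup>\<alpha>\<close> makes every \<open>\<xi>\<^sub>\<alpha>\<close> a Killing field with \<open>\<nabla>\<^sub>X \<xi>\<^sub>\<alpha> = - \<epsilon>\<^sub>\<alpha> \<phi> X\<close>, and gives
  \<open>(\<nabla>\<^sub>X \<phi>) W = g(X, W) \<Sum>\<xi>\<^sub>\<alpha>\<close> for horizontal \<open>W\<close>, that is, \<open>W\<close> in the common kernel of the \<open>\<eta>\<^sup>\<alpha>\<close>. The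
  Ricci identity for \<open>\<phi>\<close> then shows that on horizontal vectors \<open>R\<close> has the symmetries of a Kaehler
  curvature tensor up to terms in \<open>g\<close> and \<open>\<Phi>\<close>, so polarisation of the curvature hypothesis
  gives \<open>4 R = (c + 3 \<epsilon>) G\<^sub>1 + (c - \<epsilon>) G\<^sub>2\<close> there, with \<open>\<epsilon> = \<Sum>\<epsilon>\<^sub>\<alpha>\<close>. Its covariant derivative on
  horizontal arguments is \<open>4 \<nabla>\<^sub>X R = X(c) (G\<^sub>1 + G\<^sub>2)\<close>, and the second Bianchi identity yields
  \<open>X(c) = 0\<close>: for horizontal \<open>X\<close> by using a second \<open>\<phi>\<close>-plane orthogonal to that of \<open>X\<close>, which needs
  \<open>n \<ge> 2\<close>, and for \<open>X = \<xi>\<^sub>\<alpha>\<close> because the remaining two terms cancel.\<close>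

section \<open>Calculus of smooth maps\<close>

text \<open>Three obstacles shape the development. Tangent vectors are derivations, so that
  coordinate fields span them has to be secured; the required dimension bound is read off the
  structure itself, since the image of \<open>\<phi>\<close> has dimension 2n and the
  \<open>\<xi> \<alpha>\<close> account for the other s directions. An indefinite metric has null
  vectors, while the curvature hypothesis tests unit vectors only: it is rewritten as a polynomial
  identity, extended to null vectors by a limit, and non-null vectors must be produced wherever the
  final argument divides. Finally, covariant derivatives of horizontal fields need not be
  horizontal, so the curvature formula must hold with one arbitrary argument before R can be
  differentiated; this works because both sides vanish when that argument is some
  \<open>\<xi> \<alpha>\<close>.\<close>

lemma has_derivative_cong_open:
  assumes "open S" "x \<in> S" "\<And>y. y \<in> S \<Longrightarrow> f y = h y"
  shows "(f has_derivative D) (at x) \<longleftrightarrow> (h has_derivative D) (at x)"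
proof
  show "(h has_derivative D) (at x)" if "(f has_derivative D) (at x)"
    using has_derivative_transform_within_open[OF that assms(1,2)] assms(3) by simp
  show "(f has_derivative D) (at x)" if "(h has_derivative D) (at x)"
    using has_derivative_transform_within_open[OF that assms(1,2)] assms(3) by simp
qed

lemma frechet_derivative_cong_open:
  assumes "open S" "x \<in> S" "\<And>y. y \<in> S \<Longrightarrow> f y = h y"
  shows "frechet_derivative f (at x) = frechet_derivative h (at x)"
  unfolding frechet_derivative_def using has_derivative_cong_open[OF assms] by simp

lemma differentiable_cong_open:
  assumes "open S" "x \<in> S" "\<And>y. y \<in> S \<Longrightarrow> f y = h y"
  shows "f differentiable (at x) \<longleftrightarrow> h differentiable (at x)"
  unfolding differentiable_def using has_derivative_cong_open[OF assms] by simp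

lemma frechet_derivative_eq: "(f has_derivative D) (at x) \<Longrightarrow> frechet_derivative f (at x) = D"
  by (metis frechet_derivative_at)

lemma Ck_on_cong:
  assumes "open S" "\<And>x. x \<in> S \<Longrightarrow> f x = h x"
  shows "Ck_on k S f \<longleftrightarrow> Ck_on k S h"
  using assms(2)
proof (induction k arbitrary: f h)
  case 0
  then have "continuous_on S f \<longleftrightarrow> continuous_on S h"
    by (intro continuous_on_cong) simp_all
  then show ?case by simp
next
  case (Suc k)
  have "frechet_derivative f (at x) = frechet_derivative h (at x)" if "x \<in> S" for x
    using frechet_derivative_cong_open[OF assms(1) that] Suc.prems by blast
  then have "Ck_on k S (\<lambda>x. frechet_derivative f (at x) v) = Ck_on k S (\<lambda>x. frechet_derivative h (at x) v)" for v
    by (intro Suc.IH) simp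
  moreover have "f differentiable (at x) \<longleftrightarrow> h differentiable (at x)" if "x \<in> S" for x
    using differentiable_cong_open[OF assms(1) that] Suc.prems by blast
  ultimately show ?case unfolding Ck_on.simps by blast
qed

lemma Ck_on_subset: "Ck_on k S f \<Longrightarrow> T \<subseteq> S \<Longrightarrow> Ck_on k T f"
proof (induction k arbitrary: f)
  case 0
  then show ?case by (auto intro: continuous_on_subset)
next
  case (Suc k)
  then show ?case unfolding Ck_on.simps by blast
qed

lemma Ck_on_Suc_lower: "Ck_on (Suc k) S f \<Longrightarrow> Ck_on k S f"
proof (induction k arbitrary: f)
  case 0
  then show ?case
    by (auto intro!: continuous_at_imp_continuous_on differentiable_imp_continuous_within)
next
  case (Suc k)
  have "\<forall>x\<in>S. f differentiable (at x)" "Ck_on (Suc k) S (\<lambda>x. frechet_derivative f (at x) v)" for v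
    using Suc.prems unfolding Ck_on.simps(2)[of "Suc k"] by blast+
  then show ?case
    using Suc.IH unfolding Ck_on.simps(2)[of k S f] by blast
qed

lemma Ck_on_const [simp]: "Ck_on k S (\<lambda>_. a)"
  by (induction k arbitrary: a) auto

lemma Ck_on_add:
  assumes "open S"
  shows "Ck_on k S f \<Longrightarrow> Ck_on k S h \<Longrightarrow> Ck_on k S (\<lambda>x. f x + h x)"
proof (induction k arbitrary: f h)
  case 0
  then show ?case by (auto intro: continuous_on_add)
next
  case (Suc k)
  then have d: "((\<lambda>x. f x + h x) has_derivative
     (\<lambda>v. frechet_derivative f (at x) v + frechet_derivative h (at x) v)) (at x)" if "x \<in> S" for x
    using that by (intro has_derivative_add) (auto simp: frechet_derivative_works[symmetric])
  have "Ck_on k S (\<lambda>x. frechet_derivative (\<lambda>x. f x + h x) (at x) v)" for v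
  proof -
    have "Ck_on k S (\<lambda>x. frechet_derivative f (at x) v + frechet_derivative h (at x) v)"
      by (intro Suc.IH) (use Suc.prems in simp_all)
    then show ?thesis
      by (subst Ck_on_cong[OF assms]) (auto simp: frechet_derivative_eq[OF d])
  qed
  then show ?case
    using d by (auto simp: differentiable_def)
qed

lemma Ck_on_sum:
  assumes "open S" "\<And>i. i \<in> I \<Longrightarrow> Ck_on k S (f i)"
  shows "Ck_on k S (\<lambda>x. \<Sum>i\<in>I. f i x)"
  using assms(2)
proof (induction I rule: infinite_finite_induct)
  case (insert i I)
  then show ?case using Ck_on_add[OF assms(1), of k "f i"] by simp
qed simp_all

lemma Ck_on_bounded_linear:
  assumes "open S" "bounded_linear L"
  shows "Ck_on k S f \<Longrightarrow> Ck_on k S (\<lambda>x. L (f x))"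
proof (induction k arbitrary: f)
  case 0
  then show ?case
    using bounded_linear.continuous_on[OF assms(2)] by auto
next
  case (Suc k)
  then have d: "((\<lambda>x. L (f x)) has_derivative (\<lambda>v. L (frechet_derivative f (at x) v))) (at x)" if "x \<in> S" for x
    using that by (intro bounded_linear.has_derivative[OF assms(2)]) (auto simp: frechet_derivative_works[symmetric])
  have "Ck_on k S (\<lambda>x. frechet_derivative (\<lambda>x. L (f x)) (at x) v)" for v
  proof -
    have "Ck_on k S (\<lambda>x. L (frechet_derivative f (at x) v))"
      by (intro Suc.IH) (use Suc.prems in simp_all)
    then show ?thesis
      by (subst Ck_on_cong[OF assms(1)]) (auto simp: frechet_derivative_eq[OF d])
  qed
  then show ?case
    using d by (auto simp: differentiable_def)
qed

lemma Ck_on_mult: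
  fixes f h :: "'a::euclidean_space \<Rightarrow> real"
  assumes "open S"
  shows "Ck_on k S f \<Longrightarrow> Ck_on k S h \<Longrightarrow> Ck_on k S (\<lambda>x. f x * h x)"
proof (induction k arbitrary: f h)
  case 0
  then show ?case by (auto intro: continuous_on_mult)
next
  case (Suc k)
  then have d: "((\<lambda>x. f x * h x) has_derivative
     (\<lambda>v. f x * frechet_derivative h (at x) v + frechet_derivative f (at x) v * h x)) (at x)" if "x \<in> S" for x
    using that by (intro has_derivative_mult) (auto simp: frechet_derivative_works[symmetric])
  have "Ck_on k S (\<lambda>x. frechet_derivative (\<lambda>x. f x * h x) (at x) v)" for v
  proof -
    have "Ck_on k S (\<lambda>x. f x * frechet_derivative h (at x) v + frechet_derivative f (at x) v * h x)"
      using Suc.prems Ck_on_Suc_lower[OF Suc.prems(1)] Ck_on_Suc_lower[OF Suc.prems(2)]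
      by (intro Ck_on_add[OF assms] Suc.IH) simp_all
    then show ?thesis
      by (subst Ck_on_cong[OF assms]) (auto simp: frechet_derivative_eq[OF d])
  qed
  then show ?case
    using d by (auto simp: differentiable_def)
qed

lemma Ck_on_compose:
  fixes f :: "'b::euclidean_space \<Rightarrow> real" and h :: "'a::euclidean_space \<Rightarrow> 'b"
  assumes "open S"
  shows "Ck_on k T f \<Longrightarrow> Ck_on k S h \<Longrightarrow> h ` S \<subseteq> T \<Longrightarrow> Ck_on k S (\<lambda>x. f (h x))"
proof (induction k arbitrary: f)
  case 0
  then show ?case by (auto intro: continuous_on_compose2)
next
  case (Suc k)
  have d: "((\<lambda>x. f (h x)) has_derivative
     (\<lambda>v. frechet_derivative f (at (h x)) (frechet_derivative h (at x) v))) (at x)" if "x \<in> S" for x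
    using that Suc.prems
    by (intro has_derivative_compose[of h _ x UNIV f, simplified])
      (auto simp: frechet_derivative_works[symmetric] image_subset_iff)
  \<comment> \<open>\<open>Ck_on\<close> controls derivatives in a fixed direction, while the chain
    rule applies the derivative of \<open>f\<close> to a direction depending on \<open>x\<close>.
    Expanding that direction in \<open>Basis\<close> leaves fixed directions with scalar
    coefficients, to which the induction hypothesis applies.\<close>
  have e: "frechet_derivative f (at (h x)) (frechet_derivative h (at x) v)
     = (\<Sum>b\<in>Basis. (frechet_derivative h (at x) v \<bullet> b) * frechet_derivative f (at (h x)) b)"
    if "x \<in> S" for x v
  proof -
    have "linear (frechet_derivative f (at (h x)))"
      using that Suc.prems by (intro linear_frechet_derivative) auto
    then show ?thesis
      by (subst euclidean_representation[of "frechet_derivative h (at x) v", symmetric])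
        (simp add: linear_sum linear_cmul del: euclidean_representation)
  qed
  have "Ck_on k S (\<lambda>x. frechet_derivative (\<lambda>x. f (h x)) (at x) v)" for v
  proof -
    have "Ck_on k S (\<lambda>x. \<Sum>b\<in>Basis. (frechet_derivative h (at x) v \<bullet> b) * frechet_derivative f (at (h x)) b)"
      using Suc.prems Ck_on_Suc_lower[OF Suc.prems(2)]
      by (intro Ck_on_sum[OF assms] Ck_on_mult[OF assms] Suc.IH
          Ck_on_bounded_linear[OF assms bounded_linear_inner_left]) simp_all
    then show ?thesis
      by (subst Ck_on_cong[OF assms]) (auto simp: frechet_derivative_eq[OF d] e)
  qed
  then show ?case
    using d by (auto simp: differentiable_def)
qed

lemma smooth_on_cong: "open S \<Longrightarrow> (\<And>x. x \<in> S \<Longrightarrow> f x = h x) \<Longrightarrow> smooth_on S f \<longleftrightarrow> smooth_on S h"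
  unfolding smooth_on_def using Ck_on_cong by metis

lemma smooth_on_subset: "smooth_on S f \<Longrightarrow> T \<subseteq> S \<Longrightarrow> smooth_on T f"
  unfolding smooth_on_def using Ck_on_subset by blast

lemma smooth_on_differentiable: "smooth_on S f \<Longrightarrow> x \<in> S \<Longrightarrow> f differentiable (at x)"
  unfolding smooth_on_def by (metis Ck_on.simps(2))

lemma smooth_on_frechet_derivative: "smooth_on S f \<Longrightarrow> smooth_on S (\<lambda>x. frechet_derivative f (at x) v)"
  unfolding smooth_on_def by (metis Ck_on.simps(2))

lemma smooth_on_add: "open S \<Longrightarrow> smooth_on S f \<Longrightarrow> smooth_on S h \<Longrightarrow> smooth_on S (\<lambda>x. f x + h x)"
  unfolding smooth_on_def by (simp add: Ck_on_add)

lemma smooth_on_mult: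
  fixes f h :: "'a::euclidean_space \<Rightarrow> real"
  shows "open S \<Longrightarrow> smooth_on S f \<Longrightarrow> smooth_on S h \<Longrightarrow> smooth_on S (\<lambda>x. f x * h x)"
  unfolding smooth_on_def by (simp add: Ck_on_mult)

lemma smooth_on_compose:
  fixes f :: "'b::euclidean_space \<Rightarrow> real" and h :: "'a::euclidean_space \<Rightarrow> 'b"
  shows "open S \<Longrightarrow> smooth_on T f \<Longrightarrow> smooth_on S h \<Longrightarrow> h ` S \<subseteq> T \<Longrightarrow> smooth_on S (\<lambda>x. f (h x))"
  unfolding smooth_on_def using Ck_on_compose by blast

lemma sum_fun_apply: "(\<Sum>i\<in>I. f i) x = (\<Sum>i\<in>I. f i x)"
  for f :: "'i \<Rightarrow> 'a \<Rightarrow> 'b::comm_monoid_add"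
  by (induction I rule: infinite_finite_induct) simp_all

section \<open>Smooth manifolds\<close>

locale smooth_manifold =
  fixes A :: "('m::{t2_space, second_countable_topology}, 'e::euclidean_space) atlas"
  assumes atlas: "smooth_atlas A"
begin

lemma chart: "(U, \<psi>) \<in> A \<Longrightarrow> is_chart U \<psi>"
  using atlas unfolding smooth_atlas_def by blast

lemma chart_ex: "\<exists>U \<psi>. (U, \<psi>) \<in> A \<and> p \<in> U"
proof -
  have "p \<in> (\<Union>(U, \<psi>)\<in>A. U)"
    using atlas unfolding smooth_atlas_def by blast
  then show ?thesis by blast
qed

lemma transition:
  assumes "(U, \<psi>) \<in> A" "(V, \<theta>) \<in> A"
  shows "smooth_on (\<psi> ` (U \<inter> V)) (\<lambda>y. \<theta> (inv_into U \<psi> y))"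
proof -
  have "\<forall>(U, \<psi>)\<in>A. \<forall>(V, \<theta>)\<in>A. smooth_on (\<psi> ` (U \<inter> V)) (\<theta> \<circ> inv_into U \<psi>)"
    using atlas unfolding smooth_atlas_def by blast
  with assms show ?thesis unfolding comp_def by blast
qed

lemma chart_open: "(U, \<psi>) \<in> A \<Longrightarrow> open U"
  using chart by (auto simp: is_chart_def)

lemma chart_inj: "(U, \<psi>) \<in> A \<Longrightarrow> inj_on \<psi> U"
  using chart[of U \<psi>] unfolding is_chart_def homeomorphism_def by (metis inj_on_inverseI)

lemma chart_inv [simp]: "(U, \<psi>) \<in> A \<Longrightarrow> p \<in> U \<Longrightarrow> inv_into U \<psi> (\<psi> p) = p"
  using chart_inj by (simp add: inv_into_f_f)

lemma chart_open_image:
  assumes "(U, \<psi>) \<in> A" "open W"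
  shows "open (\<psi> ` (W \<inter> U))" "open (\<psi> ` (U \<inter> W))"
proof -
  have h: "homeomorphism U (\<psi> ` U) \<psi> (inv_into U \<psi>)" "open (\<psi> ` U)"
    using chart[OF assms(1)] by (auto simp: is_chart_def)
  have "openin (top_of_set (\<psi> ` U)) (\<psi> ` (W \<inter> U))"
    using homeomorphism_imp_open_map[OF h(1) openin_open_Int[OF assms(2)]] by (simp add: Int_commute)
  then show "open (\<psi> ` (W \<inter> U))"
    using h(2) openin_open_trans by blast
  then show "open (\<psi> ` (U \<inter> W))" by (simp add: Int_commute)
qed

lemma smooth_fun_iff:
  "smooth_fun A U f \<longleftrightarrow> (\<forall>V \<psi>. (V, \<psi>) \<in> A \<longrightarrow> smooth_on (\<psi> ` (U \<inter> V)) (\<lambda>y. f (inv_into V \<psi> y)))"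
  unfolding smooth_fun_def comp_def by auto

lemma smooth_fun_subset: "smooth_fun A U f \<Longrightarrow> V \<subseteq> U \<Longrightarrow> smooth_fun A V f"
  unfolding smooth_fun_iff by (meson Int_mono image_mono order_refl smooth_on_subset)

lemma smooth_fun_cong:
  assumes "open U" "\<And>p. p \<in> U \<Longrightarrow> f p = h p"
  shows "smooth_fun A U f \<longleftrightarrow> smooth_fun A U h"
proof -
  have "smooth_on (\<psi> ` (U \<inter> V)) (\<lambda>y. f (inv_into V \<psi> y)) \<longleftrightarrow> smooth_on (\<psi> ` (U \<inter> V)) (\<lambda>y. h (inv_into V \<psi> y))"
    if "(V, \<psi>) \<in> A" for V \<psi>
    by (rule smooth_on_cong) (use that assms chart_open_image in auto)
  then show ?thesis unfolding smooth_fun_iff by blast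
qed

lemma smooth_fun_const [simp]: "smooth_fun A U (\<lambda>_. r)"
  unfolding smooth_fun_iff smooth_on_def by simp

lemma smooth_fun_add: "open U \<Longrightarrow> smooth_fun A U f \<Longrightarrow> smooth_fun A U h \<Longrightarrow> smooth_fun A U (\<lambda>p. f p + h p)"
  unfolding smooth_fun_iff by (auto intro!: smooth_on_add chart_open_image(1))

lemma smooth_fun_mult: "open U \<Longrightarrow> smooth_fun A U f \<Longrightarrow> smooth_fun A U h \<Longrightarrow> smooth_fun A U (\<lambda>p. f p * h p)"
  unfolding smooth_fun_iff by (auto intro!: smooth_on_mult chart_open_image(1))

lemma smooth_nearI: "open U \<Longrightarrow> p \<in> U \<Longrightarrow> smooth_fun A U f \<Longrightarrow> smooth_near A p f"
  unfolding smooth_near_def by blast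

lemma smooth_near_cong:
  assumes "open U" "p \<in> U" "\<And>q. q \<in> U \<Longrightarrow> f q = h q"
  shows "smooth_near A p f \<longleftrightarrow> smooth_near A p h"
proof -
  have *: "smooth_near A p h" if f: "smooth_near A p f" and eq: "\<And>q. q \<in> U \<Longrightarrow> f q = h q" for f h
  proof -
    obtain V where V: "open V" "p \<in> V" "smooth_fun A V f"
      using f unfolding smooth_near_def by blast
    have UV: "open (U \<inter> V)" "p \<in> U \<inter> V"
      using V assms by auto
    have "smooth_fun A (U \<inter> V) f"
      using V(3) by (rule smooth_fun_subset) simp
    moreover have "smooth_fun A (U \<inter> V) f \<longleftrightarrow> smooth_fun A (U \<inter> V) h"
      by (rule smooth_fun_cong[OF UV(1)]) (simp add: eq)
    ultimately show ?thesis
      using smooth_nearI[OF UV] by blast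
  qed
  show ?thesis
    by (rule iffI; erule *) (simp_all add: assms(3))
qed

lemma smooth_near_const [simp]: "smooth_near A p (\<lambda>_. r)"
  by (rule smooth_nearI[of UNIV]) auto

lemma
  assumes "smooth_near A p f" "smooth_near A p h"
  shows smooth_near_add: "smooth_near A p (\<lambda>q. f q + h q)"
    and smooth_near_mult: "smooth_near A p (\<lambda>q. f q * h q)"
proof -
  obtain U V where "open U" "open V" "p \<in> U" "p \<in> V" "smooth_fun A U f" "smooth_fun A V h"
    using assms unfolding smooth_near_def by blast
  then have *: "open (U \<inter> V)" "p \<in> U \<inter> V" "smooth_fun A (U \<inter> V) f" "smooth_fun A (U \<inter> V) h"
    using smooth_fun_subset[of U f "U \<inter> V"] smooth_fun_subset[of V h "U \<inter> V"]
    by (simp_all add: open_Int)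
  show "smooth_near A p (\<lambda>q. f q + h q)"
    using * by (intro smooth_nearI[OF *(1,2)] smooth_fun_add)
  show "smooth_near A p (\<lambda>q. f q * h q)"
    using * by (intro smooth_nearI[OF *(1,2)] smooth_fun_mult)
qed

subsection \<open>Tangent vectors\<close>

lemma tangent_not_smooth: "v \<in> tangent_space A p \<Longrightarrow> \<not> smooth_near A p f \<Longrightarrow> v f = 0"
  and tangent_lin: "v \<in> tangent_space A p \<Longrightarrow> smooth_near A p f \<Longrightarrow> smooth_near A p h \<Longrightarrow>
    v (\<lambda>x. a * f x + b * h x) = a * v f + b * v h"
  and tangent_mult: "v \<in> tangent_space A p \<Longrightarrow> smooth_near A p f \<Longrightarrow> smooth_near A p h \<Longrightarrow>
    v (\<lambda>x. f x * h x) = f p * v h + h p * v f"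
  unfolding tangent_space_def by blast+

lemma tangent_add: "v \<in> tangent_space A p \<Longrightarrow> smooth_near A p f \<Longrightarrow> smooth_near A p h \<Longrightarrow>
    v (\<lambda>x. f x + h x) = v f + v h"
  and tangent_diff: "v \<in> tangent_space A p \<Longrightarrow> smooth_near A p f \<Longrightarrow> smooth_near A p h \<Longrightarrow>
    v (\<lambda>x. f x - h x) = v f - v h"
  using tangent_lin[of v p f h 1 1] tangent_lin[of v p f h 1 "-1"] by simp_all

lemma tangent_const [simp]:
  assumes "v \<in> tangent_space A p"
  shows "v (\<lambda>_. r) = 0"
proof -
  have "v (\<lambda>_. 1) = 0"
    using tangent_mult[OF assms, of "\<lambda>_. 1" "\<lambda>_. 1"] by simp
  then show ?thesis
    using tangent_lin[OF assms, of "\<lambda>_. 1" "\<lambda>_. 1" r 0] by simp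
qed

text \<open>The indicator function of an open neighbourhood of \<open>p\<close> is smooth near \<open>p\<close>, so no bump
  functions are needed to see that tangent vectors only depend on germs.\<close>

lemma tangent_cong:
  assumes v: "v \<in> tangent_space A p" and U: "open U" "p \<in> U" "\<And>q. q \<in> U \<Longrightarrow> f q = h q"
  shows "v f = v h"
proof (cases "smooth_near A p f")
  case True
  then have h: "smooth_near A p h"
    using smooth_near_cong[OF U] by simp
  let ?b = "\<lambda>q. if q \<in> U then 1 else 0 :: real"
  have b: "smooth_near A p ?b"
    using smooth_near_cong[OF U(1,2), of ?b "\<lambda>_. 1"] by simp
  have d: "smooth_near A p (\<lambda>q. f q - h q)"
    using smooth_near_add[OF True smooth_near_mult[OF smooth_near_const[of _ "-1"] h]] by simp
  have "(\<lambda>q. ?b q * (f q - h q)) = (\<lambda>_. 0)"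
    using U(3) by auto
  then show ?thesis
    using tangent_mult[OF v b d] tangent_diff[OF v True h] U v by simp
next
  case False
  then show ?thesis
    using smooth_near_cong[OF U] tangent_not_smooth[OF v, of f] tangent_not_smooth[OF v, of h] by simp
qed

lemma tangentI:
  assumes "\<And>f. \<not> smooth_near A p f \<Longrightarrow> v f = 0"
    and "\<And>f h a b. smooth_near A p f \<Longrightarrow> smooth_near A p h \<Longrightarrow>
      v (\<lambda>x. a * f x + b * h x) = a * v f + b * v h"
    and "\<And>f h. smooth_near A p f \<Longrightarrow> smooth_near A p h \<Longrightarrow>
      v (\<lambda>x. f x * h x) = f p * v h + h p * v f"
  shows "v \<in> tangent_space A p"
  unfolding tangent_space_def using assms by blast

lemma subspace_tangent: "subspace (tangent_space A p)"
proof (rule subspaceI)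
  show "0 \<in> tangent_space A p"
    by (rule tangentI) simp_all
  show "v + w \<in> tangent_space A p" if "v \<in> tangent_space A p" "w \<in> tangent_space A p" for v w
    by (rule tangentI)
      (simp_all add: tangent_not_smooth[OF that(1)] tangent_not_smooth[OF that(2)]
        tangent_lin[OF that(1)] tangent_lin[OF that(2)] tangent_mult[OF that(1)] tangent_mult[OF that(2)]
        algebra_simps)
  show "r *\<^sub>R v \<in> tangent_space A p" if "v \<in> tangent_space A p" for v r
    by (rule tangentI)
      (simp_all add: scaleR_fun_def tangent_not_smooth[OF that] tangent_lin[OF that] tangent_mult[OF that]
        algebra_simps)
qed

subsection \<open>Vector fields\<close>

lemma vfieldsI:
  assumes "\<And>p. p \<in> U \<Longrightarrow> X p \<in> tangent_space A p"
    and "\<And>V f. open V \<Longrightarrow> V \<subseteq> U \<Longrightarrow> smooth_fun A V f \<Longrightarrow> smooth_fun A V (\<lambda>p. X p f)"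
  shows "X \<in> vfields A U"
  unfolding vfields_def using assms by simp

lemma vfields_tangent: "X \<in> vfields A U \<Longrightarrow> p \<in> U \<Longrightarrow> X p \<in> tangent_space A p"
  unfolding vfields_def by simp

lemma vfields_smooth:
  assumes "X \<in> vfields A U" "open V" "V \<subseteq> U" "smooth_fun A V f"
  shows "smooth_fun A V (\<lambda>p. X p f)"
  using assms unfolding vfields_def by simp

lemma vfields_subset:
  assumes "X \<in> vfields A U" "V \<subseteq> U"
  shows "X \<in> vfields A V"
  by (rule vfieldsI) (use assms in \<open>auto simp: vfields_def\<close>)

lemma vfields_cong:
  assumes "open U" "X \<in> vfields A U" "\<And>p. p \<in> U \<Longrightarrow> X p = Y p"
  shows "Y \<in> vfields A U"
proof (rule vfieldsI)
  show "Y p \<in> tangent_space A p" if "p \<in> U" for p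
    using vfields_tangent[OF assms(2) that] assms(3)[OF that] by simp
  fix V f assume V: "open V" "V \<subseteq> U" "smooth_fun A V f"
  have "smooth_fun A V (\<lambda>p. X p f) \<longleftrightarrow> smooth_fun A V (\<lambda>p. Y p f)"
    by (rule smooth_fun_cong[OF V(1)]) (use V assms(3) in auto)
  then show "smooth_fun A V (\<lambda>p. Y p f)"
    using vfields_smooth[OF assms(2) V] by simp
qed

lemma vfields_zero: "0 \<in> vfields A U"
  by (rule vfieldsI) (simp_all add: subspace_0[OF subspace_tangent])

lemma vfields_add:
  assumes "X \<in> vfields A U" "Y \<in> vfields A U"
  shows "(\<lambda>q. X q + Y q) \<in> vfields A U"
proof (rule vfieldsI)
  show "X p + Y p \<in> tangent_space A p" if "p \<in> U" for p
    using subspace_add[OF subspace_tangent vfields_tangent[OF assms(1) that] vfields_tangent[OF assms(2) that]] .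
  fix V f assume V: "open V" "V \<subseteq> U" "smooth_fun A V f"
  show "smooth_fun A V (\<lambda>p. (X p + Y p) f)"
    using smooth_fun_add[OF V(1) vfields_smooth[OF assms(1) V] vfields_smooth[OF assms(2) V]]
    by simp
qed

lemma vfields_smul:
  assumes "X \<in> vfields A U" "smooth_fun A U f"
  shows "(\<lambda>q. f q *\<^sub>R X q) \<in> vfields A U"
proof (rule vfieldsI)
  show "f p *\<^sub>R X p \<in> tangent_space A p" if "p \<in> U" for p
    using subspace_scale[OF subspace_tangent vfields_tangent[OF assms(1) that]] .
  fix V h assume V: "open V" "V \<subseteq> U" "smooth_fun A V h"
  show "smooth_fun A V (\<lambda>p. (f p *\<^sub>R X p) h)"
    using smooth_fun_mult[OF V(1) smooth_fun_subset[OF assms(2) V(2)] vfields_smooth[OF assms(1) V]]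
    by (simp add: scaleR_fun_def)
qed

text \<open>The guard \<open>smooth_near\<close> supplies the value 0 that
  \<open>tangent_space\<close> prescribes on functions that are not smooth near
  \<open>p\<close>.\<close>

definition coord :: "'m set \<Rightarrow> ('m \<Rightarrow> 'e) \<Rightarrow> 'e \<Rightarrow> 'm vfield" where
  "coord U \<psi> b p f = (if p \<in> U \<and> smooth_near A p f
     then frechet_derivative (\<lambda>y. f (inv_into U \<psi> y)) (at (\<psi> p)) b else 0)"

lemma differentiable_chart:
  assumes "(U, \<psi>) \<in> A" "p \<in> U" "smooth_near A p f"
  shows "(\<lambda>y. f (inv_into U \<psi> y)) differentiable (at (\<psi> p))"
proof -
  obtain V where V: "open V" "p \<in> V" "smooth_fun A V f"
    using assms(3) unfolding smooth_near_def by blast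
  then have "smooth_on (\<psi> ` (V \<inter> U)) (\<lambda>y. f (inv_into U \<psi> y))"
    using assms(1) unfolding smooth_fun_iff by blast
  then show ?thesis
    by (rule smooth_on_differentiable) (use V assms in auto)
qed

lemma coord_tangent:
  assumes "(U, \<psi>) \<in> A" "p \<in> U"
  shows "coord U \<psi> b p \<in> tangent_space A p"
proof (rule tangentI)
  fix f h and r t :: real
  assume f: "smooth_near A p f" and h: "smooth_near A p h"
  have df: "((\<lambda>y. f (inv_into U \<psi> y)) has_derivative
      frechet_derivative (\<lambda>y. f (inv_into U \<psi> y)) (at (\<psi> p))) (at (\<psi> p))"
    and dh: "((\<lambda>y. h (inv_into U \<psi> y)) has_derivative
      frechet_derivative (\<lambda>y. h (inv_into U \<psi> y)) (at (\<psi> p))) (at (\<psi> p))"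
    using differentiable_chart[OF assms f] differentiable_chart[OF assms h]
    by (simp_all add: frechet_derivative_works)
  have sm: "smooth_near A p (\<lambda>x. r * f x + t * h x)"
    by (intro smooth_near_add smooth_near_mult smooth_near_const f h)
  show "coord U \<psi> b p (\<lambda>x. r * f x + t * h x) = r * coord U \<psi> b p f + t * coord U \<psi> b p h"
    using assms(2) f h sm
      frechet_derivative_eq[OF has_derivative_add[OF has_derivative_mult_right[OF df, of r]
          has_derivative_mult_right[OF dh, of t]]]
    by (simp add: coord_def)
  have sm: "smooth_near A p (\<lambda>x. f x * h x)"
    by (intro smooth_near_mult f h)
  show "coord U \<psi> b p (\<lambda>x. f x * h x) = f p * coord U \<psi> b p h + h p * coord U \<psi> b p f"
    using assms f h sm frechet_derivative_eq[OF has_derivative_mult[OF df dh]]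
    by (simp add: coord_def)
qed (simp add: coord_def)

lemma coord_vfield:
  assumes c: "(U, \<psi>) \<in> A"
  shows "coord U \<psi> b \<in> vfields A U"
proof (rule vfieldsI)
  fix V f assume V: "open V" "V \<subseteq> U" "smooth_fun A V f"
  show "smooth_fun A V (\<lambda>p. coord U \<psi> b p f)"
    unfolding smooth_fun_iff
  proof (intro allI impI)
    fix W \<theta> assume W: "(W, \<theta>) \<in> A"
    let ?f = "\<lambda>y. f (inv_into U \<psi> y)" and ?t = "\<lambda>z. \<psi> (inv_into W \<theta> z)"
    have op: "open (\<theta> ` (V \<inter> W))"
      using chart_open_image[OF W V(1)] by simp
    \<comment> \<open>Differentiation takes place in the chart \<open>\<psi>\<close>; smoothness in
      another chart \<open>\<theta>\<close> then follows by composing with the transition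
      map.\<close>
    have "smooth_on (\<psi> ` (V \<inter> U)) ?f"
      using V(3) c unfolding smooth_fun_iff by blast
    then have 1: "smooth_on (\<psi> ` (V \<inter> U)) (\<lambda>y. frechet_derivative ?f (at y) b)"
      by (rule smooth_on_frechet_derivative)
    have 2: "smooth_on (\<theta> ` (V \<inter> W)) ?t"
      using transition[OF W c] by (rule smooth_on_subset) (use V(2) in auto)
    have "smooth_on (\<theta> ` (V \<inter> W)) (\<lambda>z. frechet_derivative ?f (at (?t z)) b)"
      by (rule smooth_on_compose[OF op 1 2]) (use W V(2) in auto)
    moreover have eq: "coord U \<psi> b (inv_into W \<theta> z) f = frechet_derivative ?f (at (?t z)) b"
      if z: "z \<in> \<theta> ` (V \<inter> W)" for z
    proof -
      obtain p where p: "p \<in> V" "p \<in> W" "z = \<theta> p"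
        using z by auto
      have "smooth_near A p f"
        using V(1) p(1) V(3) by (rule smooth_nearI)
      then show ?thesis
        using p V(2) W by (auto simp: coord_def)
    qed
    ultimately show "smooth_on (\<theta> ` (V \<inter> W)) (\<lambda>z. coord U \<psi> b (inv_into W \<theta> z) f)"
      by (simp only: smooth_on_cong[OF op eq])
  qed
qed (rule coord_tangent[OF c])

lemma smooth_fun_coordinate:
  assumes c: "(U, \<psi>) \<in> A"
  shows "smooth_fun A U (\<lambda>q. \<psi> q \<bullet> b)"
  unfolding smooth_fun_iff
proof (intro allI impI)
  fix W \<theta> assume W: "(W, \<theta>) \<in> A"
  have op: "open (\<theta> ` (U \<inter> W))"
    using chart_open_image[OF W chart_open[OF c]] by simp
  have "smooth_on (\<theta> ` (U \<inter> W)) (\<lambda>z. \<psi> (inv_into W \<theta> z))"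
    using transition[OF W c] by (rule smooth_on_subset) auto
  then show "smooth_on (\<theta> ` (U \<inter> W)) (\<lambda>z. \<psi> (inv_into W \<theta> z) \<bullet> b)"
    unfolding smooth_on_def by (simp add: Ck_on_bounded_linear[OF op bounded_linear_inner_left])
qed

lemma coord_coordinate:
  assumes c: "(U, \<psi>) \<in> A" and p: "p \<in> U"
  shows "coord U \<psi> b p (\<lambda>q. \<psi> q \<bullet> b') = b \<bullet> b'"
proof -
  have eq: "\<psi> (inv_into U \<psi> y) = y" if "y \<in> \<psi> ` U" for y
    using that by (rule f_inv_into_f)
  have o: "open (\<psi> ` U)"
    using chart[OF c] by (auto simp: is_chart_def)
  have "((\<lambda>y. y \<bullet> b') has_derivative (\<lambda>y. y \<bullet> b')) (at (\<psi> p))"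
    by (auto intro!: derivative_eq_intros)
  then have "((\<lambda>y. \<psi> (inv_into U \<psi> y) \<bullet> b') has_derivative (\<lambda>y. y \<bullet> b')) (at (\<psi> p))"
    by (rule has_derivative_transform_within_open[OF _ o]) (use p eq in auto)
  moreover have "smooth_near A p (\<lambda>q. \<psi> q \<bullet> b')"
    using chart_open[OF c] p smooth_fun_coordinate[OF c] by (rule smooth_nearI)
  ultimately show ?thesis
    using p by (simp add: coord_def frechet_derivative_eq)
qed

lemma coord_sum_eq:
  assumes c: "(U, \<psi>) \<in> A" and p: "p \<in> U" and b: "b \<in> Basis"
  shows "(\<Sum>b'\<in>Basis. a b' *\<^sub>R coord U \<psi> b' p) (\<lambda>q. \<psi> q \<bullet> b) = a b"
proof -
  have "(\<Sum>b'\<in>Basis. a b' *\<^sub>R coord U \<psi> b' p) (\<lambda>q. \<psi> q \<bullet> b) = (\<Sum>b'\<in>Basis. a b' * (b' \<bullet> b))"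
    by (simp add: sum_fun_apply scaleR_fun_def coord_coordinate[OF c p])
  also have "\<dots> = a b"
    using b by (simp add: inner_Basis if_distrib cong: if_cong)
  finally show ?thesis .
qed

text \<open>The coordinate vector fields are independent, so an upper bound for the dimension of the
  tangent space suffices for them to span it.\<close>

lemma tangent_coord:
  assumes c: "(U, \<psi>) \<in> A" and p: "p \<in> U"
    and C: "finite C" "card C \<le> DIM('e)" "tangent_space A p \<subseteq> span C"
    and v: "v \<in> tangent_space A p"
  shows "v = (\<Sum>b\<in>Basis. v (\<lambda>q. \<psi> q \<bullet> b) *\<^sub>R coord U \<psi> b p)"
proof -
  let ?E = "(\<lambda>b. coord U \<psi> b p) ` (Basis :: 'e set)"
  have inj: "inj_on (\<lambda>b. coord U \<psi> b p) (Basis :: 'e set)"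
  proof (rule inj_onI)
    fix b b' :: 'e assume b: "b \<in> Basis" "b' \<in> Basis" "coord U \<psi> b p = coord U \<psi> b' p"
    have "coord U \<psi> b p (\<lambda>q. \<psi> q \<bullet> b) = coord U \<psi> b' p (\<lambda>q. \<psi> q \<bullet> b)"
      by (simp only: b(3))
    then have "b \<bullet> b = b' \<bullet> b"
      by (simp only: coord_coordinate[OF c p])
    then show "b = b'"
      using inner_Basis[OF b(2,1)] b(1) by (simp split: if_splits)
  qed
  have sum_E: "(\<Sum>x\<in>?E. u x *\<^sub>R x) = (\<Sum>b\<in>Basis. u (coord U \<psi> b p) *\<^sub>R coord U \<psi> b p)" for u
    by (simp add: sum.reindex[OF inj])
  have fin: "finite ?E"
    by simp
  have ind: "independent ?E"
  proof
    assume "dependent ?E"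
    then have "\<exists>u. (\<exists>w\<in>?E. u w \<noteq> 0) \<and> (\<Sum>x\<in>?E. u x *\<^sub>R x) = 0"
      by (simp only: dependent_finite[OF fin])
    then obtain u where u: "\<exists>w\<in>?E. u w \<noteq> 0" "(\<Sum>b\<in>Basis. u (coord U \<psi> b p) *\<^sub>R coord U \<psi> b p) = 0"
      unfolding sum_E by (elim exE conjE)
    from u(1) obtain b where b: "b \<in> Basis" "u (coord U \<psi> b p) \<noteq> 0"
      by (elim bexE imageE) (simp only:)
    show False
      using coord_sum_eq[OF c p b(1), of "\<lambda>b. u (coord U \<psi> b p)"] b(2) unfolding u(2) by simp
  qed
  have EC: "?E \<subseteq> span C"
    by (rule image_subsetI) (rule subsetD[OF C(3) coord_tangent[OF c p]])
  have "v \<in> span ?E"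
  proof (rule ccontr)
    assume nv: "v \<notin> span ?E"
    have i: "independent (insert v ?E)"
      by (rule independent_insertI[OF nv ind])
    have "v \<notin> ?E"
      using nv span_base[of v ?E] by argo
    moreover have "insert v ?E \<subseteq> span C"
      using EC v C(3) by (simp add: subset_iff)
    ultimately show False
      using independent_span_bound[OF C(1) i] C(2) by (simp add: card_image[OF inj])
  qed
  then have "v \<in> range (\<lambda>u. \<Sum>x\<in>?E. u x *\<^sub>R x)"
    using span_finite[of ?E] by simp
  then obtain u where "v = (\<Sum>x\<in>?E. u x *\<^sub>R x)"
    by (rule rangeE)
  then have v': "v = (\<Sum>b\<in>Basis. u (coord U \<psi> b p) *\<^sub>R coord U \<psi> b p)"
    by (simp only: sum_E)
  have vb: "v (\<lambda>q. \<psi> q \<bullet> b) = u (coord U \<psi> b p)" if "b \<in> Basis" for b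
    unfolding v' by (rule coord_sum_eq[OF c p that])
  have "(\<Sum>b\<in>Basis. u (coord U \<psi> b p) *\<^sub>R coord U \<psi> b p)
    = (\<Sum>b\<in>Basis. v (\<lambda>q. \<psi> q \<bullet> b) *\<^sub>R coord U \<psi> b p)"
    by (rule sum.cong) (simp_all only: vb)
  with v' show ?thesis
    by (rule trans)
qed

text \<open>The hypothesis on coordinate vectors kills all partial derivatives in a chart, so
  \<open>f\<close> is constant on the preimage of a ball; connectedness turns local constancy into
  constancy.\<close>

lemma constant_if_tangent_zero:
  assumes con: "connected (UNIV :: 'm set)" and f: "smooth_fun A UNIV f"
    and z: "\<And>p v. v \<in> tangent_space A p \<Longrightarrow> v f = 0"
  shows "f p = f q"
proof (rule connected_local_const[OF con])
  show "\<forall>a\<in>UNIV. \<forall>\<^sub>F b in at a. f a = f b"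
  proof
    fix a :: 'm
    obtain U \<psi> where c: "(U, \<psi>) \<in> A" and a: "a \<in> U"
      using chart_ex by blast
    let ?f = "\<lambda>y. f (inv_into U \<psi> y)"
    have o: "open (\<psi> ` U)"
      using chart[OF c] by (auto simp: is_chart_def)
    have near: "smooth_near A p f" for p
      using f by (intro smooth_nearI[of UNIV]) auto
    have d: "(?f has_derivative (\<lambda>_. 0)) (at y)" if y: "y \<in> \<psi> ` U" for y
    proof -
      obtain p where p: "p \<in> U" "y = \<psi> p"
        using y by blast
      have D: "(?f has_derivative frechet_derivative ?f (at y)) (at y)"
        using differentiable_chart[OF c p(1) near] p(2) by (simp add: frechet_derivative_works)
      have "frechet_derivative ?f (at y) b = 0" if "b \<in> Basis" for b
        using z[OF coord_tangent[OF c p(1), of b]] near p by (simp add: coord_def)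
      then have "frechet_derivative ?f (at y) = (\<lambda>_. 0)"
        using has_derivative_linear[OF D] by (intro linear_eq_stdbasis) (auto simp: linear_iff)
      with D show ?thesis by simp
    qed
    obtain r where r: "r > 0" "ball (\<psi> a) r \<subseteq> \<psi> ` U"
      using o a by (meson imageI open_contains_ball)
    have const: "?f y = ?f (\<psi> a)" if "y \<in> ball (\<psi> a) r" for y
    proof (rule has_derivative_zero_unique[where s = "ball (\<psi> a) r"])
      show "(?f has_derivative (\<lambda>h. 0)) (at x within ball (\<psi> a) r)" if "x \<in> ball (\<psi> a) r" for x
        using d that r(2) by (blast intro: has_derivative_at_withinI)
    qed (use r that in auto)
    have "continuous_on U \<psi>"
      using chart[OF c] by (auto simp: is_chart_def homeomorphism_def)
    then have "open (U \<inter> \<psi> -` ball (\<psi> a) r)"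
      using chart_open[OF c] by (simp add: continuous_on_open_vimage Int_commute)
    then have "eventually (\<lambda>b. b \<in> U \<inter> \<psi> -` ball (\<psi> a) r) (nhds a)"
      using a r(1) by (intro eventually_nhds_in_open) auto
    then show "\<forall>\<^sub>F b in at a. f a = f b"
      unfolding eventually_at_filter
    proof (rule eventually_mono)
      fix b assume b: "b \<in> U \<inter> \<psi> -` ball (\<psi> a) r"
      then show "b \<noteq> a \<longrightarrow> b \<in> UNIV \<longrightarrow> f a = f b"
        using const[of "\<psi> b"] c a by auto
    qed
  qed
qed auto

end

section \<open>Levi-Civita connections over an algebra of functions\<close>

text \<open>\<open>S\<close> plays the role of the smooth functions on an open set, \<open>F\<close> that of its vector fields, with
  \<open>smul\<close> and \<open>der\<close> the multiplication by functions and the action as derivations.\<close>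

locale levi_civita_module =
  fixes S :: "('m \<Rightarrow> real) set" and F :: "'v::real_vector set"
    and smul :: "('m \<Rightarrow> real) \<Rightarrow> 'v \<Rightarrow> 'v"
    and der :: "'v \<Rightarrow> ('m \<Rightarrow> real) \<Rightarrow> 'm \<Rightarrow> real"
    and D :: "'v \<Rightarrow> 'v \<Rightarrow> 'v"
    and g :: "'v \<Rightarrow> 'v \<Rightarrow> 'm \<Rightarrow> real"
  assumes S_const [simp]: "(\<lambda>_. r) \<in> S"
    and S_add [simp]: "f \<in> S \<Longrightarrow> h \<in> S \<Longrightarrow> (\<lambda>p. f p + h p) \<in> S"
    and S_mult [simp]: "f \<in> S \<Longrightarrow> h \<in> S \<Longrightarrow> (\<lambda>p. f p * h p) \<in> S"
    and F_subspace: "subspace F"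
    and smul_in [simp]: "f \<in> S \<Longrightarrow> X \<in> F \<Longrightarrow> smul f X \<in> F"
    and smul_const: "X \<in> F \<Longrightarrow> smul (\<lambda>_. r) X = r *\<^sub>R X"
    and der_in [simp]: "X \<in> F \<Longrightarrow> f \<in> S \<Longrightarrow> der X f \<in> S"
    and der_add_left: "X \<in> F \<Longrightarrow> Y \<in> F \<Longrightarrow> f \<in> S \<Longrightarrow> der (X + Y) f p = der X f p + der Y f p"
    and der_smul: "X \<in> F \<Longrightarrow> f \<in> S \<Longrightarrow> h \<in> S \<Longrightarrow> der (smul f X) h p = f p * der X h p"
    and der_add: "X \<in> F \<Longrightarrow> f \<in> S \<Longrightarrow> h \<in> S \<Longrightarrow> der X (\<lambda>q. f q + h q) p = der X f p + der X h p"
    and der_mult: "X \<in> F \<Longrightarrow> f \<in> S \<Longrightarrow> h \<in> S \<Longrightarrow>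
      der X (\<lambda>q. f q * h q) p = f p * der X h p + h p * der X f p"
    and der_const [simp]: "X \<in> F \<Longrightarrow> der X (\<lambda>_. r) p = 0"
    and faithful: "X \<in> F \<Longrightarrow> (\<And>f p. f \<in> S \<Longrightarrow> der X f p = 0) \<Longrightarrow> X = 0"
    and D_in [simp]: "X \<in> F \<Longrightarrow> Y \<in> F \<Longrightarrow> D X Y \<in> F"
    and D_add_left: "X \<in> F \<Longrightarrow> X' \<in> F \<Longrightarrow> Y \<in> F \<Longrightarrow> D (X + X') Y = D X Y + D X' Y"
    and D_smul_left: "X \<in> F \<Longrightarrow> Y \<in> F \<Longrightarrow> f \<in> S \<Longrightarrow> D (smul f X) Y = smul f (D X Y)"
    and D_add_right: "X \<in> F \<Longrightarrow> Y \<in> F \<Longrightarrow> Y' \<in> F \<Longrightarrow> D X (Y + Y') = D X Y + D X Y'"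
    and D_smul_right: "X \<in> F \<Longrightarrow> Y \<in> F \<Longrightarrow> f \<in> S \<Longrightarrow>
      D X (smul f Y) = smul (der X f) Y + smul f (D X Y)"
    and torsion_free: "X \<in> F \<Longrightarrow> Y \<in> F \<Longrightarrow> f \<in> S \<Longrightarrow>
      der (D X Y - D Y X) f p = der X (der Y f) p - der Y (der X f) p"
    and g_in [simp]: "X \<in> F \<Longrightarrow> Y \<in> F \<Longrightarrow> g X Y \<in> S"
    and g_sym: "X \<in> F \<Longrightarrow> Y \<in> F \<Longrightarrow> g X Y = g Y X"
    and g_add_left: "X \<in> F \<Longrightarrow> Y \<in> F \<Longrightarrow> Z \<in> F \<Longrightarrow> g (X + Y) Z p = g X Z p + g Y Z p"
    and g_smul_left: "X \<in> F \<Longrightarrow> Z \<in> F \<Longrightarrow> f \<in> S \<Longrightarrow> g (smul f X) Z p = f p * g X Z p"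
    and g_nondeg: "X \<in> F \<Longrightarrow> (\<And>Y p. Y \<in> F \<Longrightarrow> g X Y p = 0) \<Longrightarrow> X = 0"
    and metric: "X \<in> F \<Longrightarrow> Y \<in> F \<Longrightarrow> Z \<in> F \<Longrightarrow>
      der X (g Y Z) p = g (D X Y) Z p + g Y (D X Z) p"
begin

lemma F_simps [simp]:
  "0 \<in> F" "X \<in> F \<Longrightarrow> Y \<in> F \<Longrightarrow> X + Y \<in> F" "X \<in> F \<Longrightarrow> Y \<in> F \<Longrightarrow> X - Y \<in> F"
  "X \<in> F \<Longrightarrow> - X \<in> F" "X \<in> F \<Longrightarrow> r *\<^sub>R X \<in> F" "(\<And>i. i \<in> I \<Longrightarrow> T i \<in> F) \<Longrightarrow> sum T I \<in> F"
  using F_subspace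
  by (simp_all add: subspace_0 subspace_add subspace_diff subspace_neg subspace_scale subspace_sum)

lemma S_simps [simp]:
  "f \<in> S \<Longrightarrow> (\<lambda>p. - f p) \<in> S" "f \<in> S \<Longrightarrow> h \<in> S \<Longrightarrow> (\<lambda>p. f p - h p) \<in> S"
proof -
  show *: "(\<lambda>p. - f p) \<in> S" if "f \<in> S" for f
    using S_mult[OF S_const[of "-1"] that] by simp
  show "(\<lambda>p. f p - h p) \<in> S" if "f \<in> S" "h \<in> S"
    using S_add[OF that(1) *[OF that(2)]] by simp
qed

lemma der_cmult: "X \<in> F \<Longrightarrow> f \<in> S \<Longrightarrow> der X (\<lambda>q. r * f q) p = r * der X f p"
  by (simp add: der_mult)

lemma der_diff: "X \<in> F \<Longrightarrow> f \<in> S \<Longrightarrow> h \<in> S \<Longrightarrow> der X (\<lambda>q. f q - h q) p = der X f p - der X h p"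
  using der_add[of X f "\<lambda>q. -1 * h q" p] der_cmult[of X h "-1" p] S_mult[OF S_const[of "-1"], of h]
  by simp

lemma der_scale_left: "X \<in> F \<Longrightarrow> f \<in> S \<Longrightarrow> der (r *\<^sub>R X) f p = r * der X f p"
  using der_smul[of X "\<lambda>_. r" f p] by (simp add: smul_const)

lemma der_minus_left: "X \<in> F \<Longrightarrow> f \<in> S \<Longrightarrow> der (- X) f p = - der X f p"
  using der_scale_left[of X f "-1" p] by simp

lemma g_scale_left: "X \<in> F \<Longrightarrow> Z \<in> F \<Longrightarrow> g (r *\<^sub>R X) Z p = r * g X Z p"
  using g_smul_left[of X Z "\<lambda>_. r" p] by (simp add: smul_const)

lemma g_minus_left: "X \<in> F \<Longrightarrow> Z \<in> F \<Longrightarrow> g (- X) Z p = - g X Z p"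
  using g_scale_left[of X Z "-1" p] by simp

lemma g_diff_left: "X \<in> F \<Longrightarrow> Y \<in> F \<Longrightarrow> Z \<in> F \<Longrightarrow> g (X - Y) Z p = g X Z p - g Y Z p"
  using g_add_left[of X "- Y" Z p] by (simp add: g_minus_left)

lemma g_zero_left: "Z \<in> F \<Longrightarrow> g 0 Z p = 0"
  using g_scale_left[of 0 Z 0 p] by simp

lemma g_sum_left: "(\<And>i. i \<in> I \<Longrightarrow> T i \<in> F) \<Longrightarrow> Z \<in> F \<Longrightarrow> g (sum T I) Z p = (\<Sum>i\<in>I. g (T i) Z p)"
  by (induction I rule: infinite_finite_induct) (auto simp: g_zero_left g_add_left)

lemma g_add_right: "X \<in> F \<Longrightarrow> Y \<in> F \<Longrightarrow> Z \<in> F \<Longrightarrow> g Z (X + Y) p = g Z X p + g Z Y p"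
  by (simp add: g_sym[of Z] g_add_left)

lemma g_smul_right: "X \<in> F \<Longrightarrow> Z \<in> F \<Longrightarrow> f \<in> S \<Longrightarrow> g Z (smul f X) p = f p * g Z X p"
  by (simp add: g_sym[of Z] g_smul_left)

lemma g_scale_right: "X \<in> F \<Longrightarrow> Z \<in> F \<Longrightarrow> g Z (r *\<^sub>R X) p = r * g Z X p"
  by (simp add: g_sym[of Z] g_scale_left)

lemma g_minus_right: "X \<in> F \<Longrightarrow> Z \<in> F \<Longrightarrow> g Z (- X) p = - g Z X p"
  by (simp add: g_sym[of Z] g_minus_left)

lemma g_diff_right: "X \<in> F \<Longrightarrow> Y \<in> F \<Longrightarrow> Z \<in> F \<Longrightarrow> g Z (X - Y) p = g Z X p - g Z Y p"
  by (simp add: g_sym[of Z] g_diff_left)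

lemma g_zero_right: "Z \<in> F \<Longrightarrow> g Z 0 p = 0"
  by (simp add: g_sym[of Z] g_zero_left)

lemma g_sum_right: "(\<And>i. i \<in> I \<Longrightarrow> T i \<in> F) \<Longrightarrow> Z \<in> F \<Longrightarrow> g Z (sum T I) p = (\<Sum>i\<in>I. g Z (T i) p)"
  by (simp add: g_sym[of Z] g_sum_left)

lemmas g_lin = g_add_left g_diff_left g_minus_left g_scale_left g_zero_left g_smul_left
  g_add_right g_diff_right g_minus_right g_scale_right g_zero_right g_smul_right

lemma F_eqI: "X \<in> F \<Longrightarrow> Y \<in> F \<Longrightarrow> (\<And>Z p. Z \<in> F \<Longrightarrow> g X Z p = g Y Z p) \<Longrightarrow> X = Y"
  using g_nondeg[of "X - Y"] by (simp add: g_diff_left)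

lemma D_scale_left: "X \<in> F \<Longrightarrow> Y \<in> F \<Longrightarrow> D (r *\<^sub>R X) Y = r *\<^sub>R D X Y"
  using D_smul_left[of X Y "\<lambda>_. r"] by (simp add: smul_const)

lemma D_minus_left: "X \<in> F \<Longrightarrow> Y \<in> F \<Longrightarrow> D (- X) Y = - D X Y"
  using D_scale_left[of X Y "-1"] by simp

lemma D_diff_left: "X \<in> F \<Longrightarrow> X' \<in> F \<Longrightarrow> Y \<in> F \<Longrightarrow> D (X - X') Y = D X Y - D X' Y"
  using D_add_left[of X "- X'" Y] by (simp add: D_minus_left)

lemma D_zero_left: "Y \<in> F \<Longrightarrow> D 0 Y = 0"
  using D_scale_left[of 0 Y 0] by simp

lemma smul_der_const: "X \<in> F \<Longrightarrow> Y \<in> F \<Longrightarrow> smul (der X (\<lambda>_. r)) Y = 0"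
  by (rule F_eqI) (simp_all add: g_lin)

lemma D_scale_right: "X \<in> F \<Longrightarrow> Y \<in> F \<Longrightarrow> D X (r *\<^sub>R Y) = r *\<^sub>R D X Y"
  using D_smul_right[of X Y "\<lambda>_. r"] by (simp add: smul_const smul_der_const)

lemma D_minus_right: "X \<in> F \<Longrightarrow> Y \<in> F \<Longrightarrow> D X (- Y) = - D X Y"
  using D_scale_right[of X Y "-1"] by simp

lemma D_diff_right: "X \<in> F \<Longrightarrow> Y \<in> F \<Longrightarrow> Y' \<in> F \<Longrightarrow> D X (Y - Y') = D X Y - D X Y'"
  using D_add_right[of X Y "- Y'"] by (simp add: D_minus_right)

lemma D_zero_right: "X \<in> F \<Longrightarrow> D X 0 = 0"
  using D_scale_right[of X 0 0] by simp

lemma D_sum_right: "(\<And>i. i \<in> I \<Longrightarrow> T i \<in> F) \<Longrightarrow> X \<in> F \<Longrightarrow> D X (sum T I) = (\<Sum>i\<in>I. D X (T i))"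
  by (induction I rule: infinite_finite_induct) (auto simp: D_zero_right D_add_right)

lemmas D_lin = D_add_left D_diff_left D_minus_left D_scale_left D_zero_left
  D_add_right D_diff_right D_minus_right D_scale_right D_zero_right

section \<open>Curvature of a torsion-free metric connection and its symmetries\<close>

definition br :: "'v \<Rightarrow> 'v \<Rightarrow> 'v" where
  "br X Y = D X Y - D Y X"

definition R :: "'v \<Rightarrow> 'v \<Rightarrow> 'v \<Rightarrow> 'v" where
  "R X Y Z = D X (D Y Z) - D Y (D X Z) - D (br X Y) Z"

text \<open>The order of the arguments follows \<open>curvature_tensor\<close>, so that
  \<open>Rm X Y X Y\<close> is the numerator of the sectional curvature.\<close>

definition Rm :: "'v \<Rightarrow> 'v \<Rightarrow> 'v \<Rightarrow> 'v \<Rightarrow> 'm \<Rightarrow> real" where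
  "Rm X Y Z W = g (R Z W Y) X"

lemma br_in [simp]: "X \<in> F \<Longrightarrow> Y \<in> F \<Longrightarrow> br X Y \<in> F"
  by (simp add: br_def)

lemma R_in [simp]: "X \<in> F \<Longrightarrow> Y \<in> F \<Longrightarrow> Z \<in> F \<Longrightarrow> R X Y Z \<in> F"
  by (simp add: R_def)

lemma der_br: "X \<in> F \<Longrightarrow> Y \<in> F \<Longrightarrow> f \<in> S \<Longrightarrow>
    der (br X Y) f p = der X (der Y f) p - der Y (der X f) p"
  by (simp add: br_def torsion_free)

lemma der_br_fun: "X \<in> F \<Longrightarrow> Y \<in> F \<Longrightarrow> f \<in> S \<Longrightarrow>
    der (br X Y) f = (\<lambda>p. der X (der Y f) p - der Y (der X f) p)"
  by (rule ext) (rule der_br)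

text \<open>\<open>br\<close> is defined from the connection, and \<open>torsion_free\<close> makes
  it act on functions as a commutator of derivations. For commutators the Jacobi sum cancels, and
  \<open>faithful\<close> lifts this from derivations to fields.\<close>

lemma jacobi:
  assumes "X \<in> F" "Y \<in> F" "Z \<in> F"
  shows "br X (br Y Z) + br Y (br Z X) + br Z (br X Y) = 0"
proof (rule faithful)
  show "br X (br Y Z) + br Y (br Z X) + br Z (br X Y) \<in> F"
    using assms by simp
  fix f p assume "f \<in> S"
  with assms show "der (br X (br Y Z) + br Y (br Z X) + br Z (br X Y)) f p = 0"
    by (simp add: der_add_left der_br der_br_fun der_diff)
qed

lemma first_bianchi_R:
  assumes "X \<in> F" "Y \<in> F" "Z \<in> F"
  shows "R X Y Z + R Y Z X + R Z X Y = 0"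
  using assms jacobi[OF assms] by (simp add: R_def br_def D_lin algebra_simps)

lemma R_skew: "X \<in> F \<Longrightarrow> Y \<in> F \<Longrightarrow> Z \<in> F \<Longrightarrow> R Y X Z = - R X Y Z"
  by (simp add: R_def br_def D_lin)

lemma Rm_skew34: "X \<in> F \<Longrightarrow> Y \<in> F \<Longrightarrow> Z \<in> F \<Longrightarrow> W \<in> F \<Longrightarrow> Rm X Y W Z p = - Rm X Y Z W p"
  unfolding Rm_def by (subst R_skew) (simp_all add: g_lin)

text \<open>When \<open>br Z W\<close> is applied to the function \<open>g X Y\<close> and both
  sides are expanded by metric compatibility, the products of first derivatives cancel; what remains
  is the skewness of \<open>R Z W\<close>.\<close>

lemma Rm_skew12:
  assumes "X \<in> F" "Y \<in> F" "Z \<in> F" "W \<in> F"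
  shows "Rm Y X Z W p = - Rm X Y Z W p"
proof -
  have m: "der V (g X Y) = (\<lambda>p. g (D V X) Y p + g X (D V Y) p)" if "V \<in> F" for V
    using assms that by (intro ext metric)
  have "der (br Z W) (g X Y) p = der Z (der W (g X Y)) p - der W (der Z (g X Y)) p"
    using assms by (simp add: der_br)
  then have "g (R Z W X) Y p + g X (R Z W Y) p = 0"
    using assms by (simp add: m der_add metric R_def g_lin)
  then show ?thesis
    using assms by (simp add: Rm_def g_sym[of X])
qed

lemma first_bianchi:
  assumes "X \<in> F" "Y \<in> F" "Z \<in> F" "W \<in> F"
  shows "Rm X Y Z W p + Rm X Z W Y p + Rm X W Y Z p = 0"
proof -
  have "g (R Z W Y + R W Y Z + R Y Z W) X p = 0"
    using assms by (simp only: first_bianchi_R g_zero_left)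
  then show ?thesis
    using assms by (simp add: Rm_def g_lin)
qed

text \<open>The classical combination of four first Bianchi identities with the two skew
  symmetries.\<close>

lemma Rm_pair:
  assumes "X \<in> F" "Y \<in> F" "Z \<in> F" "W \<in> F"
  shows "Rm Z W X Y p = Rm X Y Z W p"
  using first_bianchi[OF assms, of p] first_bianchi[OF assms(2,3,4,1), of p]
    first_bianchi[OF assms(3,4,1,2), of p] first_bianchi[OF assms(4,1,2,3), of p]
    assms Rm_skew12[of _ _ _ _ p] Rm_skew34[of _ _ _ _ p]
  by (smt (verit))

lemma Rm_add:
  assumes "X \<in> F" "X' \<in> F" "Y \<in> F" "Z \<in> F" "W \<in> F"
  shows "Rm (X + X') Y Z W p = Rm X Y Z W p + Rm X' Y Z W p"
    "Rm Y (X + X') Z W p = Rm Y X Z W p + Rm Y X' Z W p"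
    "Rm Y Z (X + X') W p = Rm Y Z X W p + Rm Y Z X' W p"
    "Rm Y Z W (X + X') p = Rm Y Z W X p + Rm Y Z W X' p"
  using assms by (simp_all add: Rm_def R_def br_def g_lin D_lin)

text \<open>Only the first slot is checked directly, where \<open>f\<close> is not differentiated;
  the other three are reached through the symmetries, which avoids the product rule inside
  \<open>R\<close>.\<close>

lemma Rm_smul:
  assumes "X \<in> F" "Y \<in> F" "Z \<in> F" "W \<in> F" "f \<in> S"
  shows "Rm (smul f X) Y Z W p = f p * Rm X Y Z W p"
    "Rm Y (smul f X) Z W p = f p * Rm Y X Z W p"
    "Rm Y Z (smul f X) W p = f p * Rm Y Z X W p"
    "Rm Y Z W (smul f X) p = f p * Rm Y Z W X p"
proof -
  have 1: "Rm (smul f X) Y Z W p = f p * Rm X Y Z W p"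
    if "Y \<in> F" "Z \<in> F" "W \<in> F" for Y Z W
    using assms that by (simp add: Rm_def g_lin)
  have 2: "Rm Y (smul f X) Z W p = f p * Rm Y X Z W p"
    if "Y \<in> F" "Z \<in> F" "W \<in> F" for Y Z W
    using 1[OF that] Rm_skew12[of X Y Z W p] Rm_skew12[of "smul f X" Y Z W p] assms that by simp
  show "Rm (smul f X) Y Z W p = f p * Rm X Y Z W p" "Rm Y (smul f X) Z W p = f p * Rm Y X Z W p"
    using 1 2 assms by blast+
  show "Rm Y Z (smul f X) W p = f p * Rm Y Z X W p"
    using 1[of W Y Z] Rm_pair[of Y Z "smul f X" W p] Rm_pair[of Y Z X W p] assms by simp
  show "Rm Y Z W (smul f X) p = f p * Rm Y Z W X p"
    using 2[of W Y Z] Rm_pair[of Y Z W "smul f X" p] Rm_pair[of Y Z W X p] assms by simp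
qed

lemma Rm_scale:
  assumes "X \<in> F" "Y \<in> F" "Z \<in> F" "W \<in> F"
  shows "Rm (r *\<^sub>R X) Y Z W p = r * Rm X Y Z W p"
    "Rm Y (r *\<^sub>R X) Z W p = r * Rm Y X Z W p"
    "Rm Y Z (r *\<^sub>R X) W p = r * Rm Y Z X W p"
    "Rm Y Z W (r *\<^sub>R X) p = r * Rm Y Z W X p"
  using Rm_smul[OF assms, of "\<lambda>_. r" p] assms by (simp_all add: smul_const)

lemma Rm_minus:
  assumes "X \<in> F" "Y \<in> F" "Z \<in> F" "W \<in> F"
  shows "Rm (- X) Y Z W p = - Rm X Y Z W p"
    "Rm Y (- X) Z W p = - Rm Y X Z W p"
    "Rm Y Z (- X) W p = - Rm Y Z X W p"
    "Rm Y Z W (- X) p = - Rm Y Z W X p"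
  using Rm_scale[OF assms, of "-1" p] by simp_all

text \<open>This is (nabla_X R)(V, W, Y, Z), the covariant derivative of the (0,4) curvature
  tensor.\<close>

definition DRm :: "'v \<Rightarrow> 'v \<Rightarrow> 'v \<Rightarrow> 'v \<Rightarrow> 'v \<Rightarrow> 'm \<Rightarrow> real" where
  "DRm X V W Y Z p = der X (Rm V W Y Z) p - Rm (D X V) W Y Z p - Rm V (D X W) Y Z p
     - Rm V W (D X Y) Z p - Rm V W Y (D X Z) p"

lemma second_bianchi:
  assumes "X \<in> F" "Y \<in> F" "Z \<in> F" "V \<in> F" "W \<in> F"
  shows "DRm X V W Y Z p + DRm Y V W Z X p + DRm Z V W X Y p = 0"
proof -
  have e: "DRm X V W Y Z p = g (D X (R Y Z W) - R Y Z (D X W) - R (D X Y) Z W - R Y (D X Z) W) V p"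
    if "X \<in> F" "Y \<in> F" "Z \<in> F" for X Y Z
    using that assms by (simp add: DRm_def Rm_def metric g_lin)
  \<comment> \<open>In the cyclic sum the terms that differentiate \<open>W\<close> more than once
    cancel; what survives is the derivative of \<open>W\<close> along the Jacobi sum.\<close>
  have j: "D (D X (D Y Z)) W - D (D X (D Z Y)) W - D (D (D Y Z) X) W + D (D (D Z Y) X) W
     + D (D Y (D Z X)) W - D (D Y (D X Z)) W - D (D (D Z X) Y) W + D (D (D X Z) Y) W
     + D (D Z (D X Y)) W - D (D Z (D Y X)) W - D (D (D X Y) Z) W + D (D (D Y X) Z) W = 0"
  proof -
    have "D (br X (br Y Z) + br Y (br Z X) + br Z (br X Y)) W = 0"
      using assms by (simp only: jacobi D_zero_left)
    then show ?thesis
      using assms by (simp add: br_def D_lin algebra_simps)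
  qed
  have "g (D (D X (D Y Z)) W - D (D X (D Z Y)) W - D (D (D Y Z) X) W + D (D (D Z Y) X) W
     + D (D Y (D Z X)) W - D (D Y (D X Z)) W - D (D (D Z X) Y) W + D (D (D X Z) Y) W
     + D (D Z (D X Y)) W - D (D Z (D Y X)) W - D (D (D X Y) Z) W + D (D (D Y X) Z) W) V p = 0"
    using assms by (simp only: j g_zero_left)
  then show ?thesis
    using assms by (simp add: e R_def br_def D_lin g_lin)
qed

end

section \<open>S-structures\<close>

text \<open>The one-forms are replaced by \<open>eps \<alpha>\<close> times the metric product with
  \<open>\<xi> \<alpha>\<close>. Under this substitution \<open>deta\<close> is Phi = d eta
  multiplied by 2 \<open>eps \<alpha>\<close>, and \<open>normal\<close> is normality with every d
  eta already replaced by Phi. Of the functions \<open>g (\<xi> \<alpha>) (\<xi> \<beta>)\<close>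
  only the derivatives are prescribed, since for fields cut off outside a chart domain they are
  constant on that domain only.\<close>

locale s_structure_module = levi_civita_module S F smul der D g
  for S :: "('m \<Rightarrow> real) set" and F :: "'v::real_vector set" and smul der D g +
  fixes \<phi> :: "'v \<Rightarrow> 'v" and \<xi> :: "'i \<Rightarrow> 'v" and eps :: "'i \<Rightarrow> real" and I :: "'i set"
  assumes phi_in [simp]: "X \<in> F \<Longrightarrow> \<phi> X \<in> F"
    and xi_in [simp]: "\<alpha> \<in> I \<Longrightarrow> \<xi> \<alpha> \<in> F"
    and phi_skew: "X \<in> F \<Longrightarrow> Y \<in> F \<Longrightarrow> g (\<phi> X) Y p = - g X (\<phi> Y) p"
    and phi_sq: "X \<in> F \<Longrightarrow>
      \<phi> (\<phi> X) = - X + (\<Sum>\<alpha>\<in>I. smul (\<lambda>p. eps \<alpha> * g X (\<xi> \<alpha>) p) (\<xi> \<alpha>))"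
    and phi_xi [simp]: "\<alpha> \<in> I \<Longrightarrow> \<phi> (\<xi> \<alpha>) = 0"
    and I_nonempty: "I \<noteq> {}"
    and eps_sq: "\<alpha> \<in> I \<Longrightarrow> eps \<alpha> * eps \<alpha> = 1"
    and der_g_xi_xi: "X \<in> F \<Longrightarrow> \<alpha> \<in> I \<Longrightarrow> \<beta> \<in> I \<Longrightarrow> der X (g (\<xi> \<alpha>) (\<xi> \<beta>)) p = 0"
    and deta: "X \<in> F \<Longrightarrow> Y \<in> F \<Longrightarrow> \<alpha> \<in> I \<Longrightarrow>
      der X (g Y (\<xi> \<alpha>)) p - der Y (g X (\<xi> \<alpha>)) p - g (br X Y) (\<xi> \<alpha>) p = 2 * eps \<alpha> * g X (\<phi> Y) p"
    and normal: "X \<in> F \<Longrightarrow> Y \<in> F \<Longrightarrow>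
      br (\<phi> X) (\<phi> Y) + \<phi> (\<phi> (br X Y)) - \<phi> (br (\<phi> X) Y) - \<phi> (br X (\<phi> Y))
        + smul (\<lambda>p. 2 * g X (\<phi> Y) p) (\<Sum>\<alpha>\<in>I. \<xi> \<alpha>) = 0"
begin

lemma phi_skew': "X \<in> F \<Longrightarrow> Y \<in> F \<Longrightarrow> g X (\<phi> Y) p = - g (\<phi> X) Y p"
  by (simp add: phi_skew)

lemma phi_add: "X \<in> F \<Longrightarrow> Y \<in> F \<Longrightarrow> \<phi> (X + Y) = \<phi> X + \<phi> Y"
  by (rule F_eqI) (simp_all add: phi_skew g_lin)

lemma phi_scale: "X \<in> F \<Longrightarrow> \<phi> (r *\<^sub>R X) = r *\<^sub>R \<phi> X"
  by (rule F_eqI) (simp_all add: phi_skew g_lin)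

lemma phi_minus: "X \<in> F \<Longrightarrow> \<phi> (- X) = - \<phi> X"
  by (rule F_eqI) (simp_all add: phi_skew g_lin)

lemma phi_diff: "X \<in> F \<Longrightarrow> Y \<in> F \<Longrightarrow> \<phi> (X - Y) = \<phi> X - \<phi> Y"
  by (rule F_eqI) (simp_all add: phi_skew g_lin)

lemma phi_zero [simp]: "\<phi> 0 = 0"
  by (rule F_eqI) (simp_all add: phi_skew g_lin)

lemma phi_smul: "X \<in> F \<Longrightarrow> f \<in> S \<Longrightarrow> \<phi> (smul f X) = smul f (\<phi> X)"
  by (rule F_eqI) (simp_all add: phi_skew g_lin)

lemmas phi_lin = phi_add phi_scale phi_minus phi_diff phi_smul

lemma g_phi_xi [simp]: "X \<in> F \<Longrightarrow> \<alpha> \<in> I \<Longrightarrow> g (\<phi> X) (\<xi> \<alpha>) p = 0"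
  by (simp add: phi_skew g_lin)

lemma g_phi_xi_fun [simp]: "X \<in> F \<Longrightarrow> \<alpha> \<in> I \<Longrightarrow> g (\<phi> X) (\<xi> \<alpha>) = (\<lambda>_. 0)"
  by (rule ext) simp

lemma zero_if: "X \<in> F \<Longrightarrow> \<phi> X = 0 \<Longrightarrow> (\<And>\<alpha> p. \<alpha> \<in> I \<Longrightarrow> g X (\<xi> \<alpha>) p = 0) \<Longrightarrow> X = 0"
proof -
  assume X: "X \<in> F" "\<phi> X = 0" "\<And>\<alpha> p. \<alpha> \<in> I \<Longrightarrow> g X (\<xi> \<alpha>) p = 0"
  have "(\<Sum>\<alpha>\<in>I. smul (\<lambda>p. eps \<alpha> * g X (\<xi> \<alpha>) p) (\<xi> \<alpha>)) = (\<Sum>\<alpha>\<in>I. 0)"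
    using X by (intro sum.cong) (simp_all add: smul_const)
  then show "X = 0"
    using phi_sq[OF X(1)] X(2) by simp
qed

text \<open>By \<open>phi_sq\<close> a field is \<open>- \<phi> (\<phi> X)\<close> plus a
  combination of the \<open>\<xi> \<alpha>\<close> with function coefficients. This is the device
  for checking tensorial identities separately on horizontal fields and on the
  \<open>\<xi> \<alpha>\<close>.\<close>

lemma functional_horizontal:
  assumes add: "\<And>X Y. X \<in> F \<Longrightarrow> Y \<in> F \<Longrightarrow> L (X + Y) = L X + (L Y :: real)"
    and smul: "\<And>f X. f \<in> S \<Longrightarrow> X \<in> F \<Longrightarrow> L (smul f X) = f p * L X"
    and xi: "\<And>\<alpha>. \<alpha> \<in> I \<Longrightarrow> L (\<xi> \<alpha>) = 0" and X: "X \<in> F"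
  shows "L X = L (- \<phi> (\<phi> X))"
proof -
  have L0: "L 0 = 0"
    using add[of 0 0] by simp
  have "L (\<Sum>\<alpha>\<in>J. smul (\<lambda>p. eps \<alpha> * g X (\<xi> \<alpha>) p) (\<xi> \<alpha>)) = 0" if "J \<subseteq> I" for J
    using that
  proof (induction J rule: infinite_finite_induct)
    case (insert \<alpha> J)
    have "smul (\<lambda>p. eps \<beta> * g X (\<xi> \<beta>) p) (\<xi> \<beta>) \<in> F" if "\<beta> \<in> I" for \<beta>
      using X that by simp
    with insert show ?case
      using X by (simp add: add smul xi subset_iff)
  qed (simp_all add: L0)
  moreover have "X = - \<phi> (\<phi> X) + (\<Sum>\<alpha>\<in>I. smul (\<lambda>p. eps \<alpha> * g X (\<xi> \<alpha>) p) (\<xi> \<alpha>))"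
    using phi_sq[OF X] by simp
  ultimately show ?thesis
    using add[of "- \<phi> (\<phi> X)" "\<Sum>\<alpha>\<in>I. smul (\<lambda>p. eps \<alpha> * g X (\<xi> \<alpha>) p) (\<xi> \<alpha>)"] X by simp
qed

subsection \<open>The characteristic vector fields are Killing\<close>

text \<open>Invariance of the one-forms along \<open>\<xi> \<beta>\<close>. In Cartan's formula the
  value of the form on \<open>\<xi> \<beta>\<close> has zero derivative, and contracting d eta = Phi
  with \<open>\<xi> \<beta>\<close> gives zero because
  \<open>\<phi> (\<xi> \<beta>) = 0\<close>.\<close>

lemma g_br_xi:
  assumes "X \<in> F" "\<alpha> \<in> I" "\<beta> \<in> I"
  shows "g (br (\<xi> \<beta>) X) (\<xi> \<alpha>) p = der (\<xi> \<beta>) (g X (\<xi> \<alpha>)) p"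
  using deta[of "\<xi> \<beta>" X \<alpha> p] assms
  by (simp add: der_g_xi_xi phi_skew' g_lin)

text \<open>Normality with \<open>\<xi> \<beta>\<close> in one slot gives the identity only after
  applying \<open>\<phi>\<close>; the missing components along the \<open>\<xi> \<alpha>\<close> are
  supplied by \<open>g_br_xi\<close>.\<close>

lemma br_xi_phi:
  assumes X: "X \<in> F" and b: "\<beta> \<in> I"
  shows "br (\<xi> \<beta>) (\<phi> X) = \<phi> (br (\<xi> \<beta>) X)"
proof -
  have n: "\<phi> (\<phi> (br (\<xi> \<beta>) X)) - \<phi> (br (\<xi> \<beta>) (\<phi> X)) = 0"
    using normal[of "\<xi> \<beta>" X] assms
    by (simp add: br_def[of 0] D_lin phi_skew'[of "\<xi> \<beta>"] g_lin smul_const)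
  have "br (\<xi> \<beta>) (\<phi> X) - \<phi> (br (\<xi> \<beta>) X) = 0"
  proof (rule zero_if)
    show "\<phi> (br (\<xi> \<beta>) (\<phi> X) - \<phi> (br (\<xi> \<beta>) X)) = 0"
      using n assms by (simp add: phi_lin)
    show "g (br (\<xi> \<beta>) (\<phi> X) - \<phi> (br (\<xi> \<beta>) X)) (\<xi> \<alpha>) p = 0" if "\<alpha> \<in> I" for \<alpha> p
      using assms that by (simp add: g_lin g_br_xi)
  qed (use assms in simp)
  then show ?thesis by simp
qed

lemma br_xi_xi: "\<alpha> \<in> I \<Longrightarrow> \<beta> \<in> I \<Longrightarrow> br (\<xi> \<alpha>) (\<xi> \<beta>) = 0"
  using br_xi_phi[of "\<xi> \<beta>" \<alpha>]
  by (rule_tac zero_if) (simp_all add: g_br_xi der_g_xi_xi br_def[of _ 0] D_lin)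

text \<open>The Lie derivative along \<open>\<xi> \<beta>\<close> commutes with d and annihilates
  the one-form, hence also Phi = d eta. The proof carries this out by hand, with the Jacobi identity
  for the bracket term.\<close>

lemma lie_xi_Phi:
  assumes "X \<in> F" "Y \<in> F" "\<beta> \<in> I"
  shows "der (\<xi> \<beta>) (g X (\<phi> Y)) p = g (br (\<xi> \<beta>) X) (\<phi> Y) p + g X (\<phi> (br (\<xi> \<beta>) Y)) p"
proof -
  let ?L = "\<lambda>Z. br (\<xi> \<beta>) Z"
  have Phi: "g X (\<phi> Y) = (\<lambda>p. (eps \<beta> / 2) *
      (der X (g Y (\<xi> \<beta>)) p - der Y (g X (\<xi> \<beta>)) p - g (br X Y) (\<xi> \<beta>) p))"
    if "X \<in> F" "Y \<in> F" for X Y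
    using deta[OF that assms(3)] eps_sq[OF assms(3)] by (auto simp: fun_eq_iff field_simps)
  have L: "g (?L Z) (\<xi> \<beta>) = der (\<xi> \<beta>) (g Z (\<xi> \<beta>))" if "Z \<in> F" for Z
    using assms that by (intro ext g_br_xi)
  have J: "?L (br X Y) = br (?L X) Y + br X (?L Y)"
  proof -
    have "br X (br Y (\<xi> \<beta>)) = - br X (?L Y)" "br Y (?L X) = - br (?L X) Y"
      using assms by (simp_all add: br_def D_lin)
    then show ?thesis
      using jacobi[of "\<xi> \<beta>" X Y] assms by (simp add: algebra_simps)
  qed
  have "der (\<xi> \<beta>) (g (br X Y) (\<xi> \<beta>)) p = g (br (?L X) Y) (\<xi> \<beta>) p + g (br X (?L Y)) (\<xi> \<beta>) p"
    using assms by (simp add: g_br_xi[symmetric] J g_lin)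
  moreover have "der (\<xi> \<beta>) (g X (\<phi> Y)) p = eps \<beta> / 2 * der (\<xi> \<beta>)
      (\<lambda>p. der X (g Y (\<xi> \<beta>)) p - der Y (g X (\<xi> \<beta>)) p - g (br X Y) (\<xi> \<beta>) p) p"
    using assms by (subst Phi) (simp_all only: der_cmult S_simps der_in g_in xi_in br_in)
  ultimately show ?thesis
    using assms Phi[of "?L X" Y] Phi[of X "?L Y"]
    by (simp add: der_diff L der_br) (simp add: field_simps)
qed

text \<open>The Lie derivative of \<open>g\<close> along \<open>\<xi> \<beta>\<close> is tested on
  \<open>\<phi> Z\<close>, where it reduces to the invariance of Phi and \<open>\<phi>\<close>, and
  on \<open>\<xi> \<alpha>\<close>, where it reduces to that of the one-form. By
  \<open>functional_horizontal\<close> these cases suffice.\<close>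

lemma killing:
  assumes X: "X \<in> F" and Y: "Y \<in> F" and b: "\<beta> \<in> I"
  shows "g (D X (\<xi> \<beta>)) Y p + g X (D Y (\<xi> \<beta>)) p = 0"
proof -
  have lie: "g (D X (\<xi> \<beta>)) Z p + g X (D Z (\<xi> \<beta>)) p
      = der (\<xi> \<beta>) (g X Z) p - g (br (\<xi> \<beta>) X) Z p - g X (br (\<xi> \<beta>) Z) p" if "Z \<in> F" for Z
    using assms that by (simp add: metric br_def g_lin)
  have phi: "g (D X (\<xi> \<beta>)) (\<phi> Z) p + g X (D (\<phi> Z) (\<xi> \<beta>)) p = 0" if "Z \<in> F" for Z
    using assms that by (simp add: lie lie_xi_Phi br_xi_phi)
  have xi: "g (D X (\<xi> \<beta>)) (\<xi> \<alpha>) p + g X (D (\<xi> \<alpha>) (\<xi> \<beta>)) p = 0" if "\<alpha> \<in> I" for \<alpha>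
    using assms that by (simp add: lie g_br_xi br_xi_xi g_lin)
  have "g (D X (\<xi> \<beta>)) Y p + g X (D Y (\<xi> \<beta>)) p
      = g (D X (\<xi> \<beta>)) (- \<phi> (\<phi> Y)) p + g X (D (- \<phi> (\<phi> Y)) (\<xi> \<beta>)) p"
    by (rule functional_horizontal)
      (use X Y b xi in \<open>simp_all add: g_lin D_add_left D_smul_left algebra_simps\<close>)
  then show ?thesis
    using phi[of "\<phi> Y"] assms by (simp add: g_lin D_lin)
qed

text \<open>The skew part of the covariant derivative of \<open>\<xi> \<alpha>\<close> is given by
  \<open>deta\<close> as a multiple of Phi; the symmetric part vanishes by
  \<open>killing\<close>.\<close>

lemma D_xi:
  assumes "X \<in> F" "\<alpha> \<in> I"
  shows "D X (\<xi> \<alpha>) = (- eps \<alpha>) *\<^sub>R \<phi> X"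
proof (rule F_eqI)
  fix Y p assume Y: "Y \<in> F"
  have "g Y (D X (\<xi> \<alpha>)) p - g X (D Y (\<xi> \<alpha>)) p = 2 * eps \<alpha> * g X (\<phi> Y) p"
    using deta[OF assms(1) Y assms(2), of p] assms Y by (simp add: metric br_def g_lin)
  then show "g (D X (\<xi> \<alpha>)) Y p = g ((- eps \<alpha>) *\<^sub>R \<phi> X) Y p"
    using killing[OF assms(1) Y assms(2), of p] assms Y by (simp add: g_lin g_sym[of Y] phi_skew)
qed (use assms in simp_all)

subsection \<open>The covariant derivative of \<phi>\<close>

text \<open>This is (nabla_X phi) Y.\<close>

definition N :: "'v \<Rightarrow> 'v \<Rightarrow> 'v" where
  "N X Y = D X (\<phi> Y) - \<phi> (D X Y)"

text \<open>The horizontal fields, as \<open>g_H_xi\<close> and \<open>H_iff\<close> confirm. Stated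
  through \<open>\<phi>\<close>, membership says at once that \<open>\<phi>\<close> acts on them as
  a complex structure.\<close>

definition H :: "'v set" where
  "H = {X \<in> F. \<phi> (\<phi> X) = - X}"

lemma N_in [simp]: "X \<in> F \<Longrightarrow> Y \<in> F \<Longrightarrow> N X Y \<in> F"
  by (simp add: N_def)

lemma H_in [simp]: "X \<in> H \<Longrightarrow> X \<in> F"
  unfolding H_def by blast

lemma H_sq [simp]: "X \<in> H \<Longrightarrow> \<phi> (\<phi> X) = - X"
  unfolding H_def by blast

lemma H_phi [simp]: "X \<in> H \<Longrightarrow> \<phi> X \<in> H"
  unfolding H_def by (auto simp: phi_lin)

lemma H_add [simp]: "X \<in> H \<Longrightarrow> Y \<in> H \<Longrightarrow> X + Y \<in> H"
  unfolding H_def by (auto simp: phi_lin)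

lemma H_scale [simp]: "X \<in> H \<Longrightarrow> r *\<^sub>R X \<in> H"
  unfolding H_def by (auto simp: phi_lin)

lemma g_H_xi [simp]: assumes "X \<in> H" "\<alpha> \<in> I" shows "g X (\<xi> \<alpha>) p = 0" "g (\<xi> \<alpha>) X p = 0"
proof -
  have "X = - \<phi> (\<phi> X)" using assms by simp
  then show "g X (\<xi> \<alpha>) p = 0"
    using g_phi_xi[of "\<phi> X" \<alpha> p] assms by (simp add: g_lin)
  then show "g (\<xi> \<alpha>) X p = 0"
    using assms by (simp add: g_sym[of "\<xi> \<alpha>"])
qed

lemma H_iff: "X \<in> F \<Longrightarrow> (\<And>\<alpha> p. \<alpha> \<in> I \<Longrightarrow> g X (\<xi> \<alpha>) p = 0) \<Longrightarrow> X \<in> H"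
proof -
  assume X: "X \<in> F" "\<And>\<alpha> p. \<alpha> \<in> I \<Longrightarrow> g X (\<xi> \<alpha>) p = 0"
  have "(\<Sum>\<alpha>\<in>I. smul (\<lambda>p. eps \<alpha> * g X (\<xi> \<alpha>) p) (\<xi> \<alpha>)) = (\<Sum>\<alpha>\<in>I. 0)"
    using X by (intro sum.cong) (simp_all add: smul_const)
  then show "X \<in> H"
    using phi_sq[OF X(1)] X(1) unfolding H_def by simp
qed

lemma phi_H: "X \<in> F \<Longrightarrow> \<phi> X \<in> H"
  by (rule H_iff) simp_all

lemma N_skew:
  assumes "X \<in> F" "Y \<in> F" "Z \<in> F"
  shows "g (N X Y) Z p = - g Y (N X Z) p"
proof -
  have "g (\<phi> Y) Z = (\<lambda>p. -1 * g Y (\<phi> Z) p)"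
    using assms by (auto simp: phi_skew)
  then have "der X (g (\<phi> Y) Z) p = der X (\<lambda>p. -1 * g Y (\<phi> Z) p) p"
    by simp
  also have "\<dots> = - der X (g Y (\<phi> Z)) p"
    using assms by (subst der_cmult) simp_all
  finally show ?thesis
    using assms by (simp add: metric N_def g_lin phi_skew)
qed

lemma N_xi: "X \<in> F \<Longrightarrow> \<alpha> \<in> I \<Longrightarrow> N X (\<xi> \<alpha>) = eps \<alpha> *\<^sub>R \<phi> (\<phi> X)"
  by (simp add: N_def D_xi D_lin phi_lin)

text \<open>This expresses that Phi is closed. It comes here from the first Bianchi identity with
  \<open>\<xi> \<alpha>\<close> among the arguments, because \<open>D_xi\<close> turns
  \<open>R X Y (\<xi> \<alpha>)\<close> into the skew part of \<open>N\<close>.\<close>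

lemma N_cyclic:
  assumes "X \<in> F" "Y \<in> F" "Z \<in> F" "\<alpha> \<in> I"
  shows "g (N X Y) Z p + g (N Y Z) X p + g (N Z X) Y p = 0"
proof -
  have R: "R X Y (\<xi> \<alpha>) = (- eps \<alpha>) *\<^sub>R (N X Y - N Y X)" if "X \<in> F" "Y \<in> F" for X Y
    using that assms(4) by (simp add: R_def D_xi br_def N_def D_lin phi_lin scaleR_diff_right)
  have "Rm (\<xi> \<alpha>) Z X Y p = - Rm Z (\<xi> \<alpha>) X Y p" "Rm (\<xi> \<alpha>) Y Z X p = - Rm Y (\<xi> \<alpha>) Z X p"
    "Rm (\<xi> \<alpha>) X Y Z p = - Rm X (\<xi> \<alpha>) Y Z p"
    using assms by (auto intro: Rm_skew12)
  with first_bianchi[of "\<xi> \<alpha>" X Y Z p] have "Rm Z (\<xi> \<alpha>) X Y p + Rm Y (\<xi> \<alpha>) Z X p + Rm X (\<xi> \<alpha>) Y Z p = 0"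
    using assms by simp
  then have "eps \<alpha> * (g (N X Y) Z p - g (N Y X) Z p + (g (N Z X) Y p - g (N X Z) Y p)
     + (g (N Y Z) X p - g (N Z Y) X p)) = 0"
    using assms by (simp add: Rm_def R g_lin algebra_simps)
  moreover have "eps \<alpha> \<noteq> 0"
    using eps_sq[OF assms(4)] by auto
  ultimately have "g (N X Y) Z p - g (N Y X) Z p + (g (N Z X) Y p - g (N X Z) Y p)
     + (g (N Y Z) X p - g (N Z Y) X p) = 0"
    by (auto simp only: mult_eq_0_iff)
  then show ?thesis
    using N_skew[OF assms(2,1,3), of p] N_skew[OF assms(1,3,2), of p] N_skew[OF assms(3,2,1), of p]
      g_sym[of X "N Y Z"] g_sym[of Z "N X Y"] g_sym[of Y "N Z X"] assms by simp
qed

end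

section \<open>Curvature of S-structures\<close>

text \<open>A curvature-like tensor with Kaehler symmetry is determined by its values on the pairs
  \<open>x\<close>, \<open>J x\<close>. The argument is polarisation and the symmetries alone, so it
  is insensitive to the signature of a metric.\<close>

lemma kaehler_curvature_eq_0:
  fixes B :: "'v::real_vector \<Rightarrow> 'v \<Rightarrow> 'v \<Rightarrow> 'v \<Rightarrow> real"
  assumes H_add: "\<And>x y. x \<in> H \<Longrightarrow> y \<in> H \<Longrightarrow> x + y \<in> H"
    and H_J: "\<And>x. x \<in> H \<Longrightarrow> J x \<in> H"
    and JJ: "\<And>x. x \<in> H \<Longrightarrow> J (J x) = - x"
    and J_add: "\<And>x y. x \<in> H \<Longrightarrow> y \<in> H \<Longrightarrow> J (x + y) = J x + J y"
    and add1: "\<And>x x' y z w. \<lbrakk>x \<in> H; x' \<in> H; y \<in> H; z \<in> H; w \<in> H\<rbrakk> \<Longrightarrow>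
      B (x + x') y z w = B x y z w + B x' y z w"
    and skew12: "\<And>x y z w. \<lbrakk>x \<in> H; y \<in> H; z \<in> H; w \<in> H\<rbrakk> \<Longrightarrow> B y x z w = - B x y z w"
    and pair: "\<And>x y z w. \<lbrakk>x \<in> H; y \<in> H; z \<in> H; w \<in> H\<rbrakk> \<Longrightarrow> B z w x y = B x y z w"
    and bianchi: "\<And>x y z w. \<lbrakk>x \<in> H; y \<in> H; z \<in> H; w \<in> H\<rbrakk> \<Longrightarrow>
      B x y z w + B x z w y + B x w y z = 0"
    and BJ: "\<And>x y z w. \<lbrakk>x \<in> H; y \<in> H; z \<in> H; w \<in> H\<rbrakk> \<Longrightarrow> B (J x) y z w = - B x (J y) z w"
    and hol: "\<And>x. x \<in> H \<Longrightarrow> B x (J x) x (J x) = 0"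
    and mem: "x \<in> H" "y \<in> H" "z \<in> H" "w \<in> H"
  shows "B x y z w = 0"
proof -
  \<comment> \<open>Only sums and \<open>J\<close> are assumed to stay in \<open>H\<close>;
    negatives come from applying \<open>J\<close> twice.\<close>
  have H_neg: "- x \<in> H" if "x \<in> H" for x
    using H_J[OF H_J[OF that]] JJ[OF that] by simp
  have skew34: "B x y w z = - B x y z w" if "x \<in> H" "y \<in> H" "z \<in> H" "w \<in> H" for x y z w
    using that pair[of x y w z] pair[of x y z w] skew12[of z w x y] by simp
  have add2: "B y (x + x') z w = B y x z w + B y x' z w"
    if "x \<in> H" "x' \<in> H" "y \<in> H" "z \<in> H" "w \<in> H" for x x' y z w
    using that add1[of x x' y z w] H_add skew12[of _ y z w] by simp
  have add3: "B y z (x + x') w = B y z x w + B y z x' w"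
    if "x \<in> H" "x' \<in> H" "y \<in> H" "z \<in> H" "w \<in> H" for x x' y z w
    using that add1[of x x' w y z] H_add pair[of _ w y z] by simp
  have add4: "B y z w (x + x') = B y z w x + B y z w x'"
    if "x \<in> H" "x' \<in> H" "y \<in> H" "z \<in> H" "w \<in> H" for x x' y z w
    using that add2[of x x' w y z] H_add pair[of w _ y z] by simp
  note adds = add1 add2 add3 add4
  have neg1: "B (- x) y z w = - B x y z w" if "x \<in> H" "y \<in> H" "z \<in> H" "w \<in> H" for x y z w
  proof -
    have "0 \<in> H" using H_add[OF that(1) H_neg[OF that(1)]] by simp
    then show ?thesis
      using add1[of x "- x" y z w] add1[of 0 0 y z w] that H_neg by simp
  qed
  have neg2: "B y (- x) z w = - B y x z w" if "x \<in> H" "y \<in> H" "z \<in> H" "w \<in> H" for x y z w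
    using that neg1[of x y z w] skew12[of _ y z w] H_neg by simp
  have neg3: "B y z (- x) w = - B y z x w" if "x \<in> H" "y \<in> H" "z \<in> H" "w \<in> H" for x y z w
    using that neg1[of x w y z] H_neg pair[of _ w y z] by simp
  have neg4: "B y z w (- x) = - B y z w x" if "x \<in> H" "y \<in> H" "z \<in> H" "w \<in> H" for x y z w
    using that neg2[of x w y z] H_neg pair[of w _ y z] by simp
  have swap12: "B v (J u) z w = B u (J v) z w" if "u \<in> H" "v \<in> H" "z \<in> H" "w \<in> H" for u v z w
    using BJ[of v u z w] skew12[of "J v" u z w] that H_J by simp
  have swap34: "B z w v (J u) = B z w u (J v)" if "u \<in> H" "v \<in> H" "z \<in> H" "w \<in> H" for u v z w
    using swap12[of u v z w] pair[of z w v "J u"] pair[of z w u "J v"] that H_J by simp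
  have ab: "B x (J x) y (J y) + 2 * B x (J y) x (J y) = 0" if xy: "x \<in> H" "y \<in> H" for x y
  proof -
    have J_neg: "J (- y) = - J y"
      using JJ[OF H_J[OF xy(2)]] by (simp add: JJ[OF xy(2), symmetric])
    \<comment> \<open>Adding the values at \<open>x + y\<close> and \<open>x - y\<close> removes the
      terms of odd degree in \<open>y\<close>; the symmetries collapse the remaining mixed terms to
      two kinds.\<close>
    have "B (x + y) (J (x + y)) (x + y) (J (x + y)) + B (x + - y) (J (x + - y)) (x + - y) (J (x + - y)) = 0"
      using hol xy H_add H_neg by (metis add.right_neutral)
    then have "2 * (B x (J x) x (J x) + B y (J y) y (J y) + B x (J x) y (J y) + B y (J y) x (J x)
      + B x (J y) x (J y) + B x (J y) y (J x) + B y (J x) x (J y) + B y (J x) y (J x)) = 0"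
      using xy by (simp add: J_add J_neg H_neg H_J H_add add1 add2 add3 add4 neg1 neg2 neg3 neg4
          del: add_uminus_conv_diff)
    then show ?thesis
      using hol[OF xy(1)] hol[OF xy(2)] pair[of x "J x" y "J y"] swap12[OF xy, of y "J x"]
        swap12[OF xy, of x "J y"] swap34[OF xy, of x "J y"] xy H_J by simp
  qed
  have k: "B x y x y = 0" if xy: "x \<in> H" "y \<in> H" for x y
  proof -
    have 1: "B x y (J x) (J y) = B x y x y"
      using pair[of x y "J x" "J y"] BJ[of x "J y" x y] xy H_J by (simp add: JJ neg2)
    have 2: "B x (J y) (J x) y = - B x (J y) x (J y)"
      using pair[of x "J y" "J x" y] BJ[of x y x "J y"] xy H_J by simp
    have 3: "B x (J x) y (J y) = B x y x y + B x (J y) x (J y)"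
      using bianchi[of x "J x" y "J y"] 1 2 skew34[of x y "J x" "J y"] xy H_J by simp
    \<comment> \<open>The relation \<open>ab\<close> with \<open>J y\<close> for \<open>y\<close>.
      Together with \<open>ab\<close> itself it equates \<open>B x y x y\<close> and
      \<open>B x (J y) x (J y)\<close>; the mixed term is then twice this value by 3 and minus twice
      it by 4.\<close>
    have 4: "B x (J x) y (J y) + 2 * B x y x y = 0"
      using ab[of x "J y"] xy H_J skew34[of x "J x" y "J y"] by (simp add: JJ neg2 neg4 H_neg)
    show ?thesis
      using 3 4 ab[OF xy] by simp
  qed
  have k2: "B x y x w = 0" if "x \<in> H" "y \<in> H" "w \<in> H" for x y w
    using k[of x "y + w"] k[of x y] k[of x w] pair[of x y x w] that H_add by (simp add: adds)
  have skew13: "B x y z w = - B z y x w" if "x \<in> H" "y \<in> H" "z \<in> H" "w \<in> H" for x y z w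
    using k2[of "x + z" y w] k2[of x y w] k2[of z y w] that H_add by (simp add: adds)
  \<comment> \<open>Skewness in the slots 1 and 3 together with the other symmetries makes the three
    Bianchi terms equal.\<close>
  show ?thesis
    using bianchi[OF mem] skew13[of x z w y] skew12[of z w x y] skew13[of x w y z] skew12[of w y x z]
      pair[of x y z w] pair[of x z w y] mem by simp
qed

section \<open>The curvature of an S-structure on horizontal fields\<close>

context s_structure_module
begin

definition xib :: 'v where "xib = (\<Sum>\<alpha>\<in>I. \<xi> \<alpha>)"
text \<open>This constant enters the curvature formulas through \<open>D_xib\<close>: the derivative
  of \<open>\<phi>\<close> on horizontal fields points along \<open>xib\<close>, and differentiating
  \<open>xib\<close> produces it.\<close>

definition e :: real where "e = (\<Sum>\<alpha>\<in>I. eps \<alpha>)"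

lemma xib_in [simp]: "xib \<in> F"
  by (simp add: xib_def)

lemma D_xib: "X \<in> F \<Longrightarrow> D X xib = (- e) *\<^sub>R \<phi> X"
  by (simp add: xib_def e_def D_sum_right D_xi sum_negf scaleR_sum_left)

lemma g_H_xib [simp]: "X \<in> H \<Longrightarrow> g X xib p = 0" "X \<in> H \<Longrightarrow> g xib X p = 0"
  by (simp_all add: xib_def g_sum_left g_sum_right)

text \<open>Differentiating \<open>g W xib = 0\<close> shows how far a covariant derivative of a
  horizontal field leaves the horizontal distribution.\<close>

lemma g_D_H_xib:
  assumes "X \<in> F" "W \<in> H"
  shows "g (D X W) xib p = e * g W (\<phi> X) p"
proof -
  have "g W xib = (\<lambda>_. 0)"
    using assms by auto
  then show ?thesis
    using metric[of X W xib p] assms by (simp add: D_xib g_lin)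
qed

lemma g_phi_H: "X \<in> F \<Longrightarrow> W \<in> H \<Longrightarrow> g (\<phi> X) (\<phi> W) p = g X W p"
  by (simp add: phi_skew g_lin)

text \<open>Normality (\<open>nij\<close>) and closedness of Phi (\<open>N_cyclic\<close>) are
  linear relations between the horizontal components of the derivative of \<open>\<phi>\<close>; as
  for Kaehler structures, together they leave only zero.\<close>

lemma g_N_H_H:
  assumes X: "X \<in> F" and Y: "Y \<in> H" and Z: "Z \<in> H"
  shows "g (N X Y) Z p = 0"
proof -
  obtain \<alpha> where a: "\<alpha> \<in> I" using I_nonempty by auto
  have nij: "g (N (\<phi> Y) Z) W p - g (N (\<phi> Z) Y) W p + g (N Y Z) (\<phi> W) p - g (N Z Y) (\<phi> W) p = 0"
    if "Y \<in> H" "Z \<in> H" "W \<in> H" for Y Z W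
  proof -
    have "N (\<phi> Y) Z - N (\<phi> Z) Y - \<phi> (N Y Z) + \<phi> (N Z Y) + smul (\<lambda>p. 2 * g Y (\<phi> Z) p) xib = 0"
      using normal[of Y Z] that by (simp add: N_def br_def phi_lin xib_def algebra_simps)
    then have "g (N (\<phi> Y) Z - N (\<phi> Z) Y - \<phi> (N Y Z) + \<phi> (N Z Y)
        + smul (\<lambda>p. 2 * g Y (\<phi> Z) p) xib) W p = 0"
      using that by (simp only: g_zero_left H_in)
    then show ?thesis
      using that by (simp add: g_lin phi_skew)
  qed
  have rel: "g (N (\<phi> Y) Z) X p + g (N (\<phi> Z) X) Y p = g (N (\<phi> X) Y) Z p"
    if "X \<in> H" "Y \<in> H" "Z \<in> H" for X Y Z
    using nij[OF that(2,3,1)] N_cyclic[of "\<phi> X" Y Z \<alpha> p] a that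
      N_skew[of "\<phi> Z" Y X p] N_skew[of Z "\<phi> X" Y p] g_sym[of Y "N (\<phi> Z) X"] g_sym[of "\<phi> X" "N Z Y"]
    by simp
  \<comment> \<open>\<open>rel\<close> says that of three cyclically permuted numbers each is the
    sum of the other two, so all are zero.\<close>
  have "g (N (\<phi> X) Y) Z p = 0" if "X \<in> H" for X
    using rel[OF that Y Z] rel[OF Y Z that] rel[OF Z that Y] by simp
  then have hor: "g (N (\<phi> (\<phi> X)) Y) Z p = 0"
    using phi_H[OF X] by blast
  have "g (N X Y) Z p = g (N (- \<phi> (\<phi> X)) Y) Z p"
  proof (rule functional_horizontal[where p = p])
    fix \<beta> assume b: "\<beta> \<in> I"
    then show "g (N (\<xi> \<beta>) Y) Z p = 0"
      using N_cyclic[of "\<xi> \<beta>" Y Z \<alpha> p] a Y Z N_skew[of Y Z "\<xi> \<beta>" p]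
        by (simp add: N_xi g_lin)
  qed (use X Y Z in \<open>simp_all add: N_def D_lin D_smul_left phi_lin g_lin algebra_simps\<close>)
  then show ?thesis
    using hor X Y Z by (simp add: N_def D_lin phi_lin g_lin)
qed

text \<open>By \<open>g_N_H_H\<close> the field \<open>N X W\<close> has no horizontal part. Its
  component along \<open>\<xi> \<alpha>\<close> follows from \<open>N_skew\<close> and
  \<open>N_xi\<close>; the two factors \<open>eps \<alpha>\<close> multiply to 1, which is why
  \<open>xib\<close> appears without signs.\<close>

lemma N_H:
  assumes X: "X \<in> F" and W: "W \<in> H"
  shows "N X W = smul (g X W) xib"
proof -
  have "\<phi> (\<phi> (N X W)) = 0"
  proof (rule F_eqI)
    fix Z p assume "Z \<in> F"
    then show "g (\<phi> (\<phi> (N X W))) Z p = g 0 Z p"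
      using X W g_N_H_H[OF X W, of "\<phi> (\<phi> Z)" p] by (simp add: phi_skew g_lin phi_H)
  qed (use X W in simp_all)
  then have "N X W = (\<Sum>\<alpha>\<in>I. smul (\<lambda>p. eps \<alpha> * g (N X W) (\<xi> \<alpha>) p) (\<xi> \<alpha>))"
    using phi_sq[of "N X W"] X W by simp
  also have "\<dots> = (\<Sum>\<alpha>\<in>I. smul (g X W) (\<xi> \<alpha>))"
  proof (rule sum.cong)
    fix \<alpha> assume a: "\<alpha> \<in> I"
    have "eps \<alpha> * g (N X W) (\<xi> \<alpha>) p = g X W p" for p
      using N_skew[of X W "\<xi> \<alpha>" p] X W a eps_sq[OF a] g_phi_H[OF X W, of p]
        phi_skew[of "\<phi> X" W p] g_sym[of W "\<phi> (\<phi> X)"]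
      by (simp add: N_xi g_lin mult.assoc[symmetric])
    then show "smul (\<lambda>p. eps \<alpha> * g (N X W) (\<xi> \<alpha>) p) (\<xi> \<alpha>) = smul (g X W) (\<xi> \<alpha>)"
      by presburger
  qed simp
  also have "\<dots> = smul (g X W) xib"
    by (rule F_eqI) (use X W in \<open>simp_all add: xib_def g_sum_left g_lin sum_distrib_left\<close>)
  finally show ?thesis .
qed

lemma R_xi:
  assumes "X \<in> F" "Y \<in> F" "\<alpha> \<in> I"
  shows "R X Y (\<xi> \<alpha>) = (- eps \<alpha>) *\<^sub>R (N X Y - N Y X)"
  using assms by (simp add: R_def D_xi br_def N_def D_lin phi_lin scaleR_diff_right)

lemma R_H_H_xi: "V \<in> H \<Longrightarrow> W \<in> H \<Longrightarrow> \<alpha> \<in> I \<Longrightarrow> R V W (\<xi> \<alpha>) = 0"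
  by (simp add: R_xi N_H g_sym[of V W])

lemma g_R_H_xi:
  assumes "V \<in> F" "W \<in> H" "Z \<in> H" "\<alpha> \<in> I"
  shows "g (R V W (\<xi> \<alpha>)) Z p = - eps \<alpha> * g W Z p * g V xib p"
  using assms N_skew[of W V Z p] by (simp add: R_xi g_lin g_N_H_H N_H)

lemma Rm_H_xi:
  assumes "V \<in> H" "W \<in> H" "\<alpha> \<in> I" "Z \<in> F"
  shows "Rm Z (\<xi> \<alpha>) V W p = 0" "Rm (\<xi> \<alpha>) Z V W p = 0" "Rm V W Z (\<xi> \<alpha>) p = 0" "Rm V W (\<xi> \<alpha>) Z p = 0"
proof -
  show 1: "Rm Z (\<xi> \<alpha>) V W p = 0"
    using assms by (simp add: Rm_def R_H_H_xi g_lin)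
  show 2: "Rm (\<xi> \<alpha>) Z V W p = 0"
    using 1 Rm_skew12[of Z "\<xi> \<alpha>" V W p] assms by simp
  show "Rm V W Z (\<xi> \<alpha>) p = 0" "Rm V W (\<xi> \<alpha>) Z p = 0"
    using 1 2 Rm_pair[of V W Z "\<xi> \<alpha>" p] Rm_pair[of V W "\<xi> \<alpha>" Z p] assms by simp_all
qed

text \<open>The commutator of \<open>R X Y\<close> with \<open>\<phi>\<close> is the skew part of
  the second covariant derivative of \<open>\<phi>\<close>, which \<open>N_H\<close> makes explicit.
  Each term carries \<open>e\<close>, since it comes either from a derivative of \<open>xib\<close>
  or from the component of a derivative of \<open>Z\<close> along \<open>xib\<close>.\<close>

lemma ricci_phi:
  assumes X: "X \<in> H" and Y: "Y \<in> H" and Z: "Z \<in> H" and W: "W \<in> H"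
  shows "g (R X Y (\<phi> Z)) W p + g (R X Y Z) (\<phi> W) p
    = - e * g Z (\<phi> Y) p * g X W p + e * g Y Z p * g X (\<phi> W) p
      + e * g Z (\<phi> X) p * g Y W p - e * g X Z p * g Y (\<phi> W) p"
proof -
  have eq: "R X Y (\<phi> Z) - \<phi> (R X Y Z)
    = N X (D Y Z) + D X (N Y Z) - N Y (D X Z) - D Y (N X Z) - N (br X Y) Z"
    using assms by (simp add: R_def N_def D_lin phi_lin algebra_simps)
  have 1: "g (N X (D Y Z)) W p = - e * g Z (\<phi> Y) p * g X W p" if "X \<in> H" "Y \<in> H" for X Y
    using N_skew[of X "D Y Z" W p] that Z W by (simp add: N_H g_lin g_D_H_xib)
  have 2: "g (D X (N Y Z)) W p = e * g Y Z p * g X (\<phi> W) p" if "X \<in> H" "Y \<in> H" for X Y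
    using that Z W by (simp add: N_H D_smul_right D_xib g_lin phi_skew)
  have "g (R X Y (\<phi> Z) - \<phi> (R X Y Z)) W p = g (N X (D Y Z)) W p + g (D X (N Y Z)) W p
     - g (N Y (D X Z)) W p - g (D Y (N X Z)) W p - g (N (br X Y) Z) W p"
    unfolding eq using assms by (simp add: g_lin)
  then show ?thesis
    using assms 1[OF X Y] 1[OF Y X] 2[OF X Y] 2[OF Y X] g_N_H_H[of "br X Y" Z W p]
    by (simp add: g_lin phi_skew)
qed

text \<open>The constant curvature tensor, composed with \<open>\<phi>\<close> so that it vanishes
  when an argument is some \<open>\<xi> \<alpha>\<close>; on horizontal fields
  \<open>g_phi_H\<close> removes the \<open>\<phi>\<close> again. With \<open>G2\<close> it forms
  the curvature of a complex space form.\<close>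

definition G1 :: "'v \<Rightarrow> 'v \<Rightarrow> 'v \<Rightarrow> 'v \<Rightarrow> 'm \<Rightarrow> real" where
  "G1 X Y Z W p = g (\<phi> X) (\<phi> Z) p * g (\<phi> Y) (\<phi> W) p - g (\<phi> X) (\<phi> W) p * g (\<phi> Y) (\<phi> Z) p"

definition G2 :: "'v \<Rightarrow> 'v \<Rightarrow> 'v \<Rightarrow> 'v \<Rightarrow> 'm \<Rightarrow> real" where
  "G2 X Y Z W p = g X (\<phi> Z) p * g Y (\<phi> W) p - g X (\<phi> W) p * g Y (\<phi> Z) p
     + 2 * g X (\<phi> Y) p * g Z (\<phi> W) p"

text \<open>Four times the expected horizontal curvature. The weights are forced: on
  \<open>X\<close>, \<open>\<phi> X\<close> the values of \<open>G1\<close> and \<open>G2\<close>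
  are in the ratio 1 to 3, and c + 3 e plus three times c - e is 4 c; moreover their defects from
  Kaehler symmetry are opposite, so the difference 4 e of the weights has to match the defect of
  \<open>4 * Rm\<close>, found in \<open>Rm_phi\<close>.\<close>

definition K :: "('m \<Rightarrow> real) \<Rightarrow> 'v \<Rightarrow> 'v \<Rightarrow> 'v \<Rightarrow> 'v \<Rightarrow> 'm \<Rightarrow> real" where
  "K c X Y Z W p = (c p + 3 * e) * G1 X Y Z W p + (c p - e) * G2 X Y Z W p"

lemmas K_defs = K_def G1_def G2_def

lemma g_phi_sym: "X \<in> F \<Longrightarrow> Y \<in> F \<Longrightarrow> g Y (\<phi> X) p = - g X (\<phi> Y) p"
  by (simp add: phi_skew' g_sym[of "\<phi> Y" X])

lemma K_H:
  assumes "X \<in> F" "Y \<in> F" "Z \<in> H" "W \<in> H"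
  shows "K c X Y Z W p = (c p + 3 * e) * (g X Z p * g Y W p - g X W p * g Y Z p)
     + (c p - e) * (g X (\<phi> Z) p * g Y (\<phi> W) p - g X (\<phi> W) p * g Y (\<phi> Z) p
     + 2 * g X (\<phi> Y) p * g Z (\<phi> W) p)"
  using assms by (simp add: K_defs g_phi_H)

lemma K_add:
  assumes "X \<in> F" "X' \<in> F" "Y \<in> F" "Z \<in> F" "W \<in> F"
  shows "K c (X + X') Y Z W p = K c X Y Z W p + K c X' Y Z W p"
  using assms by (simp add: K_defs phi_add g_lin algebra_simps)

lemma K_smul:
  assumes "X \<in> F" "Y \<in> F" "Z \<in> F" "W \<in> F" "f \<in> S"
  shows "K c (smul f X) Y Z W p = f p * K c X Y Z W p"
  using assms by (simp add: K_defs phi_smul g_lin algebra_simps)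

lemma K_xi:
  assumes "\<alpha> \<in> I" "Y \<in> F" "Z \<in> F" "W \<in> F"
  shows "K c (\<xi> \<alpha>) Y Z W p = 0"
  using assms by (simp add: K_defs phi_skew' g_lin)

lemma K_skew12:
  assumes "X \<in> F" "Y \<in> F" "Z \<in> F" "W \<in> F"
  shows "K c Y X Z W p = - K c X Y Z W p"
  using assms g_phi_sym[of X Y p] by (simp add: K_defs algebra_simps)

lemma K_pair:
  assumes "X \<in> F" "Y \<in> F" "Z \<in> F" "W \<in> F"
  shows "K c Z W X Y p = K c X Y Z W p"
proof -
  have "g (\<phi> Z) (\<phi> X) = g (\<phi> X) (\<phi> Z)" "g (\<phi> W) (\<phi> Y) = g (\<phi> Y) (\<phi> W)"
    "g (\<phi> Z) (\<phi> Y) = g (\<phi> Y) (\<phi> Z)" "g (\<phi> W) (\<phi> X) = g (\<phi> X) (\<phi> W)"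
    using assms by (auto intro: g_sym)
  then show ?thesis
    using assms g_phi_sym[of X Z p] g_phi_sym[of X W p] g_phi_sym[of Y Z p] g_phi_sym[of Y W p]
    by (simp add: K_defs algebra_simps)
qed

lemma K_bianchi:
  assumes "X \<in> F" "Y \<in> F" "Z \<in> F" "W \<in> F"
  shows "K c X Y Z W p + K c X Z W Y p + K c X W Y Z p = 0"
proof -
  have "g (\<phi> Z) (\<phi> Y) = g (\<phi> Y) (\<phi> Z)" "g (\<phi> W) (\<phi> Y) = g (\<phi> Y) (\<phi> W)"
    "g (\<phi> W) (\<phi> Z) = g (\<phi> Z) (\<phi> W)"
    using assms by (auto intro: g_sym)
  then show ?thesis
    using assms g_phi_sym[of Y Z p] g_phi_sym[of Y W p] g_phi_sym[of Z W p]
    by (simp add: K_defs algebra_simps)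
qed

lemma K_phi:
  assumes "X \<in> H" "Y \<in> H" "Z \<in> H" "W \<in> H"
  shows "K c (\<phi> X) Y Z W p + K c X (\<phi> Y) Z W p
    = 4 * e * (g X (\<phi> W) p * g Y Z p - g X (\<phi> Z) p * g Y W p
       + g X W p * g Y (\<phi> Z) p - g X Z p * g Y (\<phi> W) p)"
  using assms
  by (simp add: K_H phi_skew g_lin) (simp add: algebra_simps)

end

section \<open>Pointwise constant holomorphic curvature\<close>

text \<open>\<open>hol\<close> is the curvature hypothesis with the denominator multiplied out, so
  that it also speaks about null vectors, on which the sectional curvature says nothing.\<close>

locale s_space_form_module = s_structure_module S F smul der D g \<phi> \<xi> eps I
  for S :: "('m \<Rightarrow> real) set" and F :: "'v::real_vector set" and smul der D g \<phi>
    and \<xi> :: "'i \<Rightarrow> 'v" and eps I +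
  fixes c :: "'m \<Rightarrow> real"
  assumes c_in [simp]: "c \<in> S"
    and hol: "X \<in> F \<Longrightarrow> \<phi> (\<phi> X) = - X \<Longrightarrow>
      Rm X (\<phi> X) X (\<phi> X) p = c p * (g X X p * g X X p)"
begin

lemma Rm_phi:
  assumes "X \<in> H" "Y \<in> H" "Z \<in> H" "W \<in> H"
  shows "Rm (\<phi> X) Y Z W p + Rm X (\<phi> Y) Z W p
    = e * (g X (\<phi> W) p * g Y Z p - g X (\<phi> Z) p * g Y W p
       + g X W p * g Y (\<phi> Z) p - g X Z p * g Y (\<phi> W) p)"
  using ricci_phi[OF assms(3,4,2,1), of p] assms
    g_sym[of Z X] g_sym[of W X] g_sym[of Z Y] g_sym[of W Y] g_phi_sym[of X Z] g_phi_sym[of X W]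
    g_phi_sym[of Y Z] g_phi_sym[of Y W]
  by (simp add: Rm_def algebra_simps)

text \<open>\<open>4 * Rm\<close> and \<open>K\<close> have the same defect from Kaehler symmetry
  (\<open>Rm_phi\<close>, \<open>K_phi\<close>) and agree on the pairs \<open>X\<close>,
  \<open>\<phi> X\<close>, so \<open>kaehler_curvature_eq_0\<close> applies to their
  difference.\<close>

lemma Rm_H:
  assumes "X \<in> H" "Y \<in> H" "Z \<in> H" "W \<in> H"
  shows "4 * Rm X Y Z W p = K c X Y Z W p"
proof -
  have "4 * Rm X Y Z W p - K c X Y Z W p = 0"
  proof (rule kaehler_curvature_eq_0[where H = H and J = \<phi>
        and B = "\<lambda>X Y Z W. 4 * Rm X Y Z W p - K c X Y Z W p"])
    fix X assume X: "X \<in> H"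
    have "g (\<phi> X) X p = 0"
      using g_phi_sym[of X X p] X by (simp add: phi_skew)
    then have "K c X (\<phi> X) X (\<phi> X) p = 4 * (c p * (g X X p * g X X p))"
      using X by (simp add: K_H phi_skew g_lin) (simp add: algebra_simps)
    then show "4 * Rm X (\<phi> X) X (\<phi> X) p - K c X (\<phi> X) X (\<phi> X) p = 0"
      using hol[of X p] X by simp
  next
    fix X Y Z W assume "X \<in> H" "Y \<in> H" "Z \<in> H" "W \<in> H"
    then show "4 * Rm (\<phi> X) Y Z W p - K c (\<phi> X) Y Z W p
      = - (4 * Rm X (\<phi> Y) Z W p - K c X (\<phi> Y) Z W p)"
      using K_phi[of X Y Z W c p] Rm_phi[of X Y Z W p] by (simp add: algebra_simps)
  next
    fix X Y Z W assume "X \<in> H" "Y \<in> H" "Z \<in> H" "W \<in> H"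
    then show "4 * Rm X Y Z W p - K c X Y Z W p + (4 * Rm X Z W Y p - K c X Z W Y p)
      + (4 * Rm X W Y Z p - K c X W Y Z p) = 0"
      using K_bianchi[of X Y Z W c p] first_bianchi[of X Y Z W p] by simp
  next
    fix X Y Z W assume *: "X \<in> H" "Y \<in> H" "Z \<in> H" "W \<in> H"
    then show "4 * Rm Y X Z W p - K c Y X Z W p = - (4 * Rm X Y Z W p - K c X Y Z W p)"
      using K_skew12[of X Y Z W c p] Rm_skew12[of X Y Z W p] by simp
    show "4 * Rm Z W X Y p - K c Z W X Y p = 4 * Rm X Y Z W p - K c X Y Z W p"
      using * K_pair[of X Y Z W c p] Rm_pair[of X Y Z W p] by simp
  qed (use assms in \<open>simp_all add: phi_add K_add Rm_add\<close>)
  then show ?thesis by simp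
qed

text \<open>Differentiating the formula of \<open>Rm_H\<close> replaces one argument by a covariant
  derivative, which need not be horizontal. Both sides vanish when that argument is some
  \<open>\<xi> \<alpha>\<close>, so the formula survives.\<close>

lemma Rm_F_H:
  assumes "X \<in> F" "Y \<in> H" "Z \<in> H" "W \<in> H"
  shows "4 * Rm X Y Z W p = K c X Y Z W p" "4 * Rm Y X Z W p = K c Y X Z W p"
    "4 * Rm Z W X Y p = K c Z W X Y p" "4 * Rm Z W Y X p = K c Z W Y X p"
proof -
  have "4 * Rm X Y Z W p - K c X Y Z W p = 4 * Rm (- \<phi> (\<phi> X)) Y Z W p - K c (- \<phi> (\<phi> X)) Y Z W p"
    by (rule functional_horizontal[where p = p])
      (use assms in \<open>simp_all add: Rm_add K_add Rm_smul K_smul Rm_H_xi K_xi algebra_simps\<close>)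
  moreover have "- \<phi> (\<phi> X) \<in> H"
    using H_scale[of "\<phi> (\<phi> X)" "-1"] phi_H[of "\<phi> X"] assms by simp
  ultimately show 1: "4 * Rm X Y Z W p = K c X Y Z W p"
    using assms by (simp add: Rm_H)
  show 2: "4 * Rm Y X Z W p = K c Y X Z W p"
    using 1 assms Rm_skew12[of X Y Z W p] K_skew12[of X Y Z W c p] by simp
  show "4 * Rm Z W X Y p = K c Z W X Y p" "4 * Rm Z W Y X p = K c Z W Y X p"
    using 1 2 assms Rm_pair[of Z W X Y p] K_pair[of Z W X Y c p]
      Rm_pair[of Z W Y X p] K_pair[of Z W Y X c p] by simp_all
qed

text \<open>The coefficient of \<open>c\<close> in \<open>K\<close> on horizontal fields, that is
  \<open>G1 + G2\<close>.\<close>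

definition G :: "'v \<Rightarrow> 'v \<Rightarrow> 'v \<Rightarrow> 'v \<Rightarrow> 'm \<Rightarrow> real" where
  "G X Y Z W p = g X Z p * g Y W p - g X W p * g Y Z p
     + g X (\<phi> Z) p * g Y (\<phi> W) p - g X (\<phi> W) p * g Y (\<phi> Z) p + 2 * g X (\<phi> Y) p * g Z (\<phi> W) p"

text \<open>On horizontal arguments the structure tensors behave as if they were parallel.\<close>

lemma DRm_H:
  assumes X: "X \<in> F" and H: "V \<in> H" "W \<in> H" "Y \<in> H" "Z \<in> H"
  shows "4 * DRm X V W Y Z p = der X c p * G V W Y Z p"
proof -
  \<comment> \<open>The derivative of \<open>\<phi>\<close> on horizontal fields points along
    \<open>xib\<close>, which is invisible to the horizontal \<open>U\<close>.\<close>
  have d: "g U (D X (\<phi> T)) p = g U (\<phi> (D X T)) p" if "U \<in> H" "T \<in> H" for U T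
  proof -
    have "g U (N X T) p = 0"
      using that X by (simp add: N_H g_lin)
    then show ?thesis
      using that X by (simp add: N_def g_lin)
  qed
  have h: "g (\<phi> T) (\<phi> (D X U)) p = g T (D X U) p" if "U \<in> H" "T \<in> H" for U T
    using that X by (simp add: phi_skew' g_lin)
  let ?K = "\<lambda>p. (c p + 3 * e) * (g V Y p * g W Z p - g V Z p * g W Y p)
     + (c p - e) * (g V (\<phi> Y) p * g W (\<phi> Z) p - g V (\<phi> Z) p * g W (\<phi> Y) p
     + 2 * (g V (\<phi> W) p * g Y (\<phi> Z) p))"
  have "Rm V W Y Z = (\<lambda>p. (1/4) * ?K p)"
  proof
    fix p show "Rm V W Y Z p = (1/4) * ?K p"
      using Rm_H[of V W Y Z p] K_H[of V W Y Z c p] H by (simp add: algebra_simps)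
  qed
  then have "4 * der X (Rm V W Y Z) p = 4 * der X (\<lambda>p. (1/4) * ?K p) p"
    by simp
  also have "\<dots> = der X ?K p"
    using H X by (subst der_cmult) simp_all
  also have "\<dots> = der X c p * G V W Y Z p
     + K c (D X V) W Y Z p + K c V (D X W) Y Z p + K c V W (D X Y) Z p + K c V W Y (D X Z) p"
    using H X
    by (simp add: der_add der_mult der_diff metric d K_defs G_def g_phi_H h)
      (simp add: algebra_simps)
  finally have "4 * der X (Rm V W Y Z) p = der X c p * G V W Y Z p
     + K c (D X V) W Y Z p + K c V (D X W) Y Z p + K c V W (D X Y) Z p + K c V W Y (D X Z) p" .
  then show ?thesis
    using H X Rm_F_H[of "D X V" W Y Z p] Rm_F_H[of "D X W" V Y Z p]
      Rm_F_H[of "D X Y" Z V W p] Rm_F_H[of "D X Z" Y V W p] by (simp add: DRm_def)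
qed

section \<open>Schur's argument: derivatives of the curvature function from the second Bianchi
  identity\<close>

lemma schur_H:
  assumes "X \<in> H" "Y \<in> H" "Z \<in> H" "V \<in> H" "W \<in> H"
  shows "der X c p * G V W Y Z p + der Y c p * G V W Z X p + der Z c p * G V W X Y p = 0"
  using second_bianchi[of X Y Z V W p] assms by (simp flip: DRm_H)

text \<open>The curvature itself vanishes on these arguments, so only the correction terms of
  \<open>DRm\<close> contribute: differentiating \<open>\<xi> \<alpha>\<close> brings in
  \<open>\<phi> Y\<close>, and differentiating \<open>V\<close> or \<open>W\<close> brings in a
  component along \<open>xib\<close>.\<close>

lemma DRm_H_xi:
  assumes "Y \<in> H" "Z \<in> H" "V \<in> H" "W \<in> H" "\<alpha> \<in> I"
  shows "DRm Y V W Z (\<xi> \<alpha>) p = eps \<alpha> * (e * g W Z p * g V (\<phi> Y) p - e * g V Z p * g W (\<phi> Y) p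
    + Rm V W Z (\<phi> Y) p)"
proof -
  have 0: "Rm V W Z (\<xi> \<alpha>) = (\<lambda>_. 0)"
    using assms by (auto simp: Rm_H_xi)
  have Rmx: "Rm U T Z (\<xi> \<alpha>) p = - eps \<alpha> * g T Z p * g U xib p" if "U \<in> F" "T \<in> H" for U T
    using g_R_H_xi[OF that, of Z \<alpha> p] Rm_pair[of U T Z "\<xi> \<alpha>" p] that assms by (simp add: Rm_def)
  show ?thesis
    using assms Rmx[of "D Y V" W] Rmx[of "D Y W" V] Rm_skew12[of "D Y W" V Z "\<xi> \<alpha>" p]
    by (simp add: DRm_def 0 Rm_H_xi D_xi Rm_scale Rm_minus g_D_H_xib algebra_simps)
qed

text \<open>\<open>DRm_H_xi\<close> expresses the two Bianchi terms differentiated along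
  \<open>Y\<close> and \<open>Z\<close> by horizontal curvature; in their sum the explicit formula
  makes \<open>c\<close> drop out and the multiples of \<open>e\<close> cancel.\<close>

lemma schur_xi:
  assumes "Y \<in> H" "Z \<in> H" "V \<in> H" "W \<in> H" "\<alpha> \<in> I"
  shows "der (\<xi> \<alpha>) c p * G V W Y Z p = 0"
proof -
  have "Rm V W (\<xi> \<alpha>) Y = (\<lambda>_. 0)" "Rm V W Y (\<xi> \<alpha>) = (\<lambda>_. 0)"
    using assms by (auto simp: Rm_H_xi)
  then have sk: "DRm Z V W (\<xi> \<alpha>) Y p = - DRm Z V W Y (\<xi> \<alpha>) p"
    using assms Rm_skew34[of "D Z V" W "\<xi> \<alpha>" Y p] Rm_skew34[of V "D Z W" "\<xi> \<alpha>" Y p]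
      Rm_skew34[of V W "D Z (\<xi> \<alpha>)" Y p] Rm_skew34[of V W "\<xi> \<alpha>" "D Z Y" p] by (simp add: DRm_def)
  have "4 * Rm V W Z (\<phi> Y) p - 4 * Rm V W Y (\<phi> Z) p
    = - 4 * (e * g W Z p * g V (\<phi> Y) p - e * g V Z p * g W (\<phi> Y) p
      - e * g W Y p * g V (\<phi> Z) p + e * g V Y p * g W (\<phi> Z) p)"
    using assms g_phi_sym[of Y Z p] g_sym[of Y Z] by (simp add: Rm_H K_H g_lin phi_skew algebra_simps)
  then have "e * g W Z p * g V (\<phi> Y) p - e * g V Z p * g W (\<phi> Y) p + Rm V W Z (\<phi> Y) p
    - (e * g W Y p * g V (\<phi> Z) p - e * g V Y p * g W (\<phi> Z) p + Rm V W Y (\<phi> Z) p) = 0"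
    by (simp add: algebra_simps)
  then have "DRm Y V W Z (\<xi> \<alpha>) p + DRm Z V W (\<xi> \<alpha>) Y p = 0"
    using assms by (simp add: sk DRm_H_xi flip: right_diff_distrib)
  then have "DRm (\<xi> \<alpha>) V W Y Z p = 0"
    using second_bianchi[of "\<xi> \<alpha>" Y Z V W p] assms by simp
  then show ?thesis
    using DRm_H[of "\<xi> \<alpha>" V W Y Z p] assms by simp
qed

text \<open>The second Bianchi identity for \<open>X\<close>, \<open>Y\<close>,
  \<open>\<phi> Y\<close> against the plane of \<open>Y\<close> and \<open>\<phi> Y\<close>: the
  derivative along \<open>X\<close> gets the coefficient 4 g(Y,Y)^2, and orthogonality kills the
  other two coefficients.\<close>

lemma schur_H_pair:
  assumes X: "X \<in> H" and Y: "Y \<in> H" and 0: "g X Y p = 0" "g X (\<phi> Y) p = 0" and Y0: "g Y Y p \<noteq> 0"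
  shows "der X c p = 0"
proof -
  have YY: "g Y (\<phi> Y) p = 0"
    using g_phi_sym[of Y Y p] Y by simp
  have z: "g Y X p = 0" "g Y (\<phi> X) p = 0" "g (\<phi> Y) X p = 0"
    using 0 X Y g_phi_sym[of X Y p] g_sym[of X Y] g_sym[of "\<phi> Y" X] by simp_all
  have "G Y (\<phi> Y) Y (\<phi> Y) p = 4 * (g Y Y p * g Y Y p)" "G Y (\<phi> Y) (\<phi> Y) X p = 0"
    "G Y (\<phi> Y) X Y p = 0"
    using 0 z YY X Y by (simp_all add: G_def phi_skew g_lin)
  then show ?thesis
    using schur_H[of X Y "\<phi> Y" Y "\<phi> Y" p] X Y Y0 by simp
qed

lemma schur_xi_c:
  assumes Y: "Y \<in> H" and Y0: "g Y Y p \<noteq> 0" and a: "\<alpha> \<in> I"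
  shows "der (\<xi> \<alpha>) c p = 0"
proof -
  have "g Y (\<phi> Y) p = 0"
    using g_phi_sym[of Y Y p] Y by simp
  then have "G Y (\<phi> Y) Y (\<phi> Y) p = 4 * (g Y Y p * g Y Y p)"
    using Y by (simp add: G_def phi_skew g_lin)
  then show ?thesis
    using schur_xi[of Y "\<phi> Y" Y "\<phi> Y" \<alpha> p] Y Y0 a by simp
qed

end

section \<open>Semi-Riemannian manifolds\<close>

text \<open>\<open>dim_tangent\<close> is what turns the coordinate fields into a frame; for
  S-manifolds it is established in \<open>tangent_dim\<close>.\<close>

locale semi_riemannian_manifold = smooth_manifold A
  for A :: "('m::{t2_space, second_countable_topology}, 'e::euclidean_space) atlas" +
  fixes g :: "'m \<Rightarrow> 'm tangent \<Rightarrow> 'm tangent \<Rightarrow> real"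
    and nabla :: "'m vfield \<Rightarrow> 'm vfield \<Rightarrow> 'm vfield"
  assumes metric: "semi_riemannian_metric A g" and connection: "levi_civita_connection A g nabla"
    and dim_tangent: "\<exists>C. finite C \<and> card C \<le> DIM('e) \<and> tangent_space A p \<subseteq> span C"
begin

lemma g_sym: "x \<in> tangent_space A p \<Longrightarrow> y \<in> tangent_space A p \<Longrightarrow> g p x y = g p y x"
  by (rule metric[unfolded semi_riemannian_metric_def, THEN conjunct1, rule_format])

lemma g_lin_left: "x \<in> tangent_space A p \<Longrightarrow> y \<in> tangent_space A p \<Longrightarrow> z \<in> tangent_space A p \<Longrightarrow>
    g p (a *\<^sub>R x + b *\<^sub>R y) z = a * g p x z + b * g p y z"
  by (rule metric[unfolded semi_riemannian_metric_def, THEN conjunct2, THEN conjunct1, rule_format])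

lemma g_nondeg:
  assumes "x \<in> tangent_space A p" "\<And>y. y \<in> tangent_space A p \<Longrightarrow> g p x y = 0"
  shows "x = 0"
  by (rule metric[unfolded semi_riemannian_metric_def, THEN conjunct2, THEN conjunct2, THEN conjunct1,
        rule_format, OF assms])

lemma g_smooth: "open U \<Longrightarrow> X \<in> vfields A U \<Longrightarrow> Y \<in> vfields A U \<Longrightarrow> smooth_fun A U (\<lambda>p. g p (X p) (Y p))"
  by (rule metric[unfolded semi_riemannian_metric_def, THEN conjunct2, THEN conjunct2, THEN conjunct2,
        THEN conjunct1, rule_format])

lemma g_add_left: "x \<in> tangent_space A p \<Longrightarrow> y \<in> tangent_space A p \<Longrightarrow> z \<in> tangent_space A p \<Longrightarrow>
    g p (x + y) z = g p x z + g p y z"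
  using g_lin_left[of x p y z 1 1] by simp

lemma g_scale_left: "x \<in> tangent_space A p \<Longrightarrow> z \<in> tangent_space A p \<Longrightarrow> g p (a *\<^sub>R x) z = a * g p x z"
  using g_lin_left[of x p x z a 0] by simp

lemma g_zero_left: "z \<in> tangent_space A p \<Longrightarrow> g p 0 z = 0"
  using g_scale_left[OF subspace_0[OF subspace_tangent], of z p 0] by simp

lemmas affine = connection[unfolded levi_civita_connection_def affine_connection_def,
  THEN conjunct1, rule_format]

lemma nabla_vf: "open U \<Longrightarrow> X \<in> vfields A U \<Longrightarrow> Y \<in> vfields A U \<Longrightarrow> nabla X Y \<in> vfields A U"
  by (rule affine[THEN conjunct1, rule_format])

lemma nabla_add_left: "open U \<Longrightarrow> X \<in> vfields A U \<Longrightarrow> X' \<in> vfields A U \<Longrightarrow> Y \<in> vfields A U \<Longrightarrow> p \<in> U \<Longrightarrow>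
    nabla (\<lambda>q. X q + X' q) Y p = nabla X Y p + nabla X' Y p"
  by (rule affine[THEN conjunct2, THEN conjunct1, rule_format])

lemma nabla_smul_left: "open U \<Longrightarrow> X \<in> vfields A U \<Longrightarrow> Y \<in> vfields A U \<Longrightarrow> smooth_fun A U f \<Longrightarrow> p \<in> U \<Longrightarrow>
    nabla (\<lambda>q. f q *\<^sub>R X q) Y p = f p *\<^sub>R nabla X Y p"
  by (rule affine[THEN conjunct2, THEN conjunct2, THEN conjunct1, rule_format])

lemma nabla_add_right: "open U \<Longrightarrow> X \<in> vfields A U \<Longrightarrow> Y \<in> vfields A U \<Longrightarrow> Y' \<in> vfields A U \<Longrightarrow> p \<in> U \<Longrightarrow>
    nabla X (\<lambda>q. Y q + Y' q) p = nabla X Y p + nabla X Y' p"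
  by (rule affine[THEN conjunct2, THEN conjunct2, THEN conjunct2, THEN conjunct1, rule_format])

lemma nabla_smul_right: "open U \<Longrightarrow> X \<in> vfields A U \<Longrightarrow> Y \<in> vfields A U \<Longrightarrow> smooth_fun A U f \<Longrightarrow> p \<in> U \<Longrightarrow>
    nabla X (\<lambda>q. f q *\<^sub>R Y q) p = X p f *\<^sub>R Y p + f p *\<^sub>R nabla X Y p"
  by (rule affine[THEN conjunct2, THEN conjunct2, THEN conjunct2, THEN conjunct2, rule_format])

lemma nabla_torsion: "open U \<Longrightarrow> X \<in> vfields A U \<Longrightarrow> Y \<in> vfields A U \<Longrightarrow> p \<in> U \<Longrightarrow>
    nabla X Y p - nabla Y X p = bracket A X Y p"
  by (rule connection[unfolded levi_civita_connection_def, THEN conjunct2, THEN conjunct1, rule_format])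

lemma nabla_metric: "open U \<Longrightarrow> X \<in> vfields A U \<Longrightarrow> Y \<in> vfields A U \<Longrightarrow> Z \<in> vfields A U \<Longrightarrow> p \<in> U \<Longrightarrow>
    X p (\<lambda>q. g q (Y q) (Z q)) = g p (nabla X Y p) (Z p) + g p (Y p) (nabla X Z p)"
  by (rule connection[unfolded levi_civita_connection_def, THEN conjunct2, THEN conjunct2, rule_format])

text \<open>Since the values of a function outside an open set do not affect its smoothness there, the
  tensoriality rules already imply that a connection is a local operator.\<close>

lemma nabla_zero:
  assumes "open U" "Z \<in> vfields A U" "Y \<in> vfields A U" "\<And>q. q \<in> U \<Longrightarrow> Z q = 0" "p \<in> U"
  shows "nabla Z Y p = 0" "nabla Y Z p = 0"
proof -
  \<comment> \<open>Multiplication by this function reproduces \<open>Z\<close> on the whole type,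
    while its value at \<open>p\<close> is 0.\<close>
  let ?f = "\<lambda>q. if q \<in> U then 0 else 1 :: real"
  have f: "smooth_fun A U ?f"
    using smooth_fun_cong[OF assms(1), of ?f "\<lambda>_. 0"] by simp
  have Z: "(\<lambda>q. ?f q *\<^sub>R Z q) = Z"
    by (rule ext) (simp add: assms(4))
  show "nabla Z Y p = 0"
    using nabla_smul_left[OF assms(1,2,3) f assms(5)] assms(5) unfolding Z by simp
  show "nabla Y Z p = 0"
    using nabla_smul_right[OF assms(1,3,2) f assms(5)] assms(4,5) unfolding Z by simp
qed

lemma nabla_cong:
  assumes U: "open U" "p \<in> U"
    and X: "X \<in> vfields A U" "X' \<in> vfields A U" "\<And>q. q \<in> U \<Longrightarrow> X q = X' q"
    and Y: "Y \<in> vfields A U" "Y' \<in> vfields A U" "\<And>q. q \<in> U \<Longrightarrow> Y q = Y' q"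
  shows "nabla X Y p = nabla X' Y' p"
proof -
  have diff: "(\<lambda>q. Z' q + - 1 *\<^sub>R Z q) \<in> vfields A U" if "Z \<in> vfields A U" "Z' \<in> vfields A U" for Z Z'
    using vfields_add[OF that(2) vfields_smul[OF that(1) smooth_fun_const]] .
  \<comment> \<open>Writing \<open>X'\<close> as \<open>X\<close> plus a field vanishing on
    \<open>U\<close>, and likewise for \<open>Y'\<close>, reduces the claim to
    \<open>nabla_zero\<close>.\<close>
  let ?X = "\<lambda>q. X' q + - 1 *\<^sub>R X q" and ?Y = "\<lambda>q. Y' q + - 1 *\<^sub>R Y q"
  have "(\<lambda>q. X q + ?X q) = X'" "(\<lambda>q. Y q + ?Y q) = Y'"
    by (simp_all add: fun_eq_iff)
  moreover have "nabla ?X Y p = 0"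
    by (rule nabla_zero(1)[OF U(1) diff[OF X(1,2)] Y(1) _ U(2)]) (simp add: X(3))
  moreover have "nabla X' ?Y p = 0"
    by (rule nabla_zero(2)[OF U(1) diff[OF Y(1,2)] X(2) _ U(2)]) (simp add: Y(3))
  ultimately show ?thesis
    using nabla_add_left[OF U(1) X(1) diff[OF X(1,2)] Y(1) U(2)]
      nabla_add_right[OF U(1) X(2) Y(1) diff[OF Y(1,2)] U(2)] by simp
qed

end

text \<open>\<open>W\<close> may be smaller than the chart domain \<open>U\<close>, because
  extensions of tangent vectors given on different neighbourhoods have to be compared on an
  intersection.\<close>

locale chart_domain = semi_riemannian_manifold A g nabla
  for A :: "('m::{t2_space, second_countable_topology}, 'e::euclidean_space) atlas" and g nabla +
  fixes W U :: "'m set" and \<psi> :: "'m \<Rightarrow> 'e"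
  assumes in_atlas: "(U, \<psi>) \<in> A" and W_open: "open W" and W_subset: "W \<subseteq> U"
begin

text \<open>Vector fields on \<open>W\<close> are normalised to vanish outside \<open>W\<close>, so that identities between them
  become equations.\<close>

definition restr :: "'m vfield \<Rightarrow> 'm vfield" where
  "restr X = (\<lambda>q. if q \<in> W then X q else 0)"

definition S :: "('m \<Rightarrow> real) set" where
  "S = {f. smooth_fun A W f}"

definition F :: "'m vfield set" where
  "F = {X \<in> vfields A W. \<forall>q. q \<notin> W \<longrightarrow> X q = 0}"

definition smul :: "('m \<Rightarrow> real) \<Rightarrow> 'm vfield \<Rightarrow> 'm vfield" where
  "smul f X = (\<lambda>q. f q *\<^sub>R X q)"

definition der :: "'m vfield \<Rightarrow> ('m \<Rightarrow> real) \<Rightarrow> 'm \<Rightarrow> real" where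
  "der X f = (\<lambda>p. X p f)"

definition Dr :: "'m vfield \<Rightarrow> 'm vfield \<Rightarrow> 'm vfield" where
  "Dr X Y = restr (nabla X Y)"

definition gr :: "'m vfield \<Rightarrow> 'm vfield \<Rightarrow> 'm \<Rightarrow> real" where
  "gr X Y = (\<lambda>p. g p (X p) (Y p))"

lemma F_vf: "X \<in> F \<Longrightarrow> X \<in> vfields A W"
  by (simp add: F_def)

lemma F_outside: "X \<in> F \<Longrightarrow> q \<notin> W \<Longrightarrow> X q = 0"
  by (simp add: F_def)

lemma F_tangent: "X \<in> F \<Longrightarrow> X q \<in> tangent_space A q"
  using F_outside[of X q] subspace_0[OF subspace_tangent, of q] vfields_tangent[OF F_vf, of X q]
  by (cases "q \<in> W") simp_all

lemma restr_F: "X \<in> vfields A W \<Longrightarrow> restr X \<in> F"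
  using vfields_cong[OF W_open, of X "restr X"] by (simp add: F_def restr_def)

lemma restr_eq: "q \<in> W \<Longrightarrow> restr X q = X q"
  by (simp add: restr_def)

lemma near: "f \<in> S \<Longrightarrow> p \<in> W \<Longrightarrow> smooth_near A p f"
  unfolding S_def by (auto intro: smooth_nearI[OF W_open])

definition E :: "'e \<Rightarrow> 'm vfield" where
  "E b = restr (coord U \<psi> b)"

definition x :: "'e \<Rightarrow> 'm \<Rightarrow> real" where
  "x b = (\<lambda>q. \<psi> q \<bullet> b)"

lemma E_F: "E b \<in> F"
  unfolding E_def by (rule restr_F[OF vfields_subset[OF coord_vfield[OF in_atlas] W_subset]])

lemma x_S: "x b \<in> S"
  unfolding S_def x_def by (simp add: smooth_fun_subset[OF smooth_fun_coordinate[OF in_atlas] W_subset])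

lemma tangent_E:
  assumes "p \<in> W" "v \<in> tangent_space A p"
  shows "v = (\<Sum>b\<in>Basis. v (x b) *\<^sub>R E b p)"
proof -
  obtain C where C: "finite C" "card C \<le> DIM('e)" "tangent_space A p \<subseteq> span C"
    using dim_tangent[of p] by (elim exE conjE)
  have p: "p \<in> U"
    using assms(1) W_subset by (rule subsetD[rotated])
  show ?thesis
    using tangent_coord[OF in_atlas p C assms(2)] assms(1) by (simp add: E_def x_def restr_eq)
qed

lemma F_subspace: "subspace F"
proof (rule subspaceI)
  show "0 \<in> F"
    by (simp add: F_def vfields_zero)
  fix X Y assume X: "X \<in> F" and Y: "Y \<in> F"
  have "X + Y = (\<lambda>q. X q + Y q)"
    by (rule func_plus)
  then show "X + Y \<in> F"
    using X Y vfields_add[OF F_vf[OF X] F_vf[OF Y]] by (simp add: F_def)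
next
  fix X r assume X: "X \<in> F"
  have "r *\<^sub>R X = (\<lambda>q. r *\<^sub>R X q)"
    by (rule scaleR_fun_def)
  then show "r *\<^sub>R X \<in> F"
    using X vfields_smul[OF F_vf[OF X] smooth_fun_const, of r] by (simp add: F_def)
qed

lemma smul_F: "f \<in> S \<Longrightarrow> X \<in> F \<Longrightarrow> smul f X \<in> F"
  using vfields_smul[OF F_vf, of X f] by (simp add: F_def S_def smul_def)

lemma Dr_F: "X \<in> F \<Longrightarrow> Y \<in> F \<Longrightarrow> Dr X Y \<in> F"
  unfolding Dr_def by (intro restr_F nabla_vf[OF W_open] F_vf)

lemma F_extI: "X \<in> F \<Longrightarrow> Y \<in> F \<Longrightarrow> (\<And>q. q \<in> W \<Longrightarrow> X q = Y q) \<Longrightarrow> X = Y"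
  using F_outside by (metis ext)

lemma extend_tangent:
  assumes "p \<in> W" "v \<in> tangent_space A p"
  obtains X where "X \<in> F" "X p = v"
proof
  show "(\<Sum>b\<in>Basis. v (x b) *\<^sub>R E b) \<in> F"
    by (intro subspace_sum[OF F_subspace] subspace_scale[OF F_subspace] E_F)
  show "(\<Sum>b\<in>Basis. v (x b) *\<^sub>R E b) p = v"
    using tangent_E[OF assms] by (simp add: sum_fun_apply scaleR_fun_def)
qed

sublocale mod: levi_civita_module S F smul der Dr gr
proof
  note W_open [simp]
  fix X Y Z X' f h p and r :: real
  show "(\<lambda>_. r) \<in> S"
    by (simp add: S_def)
  show "(\<lambda>p. f p + h p) \<in> S" "(\<lambda>p. f p * h p) \<in> S" if "f \<in> S" "h \<in> S"
    using that by (simp_all add: S_def smooth_fun_add smooth_fun_mult)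
  show "subspace F" by (rule F_subspace)
  show "smul f X \<in> F" if "f \<in> S" "X \<in> F" using that by (rule smul_F)
  show "smul (\<lambda>_. r) X = r *\<^sub>R X"
    by (simp add: smul_def scaleR_fun_def)
  show "der X f \<in> S" if "X \<in> F" "f \<in> S"
    using vfields_smooth[OF F_vf[OF that(1)] W_open order_refl] that(2) by (simp add: der_def S_def)
  show "der (X + Y) f p = der X f p + der Y f p"
    by (simp add: der_def)
  show "der (smul f X) h p = f p * der X h p"
    by (simp add: der_def smul_def scaleR_fun_def)
  show "der X (\<lambda>q. f q + h q) p = der X f p + der X h p"
    "der X (\<lambda>q. f q * h q) p = f p * der X h p + h p * der X f p" if "X \<in> F" "f \<in> S" "h \<in> S"
    using tangent_add[OF F_tangent[OF that(1)] near[OF that(2)] near[OF that(3)], of p]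
      tangent_mult[OF F_tangent[OF that(1)] near[OF that(2)] near[OF that(3)], of p]
      F_outside[OF that(1), of p]
    by (cases "p \<in> W"; simp add: der_def)+
  show "der X (\<lambda>_. r) p = 0" if "X \<in> F"
    using tangent_const[OF F_tangent[OF that]] by (simp add: der_def)
  show "X = 0" if X: "X \<in> F" and z: "\<And>f p. f \<in> S \<Longrightarrow> der X f p = 0"
  proof (rule F_extI[OF X subspace_0[OF F_subspace]])
    fix q assume "q \<in> W"
    then show "X q = 0 q"
      using tangent_E[OF _ F_tangent[OF X], of q] z[OF x_S] by (simp add: der_def)
  qed
  show "Dr X Y \<in> F" if "X \<in> F" "Y \<in> F" using that by (rule Dr_F)
  show "Dr (X + X') Y = Dr X Y + Dr X' Y" if "X \<in> F" "X' \<in> F" "Y \<in> F"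
  proof (rule ext)
    fix q show "Dr (X + X') Y q = (Dr X Y + Dr X' Y) q"
      using nabla_add_left[OF W_open F_vf[OF that(1)] F_vf[OF that(2)] F_vf[OF that(3)], of q]
      by (simp add: Dr_def restr_def func_plus[of X X'])
  qed
  show "Dr (smul f X) Y = smul f (Dr X Y)" if "X \<in> F" "Y \<in> F" "f \<in> S"
  proof (rule ext)
    fix q show "Dr (smul f X) Y q = smul f (Dr X Y) q"
      using nabla_smul_left[OF W_open F_vf[OF that(1)] F_vf[OF that(2)], of f q] that(3)
      by (simp add: Dr_def restr_def smul_def S_def)
  qed
  show "Dr X (Y + Z) = Dr X Y + Dr X Z" if "X \<in> F" "Y \<in> F" "Z \<in> F"
  proof (rule ext)
    fix q show "Dr X (Y + Z) q = (Dr X Y + Dr X Z) q"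
      using nabla_add_right[OF W_open F_vf[OF that(1)] F_vf[OF that(2)] F_vf[OF that(3)], of q]
      by (simp add: Dr_def restr_def func_plus[of Y Z])
  qed
  show "Dr X (smul f Y) = smul (der X f) Y + smul f (Dr X Y)" if "X \<in> F" "Y \<in> F" "f \<in> S"
  proof (rule ext)
    fix q show "Dr X (smul f Y) q = (smul (der X f) Y + smul f (Dr X Y)) q"
      using nabla_smul_right[OF W_open F_vf[OF that(1)] F_vf[OF that(2)], of f q] that(3)
        F_outside[OF that(2), of q]
      by (simp add: Dr_def restr_def smul_def S_def der_def)
  qed
  show "der (Dr X Y - Dr Y X) f p = der X (der Y f) p - der Y (der X f) p" if "X \<in> F" "Y \<in> F" "f \<in> S"
  proof (cases "p \<in> W")
    case True
    then have "nabla X Y p f - nabla Y X p f = bracket A X Y p f"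
      using nabla_torsion[OF W_open F_vf[OF that(1)] F_vf[OF that(2)] True] by (metis minus_apply)
    then show ?thesis
      using near[OF that(3) True] True by (simp add: der_def Dr_def restr_def bracket_def)
  next
    case False
    then show ?thesis
      using F_outside[OF that(1)] F_outside[OF that(2)] by (simp add: der_def Dr_def restr_def)
  qed
  show "gr X Y \<in> S" if "X \<in> F" "Y \<in> F"
    using g_smooth[OF W_open F_vf[OF that(1)] F_vf[OF that(2)]] by (simp add: gr_def S_def)
  show "gr X Y = gr Y X" if "X \<in> F" "Y \<in> F"
    unfolding gr_def by (rule ext) (rule g_sym[OF F_tangent[OF that(1)] F_tangent[OF that(2)]])
  show "gr (X + Y) Z p = gr X Z p + gr Y Z p" if "X \<in> F" "Y \<in> F" "Z \<in> F"
    using that by (simp add: gr_def g_add_left F_tangent)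
  show "gr (smul f X) Z p = f p * gr X Z p" if "X \<in> F" "Z \<in> F" "f \<in> S"
    using that by (simp add: gr_def g_scale_left F_tangent smul_def)
  show "X = 0" if X: "X \<in> F" and z: "\<And>Y p. Y \<in> F \<Longrightarrow> gr X Y p = 0"
  proof (rule F_extI[OF X subspace_0[OF F_subspace]])
    fix q assume q: "q \<in> W"
    have "X q = 0"
    proof (rule g_nondeg[OF F_tangent[OF X]])
      fix y assume "y \<in> tangent_space A q"
      with q obtain Y where "Y \<in> F" "Y q = y" by (rule extend_tangent)
      then show "g q (X q) y = 0"
        using z[of Y q] by (simp add: gr_def)
    qed
    then show "X q = 0 q" by simp
  qed
  show "der X (gr Y Z) p = gr (Dr X Y) Z p + gr Y (Dr X Z) p" if "X \<in> F" "Y \<in> F" "Z \<in> F"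
  proof (cases "p \<in> W")
    case True
    then show ?thesis
      using nabla_metric[OF W_open F_vf[OF that(1)] F_vf[OF that(2)] F_vf[OF that(3)] True]
      by (simp add: der_def gr_def Dr_def restr_def)
  next
    case False
    then show ?thesis
      using F_outside[OF that(1) False] F_outside[OF that(2) False] F_outside[OF that(3) False]
        g_zero_left[OF subspace_0[OF subspace_tangent], of p]
      by (simp add: der_def gr_def Dr_def restr_def)
  qed
qed

text \<open>Function-linear functionals are pointwise: in the coordinate frame, a field vanishing at
  \<open>p\<close> has coefficients vanishing at \<open>p\<close>.\<close>

lemma tensor_at:
  assumes p: "p \<in> W" and X: "X \<in> F" "X p = 0"
    and add: "\<And>X Y. X \<in> F \<Longrightarrow> Y \<in> F \<Longrightarrow> L (X + Y) = L X + (L Y :: real)"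
    and smul: "\<And>f X. f \<in> S \<Longrightarrow> X \<in> F \<Longrightarrow> L (smul f X) = f p * L X"
  shows "L X = 0"
proof -
  have X_eq: "X = (\<Sum>b\<in>Basis. smul (der X (x b)) (E b))"
  proof (rule F_extI[OF X(1)])
    show "(\<Sum>b\<in>Basis. smul (der X (x b)) (E b)) \<in> F"
      by (rule subspace_sum[OF F_subspace]) (rule smul_F[OF mod.der_in[OF X(1) x_S] E_F])
    show "X q = (\<Sum>b\<in>Basis. smul (der X (x b)) (E b)) q" if "q \<in> W" for q
      using tangent_E[OF that F_tangent[OF X(1)]] by (simp add: sum_fun_apply smul_def der_def)
  qed
  have L0: "L 0 = 0"
    using add[of 0 0] subspace_0[OF F_subspace] by simp
  have L: "L (\<Sum>b\<in>B. smul (der X (x b)) (E b)) = 0" for B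
  proof (induction B rule: infinite_finite_induct)
    case (insert b B)
    have sm: "smul (der X (x b)) (E b) \<in> F" for b
      by (rule smul_F[OF mod.der_in[OF X(1) x_S] E_F])
    have "L (smul (der X (x b)) (E b)) = 0"
      using smul[OF mod.der_in[OF X(1) x_S[of b]] E_F[of b]] X(2) by (simp add: der_def)
    moreover have "(\<Sum>b\<in>B. smul (der X (x b)) (E b)) \<in> F"
      by (rule subspace_sum[OF F_subspace]) (rule sm)
    ultimately show ?case
      by (simp only: sum.insert[OF insert(1,2)] add[OF sm] insert(3) add_0)
  qed (simp_all only: sum.infinite sum.empty L0 not_False_eq_True)
  show ?thesis
    using L[of Basis] unfolding X_eq[symmetric] .
qed

lemma Rm_at:
  assumes p: "p \<in> W" and F: "X \<in> F" "X' \<in> F" "Y \<in> F" "Y' \<in> F" "Z \<in> F" "Z' \<in> F" "V \<in> F" "V' \<in> F"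
    and eq: "X p = X' p" "Y p = Y' p" "Z p = Z' p" "V p = V' p"
  shows "mod.Rm X Y Z V p = mod.Rm X' Y' Z' V' p"
proof -
  have *: "L X = L X'"
    if "X \<in> F" "X' \<in> F" "X p = X' p" "\<And>X Y. X \<in> F \<Longrightarrow> Y \<in> F \<Longrightarrow> L (X + Y) = L X + (L Y :: real)"
      "\<And>f X. f \<in> S \<Longrightarrow> X \<in> F \<Longrightarrow> L (smul f X) = f p * L X" for L X X'
  proof -
    have "L (X + - X') = 0"
      by (rule tensor_at[OF p, where L = L and X = "X + - X'"]) (simp_all add: that)
    moreover have "L (- X') = - L X'"
      using that(5)[OF mod.S_const[of "-1"], of X'] mod.smul_const[of X' "-1"] that(2) by simp
    ultimately show ?thesis
      using that(4)[of X "- X'"] that(1,2) by simp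
  qed
  have "mod.Rm X Y Z V p = mod.Rm X' Y Z V p"
    by (rule *[where L = "\<lambda>X. mod.Rm X Y Z V p"]) (use F eq in \<open>simp_all add: mod.Rm_add mod.Rm_smul\<close>)
  also have "\<dots> = mod.Rm X' Y' Z V p"
    by (rule *[where L = "\<lambda>Y. mod.Rm X' Y Z V p"]) (use F eq in \<open>simp_all add: mod.Rm_add mod.Rm_smul\<close>)
  also have "\<dots> = mod.Rm X' Y' Z' V p"
    by (rule *[where L = "\<lambda>Z. mod.Rm X' Y' Z V p"]) (use F eq in \<open>simp_all add: mod.Rm_add mod.Rm_smul\<close>)
  also have "\<dots> = mod.Rm X' Y' Z' V' p"
    by (rule *[where L = "\<lambda>V. mod.Rm X' Y' Z' V p"]) (use F eq in \<open>simp_all add: mod.Rm_add mod.Rm_smul\<close>)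
  finally show ?thesis .
qed

text \<open>Transfers curvature from arbitrary fields to the normalised ones. It rests on the
  locality of \<open>nabla\<close>, used repeatedly because the inner derivatives are cut off as
  well.\<close>

lemma curvature_op_restr:
  assumes p: "p \<in> W" and vf: "X \<in> vfields A W" "Y \<in> vfields A W" "Z \<in> vfields A W" "V \<in> vfields A W"
  shows "g p (curvature_op A nabla Z V Y p) (X p) = mod.Rm (restr X) (restr Y) (restr Z) (restr V) p"
proof -
  have N: "nabla (restr Z) (restr V) q = nabla Z V q"
    if "q \<in> W" "Z \<in> vfields A W" "V \<in> vfields A W" for Z V q
    by (rule nabla_cong[OF W_open that(1)]) (use that in \<open>simp_all add: restr_eq F_vf[OF restr_F]\<close>)
  have NN: "nabla (restr Z) (Dr (restr V) (restr Y)) p = nabla Z (nabla V Y) p"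
    if "Z \<in> vfields A W" "V \<in> vfields A W" "Y \<in> vfields A W" for Z V Y
    by (rule nabla_cong[OF W_open p])
      (use that in \<open>simp_all add: restr_eq restr_F F_vf nabla_vf W_open Dr_def N\<close>)
  have br: "mod.br (restr Z) (restr V) q = bracket A Z V q" if "q \<in> W" for q
    using that vf nabla_torsion[OF W_open vf(3,4) that] by (simp add: mod.br_def Dr_def restr_eq N)
  have brF: "mod.br (restr Z) (restr V) \<in> vfields A W"
    using vf by (simp add: F_vf restr_F)
  have "nabla (mod.br (restr Z) (restr V)) (restr Y) p = nabla (bracket A Z V) Y p"
    by (rule nabla_cong[OF W_open p])
      (use vf br brF vfields_cong[OF W_open brF br] in \<open>simp_all add: restr_eq restr_F F_vf\<close>)
  then have "mod.R (restr Z) (restr V) (restr Y) p = curvature_op A nabla Z V Y p"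
    using p vf unfolding mod.R_def curvature_op_def
    by (simp add: NN Dr_def[of "restr _" "Dr _ _"] Dr_def[of "mod.br _ _"] restr_eq)
  then show ?thesis
    using p by (simp add: mod.Rm_def gr_def restr_eq)
qed

lemma curvature_tensor_eq:
  assumes p: "p \<in> W" and F: "X \<in> F" "Y \<in> F" "Z \<in> F" "V \<in> F"
  shows "curvature_tensor A g nabla p (X p) (Y p) (Z p) (V p) = mod.Rm X Y Z V p"
  unfolding curvature_tensor_def
proof (rule the_equality)
  have restr_id: "restr X = X" if "X \<in> F" for X
    by (rule F_extI) (use that in \<open>simp_all add: restr_F F_vf restr_eq\<close>)
  show "\<exists>U. open U \<and> p \<in> U \<and> (\<exists>X'\<in>vfields A U. \<exists>Y'\<in>vfields A U. \<exists>Z'\<in>vfields A U. \<exists>W'\<in>vfields A U.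
      X' p = X p \<and> Y' p = Y p \<and> Z' p = Z p \<and> W' p = V p \<and>
      mod.Rm X Y Z V p = g p (curvature_op A nabla Z' W' Y' p) (X' p))"
  proof (intro exI conjI bexI)
    show "mod.Rm X Y Z V p = g p (curvature_op A nabla Z V Y p) (X p)"
      using curvature_op_restr[OF p F_vf[OF F(1)] F_vf[OF F(2)] F_vf[OF F(3)] F_vf[OF F(4)]] F
      by (simp add: restr_id)
  qed (rule W_open p F[THEN F_vf] refl)+
  fix r assume "\<exists>U. open U \<and> p \<in> U \<and> (\<exists>X'\<in>vfields A U. \<exists>Y'\<in>vfields A U. \<exists>Z'\<in>vfields A U. \<exists>W'\<in>vfields A U.
      X' p = X p \<and> Y' p = Y p \<and> Z' p = Z p \<and> W' p = V p \<and> r = g p (curvature_op A nabla Z' W' Y' p) (X' p))"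
  then obtain U' X' Y' Z' V' where U': "open U'" "p \<in> U'" and
    vf: "X' \<in> vfields A U'" "Y' \<in> vfields A U'" "Z' \<in> vfields A U'" "V' \<in> vfields A U'" and
    eq: "X' p = X p" "Y' p = Y p" "Z' p = Z p" "V' p = V p"
      and r: "r = g p (curvature_op A nabla Z' V' Y' p) (X' p)"
    by (elim exE conjE bexE)
  \<comment> \<open>A competing system of extensions lives on another neighbourhood
    \<open>U'\<close>; on \<open>W \<inter> U'\<close> both systems belong to the same module, where
    \<open>Rm_at\<close> compares them by their values at \<open>p\<close>. This makes the definite
    description meaningful.\<close>
  interpret small: chart_domain A g nabla "W \<inter> U'" U \<psi>
    by unfold_locales (use in_atlas W_open U'(1) W_subset in \<open>auto\<close>)
  have p': "p \<in> W \<inter> U'" using p U' by simp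
  note sub = vfields_subset[OF _ Int_lower1] vfields_subset[OF _ Int_lower2]
  have vf': "X' \<in> vfields A (W \<inter> U')" "Y' \<in> vfields A (W \<inter> U')" "Z' \<in> vfields A (W \<inter> U')" "V' \<in> vfields A (W \<inter> U')"
    using vf by (auto intro: sub(2))
  have vf0: "X \<in> vfields A (W \<inter> U')" "Y \<in> vfields A (W \<inter> U')" "Z \<in> vfields A (W \<inter> U')" "V \<in> vfields A (W \<inter> U')"
    using F[THEN F_vf] by (auto intro: sub(1))
  have "r = small.mod.Rm (small.restr X') (small.restr Y') (small.restr Z') (small.restr V') p"
    unfolding r by (rule small.curvature_op_restr[OF p' vf'])
  also have "\<dots> = small.mod.Rm (small.restr X) (small.restr Y) (small.restr Z) (small.restr V) p"
    by (rule small.Rm_at[OF p']) (use vf' vf0 eq p' in \<open>simp_all add: small.restr_F small.restr_eq\<close>)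
  also have "\<dots> = g p (curvature_op A nabla Z V Y p) (X p)"
    by (rule small.curvature_op_restr[OF p' vf0, symmetric])
  also have "\<dots> = mod.Rm X Y Z V p"
    using curvature_op_restr[OF p F_vf[OF F(1)] F_vf[OF F(2)] F_vf[OF F(3)] F_vf[OF F(4)]] F
    by (simp add: restr_id)
  finally show "r = mod.Rm X Y Z V p" .
qed

end

section \<open>Indefinite S-manifolds\<close>

locale indefinite_S_manifold_connection =
  fixes n s :: nat and A :: "('m::{t2_space, second_countable_topology}, 'e::euclidean_space) atlas"
    and \<phi> :: "'m \<Rightarrow> 'm tangent \<Rightarrow> 'm tangent" and \<xi> :: "nat \<Rightarrow> 'm vfield"
    and \<eta> :: "nat \<Rightarrow> 'm \<Rightarrow> 'm tangent \<Rightarrow> real"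
    and g :: "'m \<Rightarrow> 'm tangent \<Rightarrow> 'm tangent \<Rightarrow> real"
    and nabla :: "'m vfield \<Rightarrow> 'm vfield \<Rightarrow> 'm vfield"
  assumes n_pos: "n \<ge> 1" and S_manifold: "indefinite_S_manifold n s A \<phi> \<xi> \<eta> g"
    and levi_civita: "levi_civita_connection A g nabla"
begin

section \<open>Pointwise algebra of the structure\<close>

lemmas indefinite_gff = S_manifold[unfolded indefinite_S_manifold_def, THEN conjunct1,
  unfolded indefinite_gff_manifold_def]

lemmas gff = indefinite_gff[THEN conjunct1, unfolded gff_manifold_def]

lemma connected_UNIV: "connected (UNIV :: 'm set)"
  by (rule gff[THEN conjunct1])

lemma atlas: "smooth_atlas A"
  by (rule gff[THEN conjunct2, THEN conjunct1])

lemma dimension: "DIM('e) = 2 * n + s"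
  by (rule gff[THEN conjunct2, THEN conjunct2, THEN conjunct1])

lemma s_pos: "s \<ge> 1"
  by (rule gff[THEN conjunct2, THEN conjunct2, THEN conjunct2, THEN conjunct1])

lemma phi_tangent: "x \<in> tangent_space A p \<Longrightarrow> \<phi> p x \<in> tangent_space A p"
  by (rule gff[THEN conjunct2, THEN conjunct2, THEN conjunct2, THEN conjunct2, THEN conjunct1, unfolded tensor_1_1_def, THEN conjunct1, rule_format])

lemma phi_lin: "x \<in> tangent_space A p \<Longrightarrow> y \<in> tangent_space A p \<Longrightarrow>
    \<phi> p (a *\<^sub>R x + b *\<^sub>R y) = a *\<^sub>R \<phi> p x + b *\<^sub>R \<phi> p y"
  by (rule gff[THEN conjunct2, THEN conjunct2, THEN conjunct2, THEN conjunct2, THEN conjunct1, unfolded tensor_1_1_def, THEN conjunct2, THEN conjunct1, rule_format])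

lemma phi_vf: "open U \<Longrightarrow> X \<in> vfields A U \<Longrightarrow> (\<lambda>p. \<phi> p (X p)) \<in> vfields A U"
  by (rule gff[THEN conjunct2, THEN conjunct2, THEN conjunct2, THEN conjunct2, THEN conjunct1, unfolded tensor_1_1_def, THEN conjunct2, THEN conjunct2, rule_format])

lemma xi_vf: "\<alpha> \<in> {1..s} \<Longrightarrow> \<xi> \<alpha> \<in> vfields A UNIV"
  by (rule gff[THEN conjunct2, THEN conjunct2, THEN conjunct2, THEN conjunct2, THEN conjunct2, THEN conjunct1, rule_format])

lemma rank: "dim (\<phi> p ` tangent_space A p) = 2 * n"
  by (rule gff[THEN conjunct2, THEN conjunct2, THEN conjunct2, THEN conjunct2, THEN conjunct2, THEN conjunct2, THEN conjunct2, THEN conjunct1, rule_format])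

lemma phi_cube: "x \<in> tangent_space A p \<Longrightarrow> \<phi> p (\<phi> p (\<phi> p x)) + \<phi> p x = 0"
  by (rule gff[THEN conjunct2, THEN conjunct2, THEN conjunct2, THEN conjunct2, THEN conjunct2, THEN conjunct2, THEN conjunct2, THEN conjunct2, THEN conjunct1, rule_format])

lemma xi_independent: "(\<Sum>\<alpha>=1..s. a \<alpha> *\<^sub>R \<xi> \<alpha> p) = 0 \<Longrightarrow> \<alpha> \<in> {1..s} \<Longrightarrow> a \<alpha> = 0"
  by (rule gff[THEN conjunct2, THEN conjunct2, THEN conjunct2, THEN conjunct2, THEN conjunct2, THEN conjunct2, THEN conjunct2, THEN conjunct2, THEN conjunct2, THEN conjunct1, rule_format])

lemma phi_sq: "x \<in> tangent_space A p \<Longrightarrow> \<phi> p (\<phi> p x) = - x + (\<Sum>\<alpha>=1..s. \<eta> \<alpha> p x *\<^sub>R \<xi> \<alpha> p)"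
  by (rule gff[THEN conjunct2, THEN conjunct2, THEN conjunct2, THEN conjunct2, THEN conjunct2, THEN conjunct2, THEN conjunct2, THEN conjunct2, THEN conjunct2, THEN conjunct2, THEN conjunct1, rule_format])

lemma eta_xi: "\<alpha> \<in> {1..s} \<Longrightarrow> \<beta> \<in> {1..s} \<Longrightarrow> \<eta> \<alpha> p (\<xi> \<beta> p) = (if \<alpha> = \<beta> then 1 else 0)"
  by (rule gff[THEN conjunct2, THEN conjunct2, THEN conjunct2, THEN conjunct2, THEN conjunct2, THEN conjunct2, THEN conjunct2, THEN conjunct2, THEN conjunct2, THEN conjunct2, THEN conjunct2, rule_format])

lemma metric: "semi_riemannian_metric A g"
  by (rule indefinite_gff[THEN conjunct2, THEN conjunct1])

lemma xi_unit: "\<alpha> \<in> {1..s} \<Longrightarrow> (\<forall>p. g p (\<xi> \<alpha> p) (\<xi> \<alpha> p) = 1) \<or> (\<forall>p. g p (\<xi> \<alpha> p) (\<xi> \<alpha> p) = - 1)"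
  by (rule indefinite_gff[THEN conjunct2, THEN conjunct2, THEN conjunct1, THEN bspec])

lemma compatible: "x \<in> tangent_space A p \<Longrightarrow> y \<in> tangent_space A p \<Longrightarrow> g p (\<phi> p x) (\<phi> p y)
    = g p x y - (\<Sum>\<alpha>=1..s. g p (\<xi> \<alpha> p) (\<xi> \<alpha> p) * \<eta> \<alpha> p x * \<eta> \<alpha> p y)"
  by (rule indefinite_gff[THEN conjunct2, THEN conjunct2, THEN conjunct2, rule_format])

lemma normal: "open U \<Longrightarrow> X \<in> vfields A U \<Longrightarrow> Y \<in> vfields A U \<Longrightarrow> p \<in> U \<Longrightarrow>
    nijenhuis A \<phi> X Y p + 2 *\<^sub>R (\<Sum>\<alpha>=1..s. ext_deriv A (\<eta> \<alpha>) X Y p *\<^sub>R \<xi> \<alpha> p) = 0"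
  by (rule S_manifold[unfolded indefinite_S_manifold_def normal_gff_def, THEN conjunct2, THEN conjunct1, rule_format])

lemma ext_deriv_eta: "\<alpha> \<in> {1..s} \<Longrightarrow> open U \<Longrightarrow> X \<in> vfields A U \<Longrightarrow> Y \<in> vfields A U \<Longrightarrow> p \<in> U \<Longrightarrow>
    g p (X p) (\<phi> p (Y p)) = ext_deriv A (\<eta> \<alpha>) X Y p"
  by (rule S_manifold[unfolded indefinite_S_manifold_def fundamental_form_def, THEN conjunct2, THEN conjunct2, rule_format])

sublocale smooth_manifold A
  by standard (rule atlas)

lemma xi_tangent: "\<alpha> \<in> {1..s} \<Longrightarrow> \<xi> \<alpha> p \<in> tangent_space A p"
  by (rule vfields_tangent[OF xi_vf UNIV_I])

lemma phi_add: "x \<in> tangent_space A p \<Longrightarrow> y \<in> tangent_space A p \<Longrightarrow> \<phi> p (x + y) = \<phi> p x + \<phi> p y"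
  using phi_lin[of x p y 1 1] by simp

lemma phi_scale: "x \<in> tangent_space A p \<Longrightarrow> \<phi> p (a *\<^sub>R x) = a *\<^sub>R \<phi> p x"
  using phi_lin[of x p x a 0] by simp

lemma phi_zero: "\<phi> p 0 = 0"
  using phi_scale[OF subspace_0[OF subspace_tangent], of p 0] by simp

lemma phi_minus: "x \<in> tangent_space A p \<Longrightarrow> \<phi> p (- x) = - \<phi> p x"
  using phi_scale[of x p "-1"] by simp

lemma phi_xi: assumes a: "\<alpha> \<in> {1..s}" shows "\<phi> p (\<xi> \<alpha> p) = 0"
proof -
  have "(\<Sum>\<beta>=1..s. \<eta> \<beta> p (\<xi> \<alpha> p) *\<^sub>R \<xi> \<beta> p) = (\<Sum>\<beta>=1..s. if \<beta> = \<alpha> then \<xi> \<alpha> p else 0)"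
    by (rule sum.cong) (simp_all only: eta_xi[OF _ a] if_distrib[of "\<lambda>r. r *\<^sub>R _"] scaleR_one scaleR_zero_left cong: if_cong)
  also have "\<dots> = \<xi> \<alpha> p"
    using a by (simp only: sum.delta[OF finite_atLeastAtMost] if_True)
  finally have "\<phi> p (\<phi> p (\<xi> \<alpha> p)) = 0"
    by (simp only: phi_sq[OF xi_tangent[OF a]] left_minus)
  then show ?thesis
    using phi_cube[OF xi_tangent[OF a], of p] by (simp only: phi_zero add_0)
qed

text \<open>Computing the cube of \<open>\<phi>\<close> through \<open>phi_sq\<close> at
  \<open>\<phi> p x\<close> leaves a vanishing combination of the independent
  \<open>\<xi> \<alpha> p\<close> with exactly these coefficients.\<close>

lemma eta_phi:
  assumes x: "x \<in> tangent_space A p" and a: "\<alpha> \<in> {1..s}"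
  shows "\<eta> \<alpha> p (\<phi> p x) = 0"
proof (rule xi_independent[of "\<lambda>\<alpha>. \<eta> \<alpha> p (\<phi> p x)", OF _ a])
  have "- \<phi> p x + (\<Sum>\<alpha>=1..s. \<eta> \<alpha> p (\<phi> p x) *\<^sub>R \<xi> \<alpha> p) + \<phi> p x = 0"
    using phi_cube[OF x] unfolding phi_sq[OF phi_tangent[OF x]] .
  then show "(\<Sum>\<alpha>=1..s. \<eta> \<alpha> p (\<phi> p x) *\<^sub>R \<xi> \<alpha> p) = 0"
    by (simp only: add.commute[of _ "\<phi> p x"] add_minus_cancel)
qed

text \<open>Solving \<open>phi_sq\<close> for \<open>x\<close> puts every tangent vector in the span
  of the image of \<open>\<phi> p\<close>, of dimension 2n, and the s vectors
  \<open>\<xi> \<alpha> p\<close>.\<close>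

lemma tangent_dim: "\<exists>C. finite C \<and> card C \<le> DIM('e) \<and> tangent_space A p \<subseteq> span C"
proof -
  obtain B where B: "B \<subseteq> \<phi> p ` tangent_space A p" "\<phi> p ` tangent_space A p \<subseteq> span B" "card B = 2 * n"
    by (rule real_vector.basis_exists[of "\<phi> p ` tangent_space A p"]) (simp only: rank)
  \<comment> \<open>An infinite set also has \<open>card\<close> 0, so finiteness is concluded from
    2n > 0.\<close>
  have fin: "finite B"
    using B(3) n_pos card_ge_0_finite[of B] by linarith
  let ?C = "B \<union> (\<lambda>\<alpha>. \<xi> \<alpha> p) ` {1..s}"
  have "card ?C \<le> card B + card ((\<lambda>\<alpha>. \<xi> \<alpha> p) ` {1..s})"
    by (rule card_Un_le)
  also have "\<dots> \<le> 2 * n + s"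
    using card_image_le[of "{1..s}" "\<lambda>\<alpha>. \<xi> \<alpha> p"] B(3) by simp
  finally have card: "card ?C \<le> DIM('e)"
    by (simp only: dimension)
  have "x \<in> span ?C" if x: "x \<in> tangent_space A p" for x
  proof -
    have 1: "\<phi> p (\<phi> p x) \<in> span ?C"
      by (rule subsetD[OF span_mono[OF Un_upper1] subsetD[OF B(2) imageI[OF phi_tangent[OF x]]]])
    have 2: "(\<Sum>\<alpha>=1..s. \<eta> \<alpha> p x *\<^sub>R \<xi> \<alpha> p) \<in> span ?C"
      by (intro span_sum span_scale span_base UnI2 imageI)
    have "x = (\<Sum>\<alpha>=1..s. \<eta> \<alpha> p x *\<^sub>R \<xi> \<alpha> p) - \<phi> p (\<phi> p x)"
      by (simp only: phi_sq[OF x]) (simp only: diff_minus_eq_add minus_add_distrib diff_conv_add_uminus minus_minus add.commute[of x] add_minus_cancel add_0 add.assoc minus_add_cancel)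
    then show ?thesis
      using span_diff[OF 2 1] by (simp only:)
  qed
  then have "tangent_space A p \<subseteq> span ?C" ..
  with fin card show ?thesis
    by (intro exI[of _ ?C] conjI) (simp_all only: finite_Un finite_imageI finite_atLeastAtMost)
qed

sublocale semi_riemannian_manifold A g nabla
  by standard (rule metric levi_civita tangent_dim)+

definition eps :: "nat \<Rightarrow> real" where
  "eps \<alpha> = (if \<forall>p. g p (\<xi> \<alpha> p) (\<xi> \<alpha> p) = 1 then 1 else - 1)"

lemma g_xi_xi_same: "\<alpha> \<in> {1..s} \<Longrightarrow> g p (\<xi> \<alpha> p) (\<xi> \<alpha> p) = eps \<alpha>"
  using xi_unit[of \<alpha>] by (auto simp: eps_def)

lemma eps_sq: "eps \<alpha> * eps \<alpha> = 1"
  by (simp add: eps_def)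

lemma g_add_right: "x \<in> tangent_space A p \<Longrightarrow> y \<in> tangent_space A p \<Longrightarrow> z \<in> tangent_space A p \<Longrightarrow>
    g p z (x + y) = g p z x + g p z y"
  by (simp only: g_sym[of z] subspace_add[OF subspace_tangent] g_add_left)

lemma g_scale_right: "x \<in> tangent_space A p \<Longrightarrow> z \<in> tangent_space A p \<Longrightarrow> g p z (a *\<^sub>R x) = a * g p z x"
  by (simp only: g_sym[of z] subspace_scale[OF subspace_tangent] g_scale_left)

lemma g_zero_right: "z \<in> tangent_space A p \<Longrightarrow> g p z 0 = 0"
  using g_scale_right[OF subspace_0[OF subspace_tangent], of z p 0] by simp

lemma g_minus_right: "x \<in> tangent_space A p \<Longrightarrow> z \<in> tangent_space A p \<Longrightarrow> g p z (- x) = - g p z x"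
  using g_scale_right[of x p z "-1"] by simp

lemma g_sum_right:
  assumes "z \<in> tangent_space A p" "\<And>i. i \<in> I \<Longrightarrow> f i \<in> tangent_space A p"
  shows "g p z (\<Sum>i\<in>I. f i) = (\<Sum>i\<in>I. g p z (f i))"
  using assms(2)
proof (induction I rule: infinite_finite_induct)
  case (insert i I)
  have "sum f I \<in> tangent_space A p"
    by (rule subspace_sum[OF subspace_tangent]) (simp add: insert.prems)
  then show ?case
    using insert.IH insert.prems
    by (simp only: sum.insert[OF insert.hyps] g_add_right[OF insert.prems[OF insertI1] _ assms(1)] insertI2)
qed (simp_all only: sum.infinite sum.empty g_zero_right[OF assms(1)] not_False_eq_True)

text \<open>Compatibility with \<open>\<xi> \<alpha> p\<close> as one argument, where
  \<open>\<phi> p\<close> vanishes, collapses the sum to a single term.\<close>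

lemma g_xi:
  assumes x: "x \<in> tangent_space A p" and a: "\<alpha> \<in> {1..s}"
  shows "g p x (\<xi> \<alpha> p) = eps \<alpha> * \<eta> \<alpha> p x"
proof -
  have "0 = g p x (\<xi> \<alpha> p) - (\<Sum>\<beta>=1..s. g p (\<xi> \<beta> p) (\<xi> \<beta> p) * \<eta> \<beta> p x * \<eta> \<beta> p (\<xi> \<alpha> p))"
    using compatible[OF x xi_tangent[OF a]] by (simp only: phi_xi[OF a] g_zero_right[OF phi_tangent[OF x]])
  also have "(\<Sum>\<beta>=1..s. g p (\<xi> \<beta> p) (\<xi> \<beta> p) * \<eta> \<beta> p x * \<eta> \<beta> p (\<xi> \<alpha> p))
     = (\<Sum>\<beta>=1..s. if \<beta> = \<alpha> then eps \<alpha> * \<eta> \<alpha> p x else 0)"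
    by (rule sum.cong) (simp_all add: eta_xi[OF _ a] g_xi_xi_same[OF a])
  also have "\<dots> = eps \<alpha> * \<eta> \<alpha> p x"
    using a by (simp add: sum.delta)
  finally show ?thesis by simp
qed

text \<open>Compatibility at \<open>x\<close> and \<open>\<phi> p y\<close>, where the one-form
  terms vanish by \<open>eta_phi\<close>; the part of \<open>\<phi> p (\<phi> p y)\<close> along the
  \<open>\<xi> \<alpha> p\<close> is orthogonal to \<open>\<phi> p x\<close>.\<close>

lemma phi_skew:
  assumes x: "x \<in> tangent_space A p" and y: "y \<in> tangent_space A p"
  shows "g p (\<phi> p x) y = - g p x (\<phi> p y)"
proof -
  have T: "\<phi> p x \<in> tangent_space A p" "- y \<in> tangent_space A p"
    "(\<Sum>\<alpha>=1..s. \<eta> \<alpha> p y *\<^sub>R \<xi> \<alpha> p) \<in> tangent_space A p"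
    by (rule phi_tangent[OF x], rule subspace_neg[OF subspace_tangent y],
        rule subspace_sum[OF subspace_tangent], rule subspace_scale[OF subspace_tangent], rule xi_tangent)
  have "g p (\<phi> p x) (\<Sum>\<alpha>=1..s. \<eta> \<alpha> p y *\<^sub>R \<xi> \<alpha> p) = (\<Sum>\<alpha>=1..s. g p (\<phi> p x) (\<eta> \<alpha> p y *\<^sub>R \<xi> \<alpha> p))"
    by (rule g_sum_right[OF T(1)]) (rule subspace_scale[OF subspace_tangent xi_tangent])
  also have "\<dots> = 0"
    by (rule sum.neutral) (simp add: g_scale_right[OF xi_tangent T(1)] g_xi[OF T(1)] eta_phi[OF x])
  finally have 0: "g p (\<phi> p x) (\<Sum>\<alpha>=1..s. \<eta> \<alpha> p y *\<^sub>R \<xi> \<alpha> p) = 0" .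
  have "g p (\<phi> p x) (\<phi> p (\<phi> p y)) = g p x (\<phi> p y)"
    using compatible[OF x phi_tangent[OF y]] by (simp add: eta_phi[OF y])
  moreover have "g p (\<phi> p x) (\<phi> p (\<phi> p y)) = - g p (\<phi> p x) y"
    by (simp only: phi_sq[OF y] g_add_right[OF T(2,3,1)] 0 g_minus_right[OF y T(1)] add_0_right)
  ultimately show ?thesis by simp
qed

end

section \<open>The S-structure and the curvature hypothesis on a chart domain\<close>

locale S_chart = indefinite_S_manifold_connection n s A \<phi> \<xi> \<eta> g nabla
  for n s :: nat and A :: "('m::{t2_space, second_countable_topology}, 'e::euclidean_space) atlas"
    and \<phi> \<xi> \<eta> g nabla +
  fixes U :: "'m set" and \<psi> :: "'m \<Rightarrow> 'e" and c :: "'m \<Rightarrow> real"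
  assumes in_atlas: "(U, \<psi>) \<in> A"
    and c_smooth: "smooth_fun A UNIV c"
    and c_curvature: "pointwise_constant_phi_curvature A \<phi> g nabla c"
begin

lemma U_open: "open U"
  by (rule chart_open[OF in_atlas])

sublocale chart_domain A g nabla U U \<psi>
  by standard (rule in_atlas U_open order_refl)+

definition phi' :: "'m vfield \<Rightarrow> 'm vfield" where
  "phi' X = (\<lambda>q. \<phi> q (X q))"

definition xi' :: "nat \<Rightarrow> 'm vfield" where
  "xi' \<alpha> = restr (\<xi> \<alpha>)"

lemma phi'_F: "X \<in> F \<Longrightarrow> phi' X \<in> F"
  using phi_vf[OF U_open F_vf, of X] F_outside[of X] by (simp add: F_def phi'_def phi_zero)

lemma xi'_F: "\<alpha> \<in> {1..s} \<Longrightarrow> xi' \<alpha> \<in> F"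
  unfolding xi'_def by (rule restr_F[OF vfields_subset[OF xi_vf subset_UNIV]])

lemma xi'_eq: "p \<in> U \<Longrightarrow> xi' \<alpha> p = \<xi> \<alpha> p"
  by (simp add: xi'_def restr_eq)

lemma gr_xi': "X \<in> F \<Longrightarrow> \<alpha> \<in> {1..s} \<Longrightarrow> p \<in> U \<Longrightarrow> gr X (xi' \<alpha>) p = eps \<alpha> * \<eta> \<alpha> p (X p)"
  by (simp only: gr_def xi'_eq g_xi[OF F_tangent])

lemma eta_gr:
  assumes "X \<in> F" "\<alpha> \<in> {1..s}" "p \<in> U"
  shows "\<eta> \<alpha> p (X p) = eps \<alpha> * gr X (xi' \<alpha>) p"
  by (simp only: gr_xi'[OF assms] mult.assoc[symmetric] eps_sq mult_1)

lemma der_outside: "X \<in> F \<Longrightarrow> p \<notin> U \<Longrightarrow> der X f p = 0"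
  by (simp add: der_def F_outside)

lemma gr_outside: "X \<in> F \<Longrightarrow> Y \<in> F \<Longrightarrow> p \<notin> U \<Longrightarrow> gr X Y p = 0"
  unfolding gr_def by (subst F_outside, assumption+) (rule g_zero_left[OF F_tangent])

lemma br_eq: "X \<in> F \<Longrightarrow> Y \<in> F \<Longrightarrow> p \<in> U \<Longrightarrow> mod.br X Y p = bracket A X Y p"
  using nabla_torsion[OF U_open F_vf F_vf, of X Y p] by (simp add: mod.br_def Dr_def restr_eq)

lemma der_eta:
  assumes X: "X \<in> F" and Y: "Y \<in> F" and a: "\<alpha> \<in> {1..s}" and p: "p \<in> U"
  shows "X p (\<lambda>q. \<eta> \<alpha> q (Y q)) = eps \<alpha> * der X (gr Y (xi' \<alpha>)) p"
proof -
  have "X p (\<lambda>q. \<eta> \<alpha> q (Y q)) = X p (\<lambda>q. eps \<alpha> * gr Y (xi' \<alpha>) q)"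
    by (rule tangent_cong[OF F_tangent[OF X] U_open p]) (rule eta_gr[OF Y a])
  also have "\<dots> = eps \<alpha> * der X (gr Y (xi' \<alpha>)) p"
    using mod.der_cmult[OF X mod.g_in[OF Y xi'_F[OF a]]] by (simp add: der_def)
  finally show ?thesis .
qed

lemma ext_deriv_gr:
  assumes X: "X \<in> F" and Y: "Y \<in> F" and a: "\<alpha> \<in> {1..s}" and p: "p \<in> U"
  shows "gr X (phi' Y) p = ext_deriv A (\<eta> \<alpha>) X Y p"
  using ext_deriv_eta[OF a U_open F_vf[OF X] F_vf[OF Y] p] by (simp only: gr_def phi'_def)

sublocale st: s_structure_module S F smul der Dr gr phi' xi' eps "{1..s}"
proof
  fix X Y and \<alpha> \<beta> :: nat and p
  show "phi' X \<in> F" if "X \<in> F" using that by (rule phi'_F)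
  show "xi' \<alpha> \<in> F" if "\<alpha> \<in> {1..s}" using that by (rule xi'_F)
  show "gr (phi' X) Y p = - gr X (phi' Y) p" if "X \<in> F" "Y \<in> F"
    unfolding gr_def phi'_def by (rule phi_skew[OF F_tangent[OF that(1)] F_tangent[OF that(2)]])
  show "phi' (phi' X) = - X + (\<Sum>\<alpha>=1..s. smul (\<lambda>p. eps \<alpha> * gr X (xi' \<alpha>) p) (xi' \<alpha>))" if X: "X \<in> F"
  proof (rule ext)
    fix q
    have "(\<Sum>\<alpha>=1..s. smul (\<lambda>p. eps \<alpha> * gr X (xi' \<alpha>) p) (xi' \<alpha>)) q
      = (\<Sum>\<alpha>=1..s. (eps \<alpha> * gr X (xi' \<alpha>) q) *\<^sub>R xi' \<alpha> q)"
      by (simp only: sum_fun_apply smul_def)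
    also have "\<dots> = (\<Sum>\<alpha>=1..s. \<eta> \<alpha> q (X q) *\<^sub>R \<xi> \<alpha> q)" if "q \<in> U"
      by (rule sum.cong) (simp_all only: eta_gr[OF X _ that] xi'_eq[OF that])
    finally have in_U: "(\<Sum>\<alpha>=1..s. smul (\<lambda>p. eps \<alpha> * gr X (xi' \<alpha>) p) (xi' \<alpha>)) q
      = (\<Sum>\<alpha>=1..s. \<eta> \<alpha> q (X q) *\<^sub>R \<xi> \<alpha> q)" if "q \<in> U"
      using that .
    show "phi' (phi' X) q = (- X + (\<Sum>\<alpha>=1..s. smul (\<lambda>p. eps \<alpha> * gr X (xi' \<alpha>) p) (xi' \<alpha>))) q"
    proof (cases "q \<in> U")
      case True
      then show ?thesis
        by (simp only: plus_fun_apply in_U uminus_apply phi'_def phi_sq[OF F_tangent[OF X]])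
    next
      case False
      have "- X + (\<Sum>\<alpha>=1..s. smul (\<lambda>p. eps \<alpha> * gr X (xi' \<alpha>) p) (xi' \<alpha>)) \<in> F"
        by (rule mod.F_simps(2)[OF mod.F_simps(4)[OF X] subspace_sum[OF F_subspace
              smul_F[OF mod.S_mult[OF mod.S_const mod.g_in[OF X xi'_F]] xi'_F]]])
      then show ?thesis
        by (rule trans[OF F_outside[OF phi'_F[OF phi'_F[OF X]] False] F_outside[OF _ False, symmetric]])
    qed
  qed
  show "phi' (xi' \<alpha>) = 0" if "\<alpha> \<in> {1..s}"
  proof (rule F_extI[OF phi'_F[OF xi'_F[OF that]] subspace_0[OF F_subspace]])
    show "phi' (xi' \<alpha>) q = 0 q" if "q \<in> U" for q
      using phi_xi[OF \<open>\<alpha> \<in> {1..s}\<close>, of q] by (simp only: phi'_def xi'_eq[OF that] zero_fun_apply)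
  qed
  show "{1..s} \<noteq> {}"
    using s_pos by simp
  show "eps \<alpha> * eps \<alpha> = 1"
    by (rule eps_sq)
  show "der X (gr (xi' \<alpha>) (xi' \<beta>)) p = 0"
    if X: "X \<in> F" and a: "\<alpha> \<in> {1..s}" and b: "\<beta> \<in> {1..s}"
  proof (cases "p \<in> U")
    case True
    have "X p (gr (xi' \<alpha>) (xi' \<beta>)) = X p (\<lambda>_. eps \<beta> * (if \<beta> = \<alpha> then 1 else 0))"
    proof (rule tangent_cong[OF F_tangent[OF X] U_open True])
      show "gr (xi' \<alpha>) (xi' \<beta>) q = eps \<beta> * (if \<beta> = \<alpha> then 1 else 0)" if q: "q \<in> U" for q
        by (simp only: gr_xi'[OF xi'_F[OF a] b q] xi'_eq[OF q] eta_xi[OF b a])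
    qed
    then show ?thesis
      using tangent_const[OF F_tangent[OF X]] by (simp only: der_def)
  qed (simp add: der_outside X)
  show "der X (gr Y (xi' \<alpha>)) p - der Y (gr X (xi' \<alpha>)) p - gr (mod.br X Y) (xi' \<alpha>) p
      = 2 * eps \<alpha> * gr X (phi' Y) p" if X: "X \<in> F" and Y: "Y \<in> F" and a: "\<alpha> \<in> {1..s}"
  proof (cases "p \<in> U")
    case True
    have "2 * gr X (phi' Y) p = eps \<alpha> * (der X (gr Y (xi' \<alpha>)) p - der Y (gr X (xi' \<alpha>)) p - gr (mod.br X Y) (xi' \<alpha>) p)"
      using eta_gr[OF mod.br_in[OF X Y] a True]
      by (simp add: ext_deriv_gr[OF X Y a True] ext_deriv_def der_eta[OF X Y a True] der_eta[OF Y X a True]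
          br_eq[OF X Y True] right_diff_distrib)
    then have "eps \<alpha> * (2 * gr X (phi' Y) p) = eps \<alpha> * eps \<alpha> *
       (der X (gr Y (xi' \<alpha>)) p - der Y (gr X (xi' \<alpha>)) p - gr (mod.br X Y) (xi' \<alpha>) p)"
      by simp
    then show ?thesis
      by (simp add: eps_sq)
  next
    case False
    show ?thesis
      using der_outside[OF X False] der_outside[OF Y False] gr_outside[OF X phi'_F[OF Y] False]
        gr_outside[OF mod.br_in[OF X Y] xi'_F[OF a] False] by simp
  qed
  show "mod.br (phi' X) (phi' Y) + phi' (phi' (mod.br X Y)) - phi' (mod.br (phi' X) Y)
     - phi' (mod.br X (phi' Y)) + smul (\<lambda>p. 2 * gr X (phi' Y) p) (\<Sum>\<alpha>=1..s. xi' \<alpha>) = 0"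
    if X: "X \<in> F" and Y: "Y \<in> F"
  proof (rule F_extI)
    note [simp] = phi'_F xi'_F
    show "mod.br (phi' X) (phi' Y) + phi' (phi' (mod.br X Y)) - phi' (mod.br (phi' X) Y)
     - phi' (mod.br X (phi' Y)) + smul (\<lambda>p. 2 * gr X (phi' Y) p) (\<Sum>\<alpha>=1..s. xi' \<alpha>) \<in> F"
      by (rule mod.F_simps(2)[OF _ smul_F[OF mod.S_mult[OF mod.S_const mod.g_in[OF X phi'_F[OF Y]]]
              subspace_sum[OF F_subspace xi'_F]]]) (use X Y in simp)
    fix q assume q: "q \<in> U"
    have "2 *\<^sub>R (\<Sum>\<alpha>=1..s. ext_deriv A (\<eta> \<alpha>) X Y q *\<^sub>R \<xi> \<alpha> q)
       = (2 * gr X (phi' Y) q) *\<^sub>R (\<Sum>\<alpha>=1..s. xi' \<alpha> q)"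
      unfolding scaleR_sum_right scaleR_scaleR
      by (rule sum.cong) (simp_all only: ext_deriv_gr[OF X Y _ q] xi'_eq[OF q])
    moreover have "nijenhuis A \<phi> X Y q = mod.br (phi' X) (phi' Y) q + phi' (phi' (mod.br X Y)) q
        - phi' (mod.br (phi' X) Y) q - phi' (mod.br X (phi' Y)) q"
      using br_eq[OF X Y q] br_eq[OF phi'_F[OF X] Y q] br_eq[OF X phi'_F[OF Y] q]
        br_eq[OF phi'_F[OF X] phi'_F[OF Y] q]
      by (simp add: nijenhuis_def phi'_def add.commute)
    ultimately show "(mod.br (phi' X) (phi' Y) + phi' (phi' (mod.br X Y)) - phi' (mod.br (phi' X) Y)
     - phi' (mod.br X (phi' Y)) + smul (\<lambda>p. 2 * gr X (phi' Y) p) (\<Sum>\<alpha>=1..s. xi' \<alpha>)) q = 0 q"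
      using normal[OF U_open F_vf[OF X] F_vf[OF Y] q]
      by (simp add: smul_def sum_fun_apply)
  qed (rule subspace_0[OF F_subspace])
qed

lemma H_tangent: "X \<in> st.H \<Longrightarrow> \<phi> p (\<phi> p (X p)) = - X p"
  using fun_cong[OF st.H_sq[of X], of p] by (simp only: phi'_def uminus_apply)

lemma extend_horizontal:
  assumes p: "p \<in> U" and v: "v \<in> tangent_space A p"
  obtains X where "X \<in> st.H" "X p = - \<phi> p (\<phi> p v)"
proof -
  obtain Y where Y: "Y \<in> F" "Y p = v"
    using p v by (rule extend_tangent)
  show ?thesis
  proof
    show "(- 1) *\<^sub>R phi' (phi' Y) \<in> st.H"
      by (rule st.H_scale[OF st.phi_H[OF phi'_F[OF Y(1)]]])
    show "((- 1) *\<^sub>R phi' (phi' Y)) p = - \<phi> p (\<phi> p v)"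
      by (simp add: phi'_def Y(2))
  qed
qed

text \<open>For horizontal \<open>X\<close> the product with a field depends only on the horizontal
  part of that field, so nondegeneracy passes to horizontal fields.\<close>

lemma gr_horizontal_eq_0:
  assumes X: "X \<in> st.H" and p: "p \<in> U" and z: "\<And>Y. Y \<in> st.H \<Longrightarrow> gr X Y p = 0"
  shows "X p = 0"
proof (rule g_nondeg[OF F_tangent[OF st.H_in[OF X]]])
  fix v assume v: "v \<in> tangent_space A p"
  obtain V where V: "V \<in> F" "V p = v"
    using p v by (rule extend_tangent)
  have "gr X (phi' (phi' V)) p = 0"
    by (rule z[OF st.phi_H[OF phi'_F[OF V(1)]]])
  then have "gr X V p = 0"
    using X V(1) by (simp add: st.phi_skew' mod.g_lin)
  then show "g p (X p) v = 0"
    by (simp only: gr_def V(2))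
qed

lemma holomorphic_curvature_nonnull:
  assumes X: "X \<in> st.H" and p: "p \<in> U" and nz: "gr X X p \<noteq> 0"
  shows "mod.Rm X (phi' X) X (phi' X) p = c p * (gr X X p * gr X X p)"
proof -
  let ?r = "gr X X p"
  \<comment> \<open>This factor makes \<open>X\<close> a unit vector at \<open>p\<close> only, which
    is all that the pointwise hypothesis asks for.\<close>
  define a where "a = 1 / sqrt \<bar>?r\<bar>"
  let ?X = "a *\<^sub>R X"
  have r: "\<bar>?r\<bar> > 0" using nz by simp
  have a2: "a * a = 1 / \<bar>?r\<bar>"
    using r by (simp add: a_def field_simps)
  have H: "?X \<in> st.H" "?X \<in> F"
    using X by simp_all
  have im: "?X p \<in> \<phi> p ` tangent_space A p"
  proof
    have T: "phi' ?X p \<in> tangent_space A p"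
      by (rule F_tangent[OF phi'_F[OF H(2)]])
    show "- phi' ?X p \<in> tangent_space A p"
      by (rule subspace_neg[OF subspace_tangent T])
    show "?X p = \<phi> p (- phi' ?X p)"
      using H_tangent[OF H(1), of p] by (simp only: phi_minus[OF T]) (simp only: phi'_def minus_minus)
  qed
  have g: "gr ?X ?X p = ?r / \<bar>?r\<bar>" "gr (phi' ?X) (phi' ?X) p = ?r / \<bar>?r\<bar>" "gr ?X (phi' ?X) p = 0"
  proof -
    show 1: "gr ?X ?X p = ?r / \<bar>?r\<bar>"
      using X a2 by (simp add: mod.g_lin mult.assoc[symmetric])
    show "gr (phi' ?X) (phi' ?X) p = ?r / \<bar>?r\<bar>"
      using 1 st.g_phi_H[OF H(2,1), of p] by simp
    show "gr ?X (phi' ?X) p = 0"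
      using st.g_phi_sym[OF H(2,2), of p] by simp
  qed
  \<comment> \<open>\<open>?X p\<close> and its image under \<open>\<phi> p\<close> have the same
    square +1 or -1 and are orthogonal, so the denominator of the sectional curvature is 1 for
    either sign.\<close>
  have sgn: "(?r / \<bar>?r\<bar>) * (?r / \<bar>?r\<bar>) = 1"
    using r by simp
  have g': "g p (?X p) (?X p) = ?r / \<bar>?r\<bar>" "g p (phi' ?X p) (phi' ?X p) = ?r / \<bar>?r\<bar>"
     "g p (?X p) (phi' ?X p) = 0"
    using g by (simp_all only: gr_def)
  have unit: "\<bar>g p (?X p) (?X p)\<bar> = 1"
    unfolding g'(1) using r by simp
  have sec: "sectional_curvature A g nabla p (?X p) (\<phi> p (?X p)) = c p"
    using c_curvature[unfolded pointwise_constant_phi_curvature_def, rule_format, OF im unit] .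
  have ct: "curvature_tensor A g nabla p (?X p) (phi' ?X p) (?X p) (phi' ?X p)
     = mod.Rm ?X (phi' ?X) ?X (phi' ?X) p"
    by (rule curvature_tensor_eq[OF p H(2) phi'_F[OF H(2)] H(2) phi'_F[OF H(2)]])
  have "mod.Rm ?X (phi' ?X) ?X (phi' ?X) p = c p"
    using sec ct g' sgn unfolding sectional_curvature_def phi'_def[of ?X, THEN fun_cong, of p, symmetric]
    by simp
  moreover have "mod.Rm ?X (phi' ?X) ?X (phi' ?X) p = (a * a) * (a * a) * mod.Rm X (phi' X) X (phi' X) p"
    using X by (simp add: st.phi_scale mod.Rm_scale phi'_F mult.assoc)
  ultimately have "c p = mod.Rm X (phi' X) X (phi' X) p / (\<bar>?r\<bar> * \<bar>?r\<bar>)"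
    unfolding a2 by simp
  then show ?thesis
    using r by (simp add: field_simps)
qed

text \<open>Null vectors are limits of non-null ones, so the curvature hypothesis extends to them.\<close>

lemma holomorphic_curvature:
  assumes X: "X \<in> st.H"
  shows "mod.Rm X (phi' X) X (phi' X) p = c p * (gr X X p * gr X X p)"
proof (cases "p \<in> U")
  case p: True
  show ?thesis
  proof (cases "gr X X p = 0 \<and> X p \<noteq> 0")
    case True
    have "\<exists>Y\<in>st.H. gr X Y p \<noteq> 0"
    proof (rule ccontr)
      assume "\<not> (\<exists>Y\<in>st.H. gr X Y p \<noteq> 0)"
      then have "X p = 0"
        by (intro gr_horizontal_eq_0[OF X p]) simp
      with True show False by simp
    qed
    then obtain Y where Y: "Y \<in> st.H" and XY: "gr X Y p \<noteq> 0"
      by (rule bexE)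
    \<comment> \<open>The defect of the claim along the line \<open>X + t *\<^sub>R Y\<close>, a
      polynomial in \<open>t\<close>. The choice of \<open>Y\<close> makes these fields non-null at
      \<open>p\<close> for all small nonzero \<open>t\<close>, so \<open>f\<close> vanishes there
      and hence at 0.\<close>
    define f where "f t = mod.Rm (X + t *\<^sub>R Y) (phi' (X + t *\<^sub>R Y)) (X + t *\<^sub>R Y) (phi' (X + t *\<^sub>R Y)) p
      - c p * (gr (X + t *\<^sub>R Y) (X + t *\<^sub>R Y) p * gr (X + t *\<^sub>R Y) (X + t *\<^sub>R Y) p)" for t :: real
    have g: "gr (X + t *\<^sub>R Y) (X + t *\<^sub>R Y) p = t * (2 * gr X Y p + t * gr Y Y p)" for t
      using X Y True by (simp add: mod.g_lin mod.g_sym[of Y X] algebra_simps)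
    have f: "f t = mod.Rm X (phi' X) X (phi' X) p
      + t * (mod.Rm X (phi' X) X (phi' Y) p + mod.Rm X (phi' X) Y (phi' X) p
        + mod.Rm X (phi' Y) X (phi' X) p + mod.Rm Y (phi' X) X (phi' X) p)
      + t * t * (mod.Rm X (phi' X) Y (phi' Y) p + mod.Rm X (phi' Y) X (phi' Y) p
        + mod.Rm X (phi' Y) Y (phi' X) p + mod.Rm Y (phi' X) X (phi' Y) p
        + mod.Rm Y (phi' X) Y (phi' X) p + mod.Rm Y (phi' Y) X (phi' X) p)
      + t * t * t * (mod.Rm X (phi' Y) Y (phi' Y) p + mod.Rm Y (phi' X) Y (phi' Y) p
        + mod.Rm Y (phi' Y) X (phi' Y) p + mod.Rm Y (phi' Y) Y (phi' X) p)
      + t * t * t * t * mod.Rm Y (phi' Y) Y (phi' Y) p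
      - c p * (t * (2 * gr X Y p + t * gr Y Y p) * (t * (2 * gr X Y p + t * gr Y Y p)))" for t
      unfolding f_def g using X Y
      by (simp add: st.phi_add st.phi_scale mod.Rm_add mod.Rm_scale) (simp add: algebra_simps)
    have "continuous (at 0) f"
      unfolding f by (intro continuous_intros)
    then have lim: "(f \<longlongrightarrow> f 0) (at 0)"
      by (simp add: continuous_at)
    have "continuous (at 0) (\<lambda>t. 2 * gr X Y p + t * gr Y Y p)"
      by (intro continuous_intros)
    then have "((\<lambda>t. 2 * gr X Y p + t * gr Y Y p) \<longlongrightarrow> 2 * gr X Y p) (at 0)"
      by (simp add: continuous_at)
    then have "\<forall>\<^sub>F t in at 0. 2 * gr X Y p + t * gr Y Y p \<noteq> 0"
      by (rule tendsto_imp_eventually_ne) (use XY in simp)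
    then have "\<forall>\<^sub>F t in at 0. f t = 0"
      using eventually_neq_at_within[of "0::real" 0 UNIV]
    proof eventually_elim
      case (elim t)
      then have "gr (X + t *\<^sub>R Y) (X + t *\<^sub>R Y) p \<noteq> 0"
        by (simp add: g)
      then show ?case
        using holomorphic_curvature_nonnull[of "X + t *\<^sub>R Y" p] X Y p by (simp add: f_def)
    qed
    then have "(f \<longlongrightarrow> 0) (at 0)"
      by (rule tendsto_eventually)
    then have "f 0 = 0"
      using lim by (intro tendsto_unique[OF _ lim]) simp_all
    then show ?thesis
      using True by (simp add: f)
  next
    case False
    show ?thesis
    proof (cases "gr X X p = 0")
      case True
      with False have X0: "X p = 0" by simp
      have "mod.Rm X (phi' X) X (phi' X) p = mod.Rm (0 *\<^sub>R X) (phi' X) X (phi' X) p"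
        using X by (intro Rm_at[OF p]) (simp_all add: X0 phi'_F)
      also have "\<dots> = 0"
        using X by (subst mod.Rm_scale) (simp_all add: phi'_F)
      finally show ?thesis
        using True by simp
    next
      case nz: False
      then show ?thesis
        using holomorphic_curvature_nonnull[OF X p] by simp
    qed
  qed
next
  case False
  then show ?thesis
    using X by (simp add: mod.Rm_def gr_outside phi'_F)
qed

sublocale sf: s_space_form_module S F smul der Dr gr phi' xi' eps "{1..s}" c
proof
  show "c \<in> S"
    unfolding S_def using smooth_fun_subset[OF c_smooth subset_UNIV] by simp
  show "mod.Rm X (phi' X) X (phi' X) p = c p * (gr X X p * gr X X p)"
    if "X \<in> F" "phi' (phi' X) = - X" for X p
    using that by (intro holomorphic_curvature) (unfold st.H_def, simp)
qed

section \<open>Vanishing of all derivatives of the curvature function\<close>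

lemma der_at: "X \<in> F \<Longrightarrow> X p = v \<Longrightarrow> der X c p = v c"
  by (simp add: der_def)

text \<open>If every horizontal field were null at \<open>p\<close>, polarisation would make the
  metric zero on horizontal vectors; nondegeneracy then forces \<open>\<phi> p\<close> to vanish on
  the tangent space, against rank 2n > 0.\<close>

lemma exists_nonnull:
  assumes p: "p \<in> U"
  shows "\<exists>Y\<in>st.H. gr Y Y p \<noteq> 0"
proof (rule ccontr)
  assume "\<not> ?thesis"
  then have null: "gr Y Y p = 0" if "Y \<in> st.H" for Y
    using that by simp
  have XY: "gr X Y p = 0" if "X \<in> st.H" "Y \<in> st.H" for X Y
    using null[of "X + Y"] null[of X] null[of Y] that by (simp add: mod.g_lin mod.g_sym[of Y X])
  have "\<phi> p x = 0" if x: "x \<in> tangent_space A p" for x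
  proof -
    obtain X where X: "X \<in> st.H" "X p = - \<phi> p (\<phi> p (\<phi> p x))"
      using p phi_tangent[OF x] by (rule extend_horizontal)
    have "X p = 0"
      by (rule gr_horizontal_eq_0[OF X(1) p XY[OF X(1)]])
    then show ?thesis
      using X(2) phi_cube[OF x] by simp
  qed
  then have "\<phi> p ` tangent_space A p \<subseteq> span {}"
    by (intro image_subsetI) simp
  then have "dim (\<phi> p ` tangent_space A p) \<le> card ({} :: 'm tangent set)"
    by (rule real_vector.dim_le_card) simp
  then show False
    using rank[of p] n_pos by simp
qed

text \<open>Otherwise the orthogonal complement of the \<open>\<phi>\<close>-plane of \<open>X\<close> in the horizontal space would be
  totally null, hence zero, and the horizontal space would be that plane.\<close>

lemma exists_orthogonal_nonnull:
  assumes n: "n \<ge> 2" and p: "p \<in> U" and X: "X \<in> st.H" and X0: "gr X X p \<noteq> 0"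
  shows "\<exists>Y\<in>st.H. gr X Y p = 0 \<and> gr X (phi' Y) p = 0 \<and> gr Y Y p \<noteq> 0"
proof (rule ccontr)
  assume "\<not> ?thesis"
  then have null: "gr Y Y p = 0" if "Y \<in> st.H" "gr X Y p = 0" "gr X (phi' Y) p = 0" for Y
    using that by simp
  let ?r = "gr X X p"
  \<comment> \<open>Coefficients of the projection onto the orthogonal complement of
    \<open>X\<close> and \<open>phi' X\<close>; the sign of \<open>b\<close> differs because
    \<open>gr X (phi' (phi' X)) p = - ?r\<close>.\<close>
  define a where "a Y = - gr X Y p / ?r" for Y
  define b where "b Y = gr X (phi' Y) p / ?r" for Y
  define pr where "pr Y = Y + (a Y *\<^sub>R X + b Y *\<^sub>R phi' X)" for Y
  have Xf: "gr X (phi' X) p = 0" "gr (phi' X) X p = 0" "gr (phi' X) (phi' X) p = ?r"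
    using st.g_phi_sym[of X X p] st.g_phi_H[of X X p] X by (simp_all add: st.phi_skew)
  have pr: "pr Y \<in> st.H" "gr X (pr Y) p = 0" "gr X (phi' (pr Y)) p = 0" if "Y \<in> st.H" for Y
    using that X X0 Xf
    by (simp_all add: pr_def mod.g_lin st.phi_add st.phi_scale phi'_F) (simp_all add: a_def b_def)
  have zero: "pr Y p = 0" if Y: "Y \<in> st.H" for Y
  proof (rule gr_horizontal_eq_0[OF pr(1)[OF Y] p])
    fix Z assume Z: "Z \<in> st.H"
    let ?Y = "pr Y" and ?Z = "pr Z"
    have "gr (?Y + ?Z) (?Y + ?Z) p = 0"
      by (rule null) (simp_all add: X pr[OF Y] pr[OF Z] mod.g_lin st.phi_add phi'_F)
    moreover have "gr ?Y ?Y p = 0" "gr ?Z ?Z p = 0"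
      using null[OF pr[OF Y]] null[OF pr[OF Z]] .
    ultimately have 1: "gr ?Y ?Z p = 0"
      using pr(1)[OF Y] pr(1)[OF Z] by (simp add: mod.g_lin mod.g_sym[of ?Z ?Y])
    have 2: "gr ?Y X p = 0" "gr ?Y (phi' X) p = 0"
      using pr[OF Y] X mod.g_sym[of ?Y X] st.g_phi_sym[of X ?Y p] by simp_all
    have "gr ?Y ?Z p = gr ?Y Z p + a Z * gr ?Y X p + b Z * gr ?Y (phi' X) p"
      unfolding pr_def[of Z] using pr(1)[OF Y] X Z by (simp add: mod.g_lin phi'_F)
    then show "gr ?Y Z p = 0"
      using 1 2 by simp
  qed
  have "\<phi> p ` tangent_space A p \<subseteq> span {X p, phi' X p}"
  proof (rule image_subsetI)
    fix x assume x: "x \<in> tangent_space A p"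
    obtain Y where Y: "Y \<in> st.H" "Y p = - \<phi> p (\<phi> p (\<phi> p x))"
      using p phi_tangent[OF x] by (rule extend_horizontal)
    have "Y p + (a Y *\<^sub>R X p + b Y *\<^sub>R phi' X p) = 0"
      using zero[OF Y(1)] by (simp only: pr_def plus_fun_apply scaleR_fun_def)
    then have "Y p = - (a Y *\<^sub>R X p + b Y *\<^sub>R phi' X p)"
      by (simp only: eq_neg_iff_add_eq_0)
    moreover have "- (a Y *\<^sub>R X p + b Y *\<^sub>R phi' X p) \<in> span {X p, phi' X p}"
      by (intro span_neg span_add span_scale span_base) simp_all
    moreover have "\<phi> p (\<phi> p (\<phi> p x)) = - \<phi> p x"
      using phi_cube[OF x] by (simp only: eq_neg_iff_add_eq_0)
    then have "\<phi> p x = Y p"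
      by (simp only: Y(2) minus_minus)
    ultimately show "\<phi> p x \<in> span {X p, phi' X p}"
      by (simp only:)
  qed
  \<comment> \<open>The rank would be at most 2, whereas it is 2n with n \<ge> 2.\<close>
  then have "dim (\<phi> p ` tangent_space A p) \<le> card {X p, phi' X p}"
    by (rule real_vector.dim_le_card) simp
  also have "\<dots> \<le> 2"
    by (simp add: card_insert_le_m1)
  finally show False
    using rank[of p] n by simp
qed

lemma horizontal_derivative_nonnull:
  assumes n: "n \<ge> 2" and p: "p \<in> U" and X: "X \<in> st.H" and X0: "gr X X p \<noteq> 0"
  shows "der X c p = 0"
proof -
  obtain Y where "Y \<in> st.H" "gr X Y p = 0 \<and> gr X (phi' Y) p = 0 \<and> gr Y Y p \<noteq> 0"
    using exists_orthogonal_nonnull[OF assms] by (rule bexE)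
  then show ?thesis
    using sf.schur_H_pair[OF X, of Y p] by simp
qed

text \<open>For \<open>X\<close> null at \<open>p\<close>, a non-null \<open>Y\<close> helps: the
  squared lengths of \<open>X + Y\<close> and \<open>X - Y\<close> add up to twice that of
  \<open>Y\<close>, so one of the two is non-null, and the derivatives along it and along
  \<open>Y\<close> both vanish.\<close>

lemma horizontal_derivative:
  assumes n: "n \<ge> 2" and p: "p \<in> U" and X: "X \<in> st.H"
  shows "der X c p = 0"
proof (cases "gr X X p = 0")
  case True
  obtain Y where Y: "Y \<in> st.H" "gr Y Y p \<noteq> 0"
    using exists_nonnull[OF p] by (rule bexE)
  have add: "der (X + t *\<^sub>R Y) c p = der X c p + t * der Y c p" for t
    using X Y by (simp add: mod.der_add_left mod.der_scale_left)
  have g: "gr (X + t *\<^sub>R Y) (X + t *\<^sub>R Y) p = 2 * t * gr X Y p + t * t * gr Y Y p" for t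
    using X Y True by (simp add: mod.g_lin mod.g_sym[of Y X] algebra_simps)
  have "gr (X + 1 *\<^sub>R Y) (X + 1 *\<^sub>R Y) p \<noteq> 0 \<or> gr (X + (-1) *\<^sub>R Y) (X + (-1) *\<^sub>R Y) p \<noteq> 0"
    unfolding g using Y(2) by linarith
  then obtain t where "gr (X + t *\<^sub>R Y) (X + t *\<^sub>R Y) p \<noteq> 0"
    by (elim disjE)
  then have "der (X + t *\<^sub>R Y) c p = 0"
    using X Y by (intro horizontal_derivative_nonnull[OF n p]) simp_all
  then show ?thesis
    using horizontal_derivative_nonnull[OF n p Y] by (simp only: add)
next
  case False
  with n p X show ?thesis
    by (rule horizontal_derivative_nonnull)
qed

text \<open>The components along the \<open>\<xi> \<alpha>\<close> are handled by
  \<open>schur_xi_c\<close> and the horizontal part by \<open>horizontal_derivative\<close>; a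
  non-null \<open>Y\<close> from \<open>exists_nonnull\<close> feeds the former.\<close>

lemma tangent_derivative:
  assumes n: "n \<ge> 2" and p: "p \<in> U" and v: "v \<in> tangent_space A p"
  shows "v c = 0"
proof -
  obtain Y where Y: "Y \<in> st.H" "gr Y Y p \<noteq> 0"
    using exists_nonnull[OF p] by (rule bexE)
  obtain X where X: "X \<in> F" "X p = v"
    using p v by (rule extend_tangent)
  have "der X c p = der (- phi' (phi' X)) c p"
  proof (rule st.functional_horizontal[where p = p])
    show "der (xi' \<alpha>) c p = 0" if "\<alpha> \<in> {1..s}" for \<alpha>
      using Y(1,2) that by (rule sf.schur_xi_c)
    show "der (V + W) c p = der V c p + der W c p" if "V \<in> F" "W \<in> F" for V W
      using that sf.c_in by (rule mod.der_add_left)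
    show "der (smul f V) c p = f p * der V c p" if "f \<in> S" "V \<in> F" for f V
      using that(2,1) sf.c_in by (rule mod.der_smul)
  qed (rule X(1))
  also have "\<dots> = 0"
    using horizontal_derivative[OF n p, of "phi' (phi' X)"] st.phi_H[of "phi' X"] X(1)
    by (simp add: mod.der_minus_left phi'_F)
  finally show ?thesis
    by (simp only: der_at[OF X])
qed

end

theorem theorem3p2:
  fixes A :: "('m::{t2_space, second_countable_topology}, 'e::euclidean_space) atlas"
    and \<phi> :: "'m \<Rightarrow> 'm tangent \<Rightarrow> 'm tangent"
    and \<xi> :: "nat \<Rightarrow> 'm vfield"
    and \<eta> :: "nat \<Rightarrow> 'm \<Rightarrow> 'm tangent \<Rightarrow> real"
    and g :: "'m \<Rightarrow> 'm tangent \<Rightarrow> 'm tangent \<Rightarrow> real"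
    and nabla :: "'m vfield \<Rightarrow> 'm vfield \<Rightarrow> 'm vfield"
    and c :: "'m \<Rightarrow> real"
    and n s :: nat
  assumes "n \<ge> 2" and "s \<ge> 1"
    and "indefinite_S_manifold n s A \<phi> \<xi> \<eta> g"
    and "levi_civita_connection A g nabla"
    and "smooth_fun A UNIV c"
    and "pointwise_constant_phi_curvature A \<phi> g nabla c"
  shows "c constant_on UNIV \<and> indefinite_S_space_form n s A \<phi> \<xi> \<eta> g nabla"
proof -
  interpret indefinite_S_manifold_connection n s A \<phi> \<xi> \<eta> g nabla
    using assms by unfold_locales simp_all
  have zero: "v c = 0" if v: "v \<in> tangent_space A p" for p v
  proof -
    obtain U \<psi> where U: "(U, \<psi>) \<in> A" "p \<in> U"
      using chart_ex[of p] by (elim exE conjE)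
    interpret S_chart n s A \<phi> \<xi> \<eta> g nabla U \<psi> c
      using U(1) assms(5,6) by unfold_locales
    show ?thesis
      using assms(1) U(2) v by (rule tangent_derivative)
  qed
  have const: "c p = c q" for p q
    by (rule constant_if_tangent_zero[OF connected_UNIV assms(5)]) (rule zero)
  have "c constant_on UNIV"
    unfolding constant_on_def using const by blast
  \<comment> \<open>\<open>undefined\<close> serves as an arbitrary base point, so that the common
    value of \<open>c\<close> becomes the witness in the definition of a space form.\<close>
  moreover have "c = (\<lambda>_. c undefined)"
    using const by blast
  then have "pointwise_constant_phi_curvature A \<phi> g nabla (\<lambda>_. c undefined)"
    using assms(6) by (simp only:)
  then have "indefinite_S_space_form n s A \<phi> \<xi> \<eta> g nabla"
    unfolding indefinite_S_space_form_def using assms(3) by (intro conjI exI)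
  ultimately show ?thesis ..
qed

end
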